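(* The process $X=2K-B=(2K(t)-B(t))_{t\ge 0}$ is not a Markov process. Equivalently, $X$ does not have the same law as the $\mathrm{BES}(5)$ process started at $0$.
   Context: Let $B$ be a standard one-dimensional Brownian motion with $B(0)=0$, and let $K$ be its concave majorant on $[0,\infty)$, i.e. the pointwise smallest concave function $c:[0,\infty)\to\mathbb R$ with $c\ge B$ (almost surely it exists, is increasing and piecewise linear, with infinitely many linear segments accumulating only at $0$ and $\infty$). The $\mathrm{BES}(n)$ process is the Euclidean norm of an $n$-dimensional standard Brownian motion; $\mathrm{BES}(5)$ started at $0$ is a Markov process. *)

theory Defs
  imports "HOL-Probability.Probability"
begin

definition brownian_motion :: "'a measure \<Rightarrow> (real \<Rightarrow> 'a \<Rightarrow> real) \<Rightarrow> bool" where
  "brownian_motion M B \<longleftrightarrow>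
     prob_space M \<and>
     (\<forall>t\<ge>0. B t \<in> borel_measurable M) \<and>
     (\<forall>\<omega>\<in>space M. B 0 \<omega> = 0 \<and> continuous_on {0..} (\<lambda>t. B t \<omega>)) \<and>
     (\<forall>s t. 0 \<le> s \<longrightarrow> s < t \<longrightarrow>
        distributed M lborel (\<lambda>\<omega>. B t \<omega> - B s \<omega>) (\<lambda>x. ennreal (normal_density 0 (sqrt (t - s)) x))) \<and>
     (\<forall>(ts :: nat \<Rightarrow> real) n. 0 \<le> ts 0 \<longrightarrow> (\<forall>i<n. ts i < ts (Suc i)) \<longrightarrow>
        prob_space.indep_vars M (\<lambda>_. borel) (\<lambda>i \<omega>. B (ts (Suc i)) \<omega> - B (ts i) \<omega>) {..<n})"

definition concave_majorant :: "(real \<Rightarrow> real) \<Rightarrow> real \<Rightarrow> real" where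
  "concave_majorant f t =
     Inf {c t | c. concave_on {0..} c \<and> (\<forall>s\<ge>0. f s \<le> c s)}"

definition gen_sigma :: "'a measure \<Rightarrow> (real \<Rightarrow> 'a \<Rightarrow> real) \<Rightarrow> real set \<Rightarrow> 'a measure" where
  "gen_sigma M X I =
     sigma (space M) (\<Union>r\<in>I. {X r -` A \<inter> space M | A. A \<in> sets borel})"

definition markov_process :: "'a measure \<Rightarrow> (real \<Rightarrow> 'a \<Rightarrow> real) \<Rightarrow> bool" where
  "markov_process M X \<longleftrightarrow>
     (\<forall>t\<ge>0. X t \<in> borel_measurable M) \<and>
     (\<forall>s t A. 0 \<le> s \<longrightarrow> s \<le> t \<longrightarrow> A \<in> sets borel \<longrightarrow>
        (AE \<omega> in M.
           real_cond_exp M (gen_sigma M X {0..s}) (indicator {\<omega>\<in>space M. X t \<omega> \<in> A}) \<omega> =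
           real_cond_exp M (gen_sigma M X {s}) (indicator {\<omega>\<in>space M. X t \<omega> \<in> A}) \<omega>))"

end

theory Submission
  imports Defs
begin

text \<open>If \<open>X\<close> were Markov, then \<open>{X 1 \<le> \<delta>}\<close> and \<open>{X 8 \<le> \<delta>}\<close> would be conditionally independent given \<open>X 6\<close>.
  Since \<open>K \<ge> B\<close>, the event \<open>X r \<le> \<delta>\<close> gives \<open>K r \<le> \<delta>\<close>, and as \<open>K\<close> is concave with \<open>K 0 = 0\<close> the path then
  stays below \<open>\<delta> u / r\<close> at all times \<open>u \<ge> r\<close>. Remaining below a line of slope \<open>\<delta>\<close> forever is expensive, but when
  both events occur this price is paid only once: together with \<open>X 6 \<in> [1, 3/2]\<close> they have probability at least
  \<open>c \<delta>^8\<close>. Separately, \<open>X 8 \<le> \<delta>\<close> has probability \<open>O(\<delta>^(17/4))\<close>, and \<open>X 1 \<le> \<delta>\<close> has conditional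
  probability \<open>O(\<delta>^4)\<close> given \<open>X 6 \<in> [1, 3/2]\<close>. The product \<open>O(\<delta>^(33/4))\<close> is too small; the proof takes
  \<open>\<delta> = \<epsilon>^4\<close> to avoid fractional powers.

  For the conditional bound, the law of \<open>X 6\<close> needs a density that is bounded below on \<open>[1, 3/2]\<close> and that is
  \<open>O(\<delta>^4)\<close> on the event \<open>X 1 \<le> \<delta>\<close>. Both follow from Cameron-Martin shifts of the path that move
  \<open>X 6\<close> at a definite speed: a ramp on \<open>[2, 7]\<close> if the chord realising \<open>K 6\<close> has an endpoint near 6, and a
  tent on \<open>[5, 7]\<close>, which leaves \<open>K 6\<close> alone, if it does not.\<close>

section \<open>Independence of increments\<close>

text \<open>The exponent 8 is made up of 3 up to time 1 (a window of width \<delta>, and a distance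
  of order \<delta> to the barrier at both ends), 1 for leaving, 2 for returning at time 8 and 2 for
  staying low ever after. The upper bounds keep just enough of this: 3 + 1 for
  \<open>X 1 \<le> \<delta>\<close>, as only the path up to time 2 may be used if shifts on
  \<open>[2, 7]\<close> are to leave the event alone, and 3 + 1 + 1/4 for
  \<open>X 8 \<le> \<delta>\<close>, the 1/4 coming from a horizon of length
  \<open>1 / \<delta>\<close>. Any gain beyond 4 is enough there.

  Two obstacles shape the rest. Exit probabilities are needed without a strong Markov property; they
  are computed on dyadic grids and passed to the limit. And \<open>concave_majorant\<close> is an
  infimum over an uncountable family whose response to a shift depends on the path: measurability of
  \<open>X\<close> is taken from the Markov hypothesis, \<open>X 6\<close> is replaced almost surely
  by a countable supremum of chords, and no density is ever constructed, only measures of Borel sets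
  are compared.\<close>

locale brownian = prob_space M for M :: "'a measure" +
  fixes B :: "real \<Rightarrow> 'a \<Rightarrow> real"
  assumes bm: "brownian_motion M B"
begin

abbreviation "F s \<equiv> gen_sigma M B {0..s}"

lemma measurable_B: "0 \<le> t \<Longrightarrow> B t \<in> borel_measurable M"
  using bm unfolding brownian_motion_def by blast

lemma B_zero: "\<omega> \<in> space M \<Longrightarrow> B 0 \<omega> = 0"
  using bm unfolding brownian_motion_def by blast

lemma continuous_B: "\<omega> \<in> space M \<Longrightarrow> continuous_on {0..} (\<lambda>t. B t \<omega>)"
  using bm unfolding brownian_motion_def by blast

lemma increment_distributed:
  "0 \<le> s \<Longrightarrow> s < t \<Longrightarrow>
    distributed M lborel (\<lambda>\<omega>. B t \<omega> - B s \<omega>) (\<lambda>x. ennreal (normal_density 0 (sqrt (t - s)) x))"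
  using bm unfolding brownian_motion_def by blast

lemma increments_indep:
  "0 \<le> ts 0 \<Longrightarrow> (\<And>i. i < n \<Longrightarrow> ts i < ts (Suc i)) \<Longrightarrow>
    indep_vars (\<lambda>_. borel) (\<lambda>i \<omega>. B (ts (Suc i)) \<omega> - B (ts i) \<omega>) {..<n}" for n :: nat
  using bm unfolding brownian_motion_def by blast

end

lemma space_gen_sigma [simp]: "space (gen_sigma M X I) = space M"
  unfolding gen_sigma_def by (rule space_measure_of) auto

lemma sets_gen_sigma:
  "sets (gen_sigma M X I) =
    sigma_sets (space M) (\<Union>r\<in>I. {X r -` A \<inter> space M | A. A \<in> sets borel})"
  unfolding gen_sigma_def by (rule sets_measure_of) auto

lemma measurable_gen_sigma: "r \<in> I \<Longrightarrow> X r \<in> borel_measurable (gen_sigma M X I)"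
  unfolding measurable_def by (auto simp: sets_gen_sigma intro!: sigma_sets.Basic)

lemma sets_gen_sigma_least:
  assumes "\<And>r. r \<in> I \<Longrightarrow> X r \<in> borel_measurable N" "space N = space M"
  shows "sets (gen_sigma M X I) \<subseteq> sets N"
  unfolding sets_gen_sigma assms(2)[symmetric]
proof (rule sets.sigma_sets_subset, safe)
  fix r and A :: "real set" assume "r \<in> I" "A \<in> sets borel"
  then show "X r -` A \<inter> space N \<in> sets N" using assms(1)[of r] by (intro measurable_sets)
qed

lemma sets_gen_sigma_mono: "I \<subseteq> J \<Longrightarrow> sets (gen_sigma M X I) \<subseteq> sets (gen_sigma M X J)"
  by (rule sets_gen_sigma_least) (auto intro: measurable_gen_sigma)

text \<open>\<open>brownian_motion\<close> speaks of increasing sequences of times, whereas cylinder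
  events come with finite sets of times. Sorting turns the one into the other.\<close>

lemma sorted_enumeration:
  fixes J :: "real set"
  assumes "finite J" "J \<noteq> {}"
  obtains ts :: "nat \<Rightarrow> real" and n where "\<And>i. i < n \<Longrightarrow> ts i < ts (Suc i)" "ts ` {..n} = J"
    "ts 0 = Min J"
proof -
  define xs where "xs = sorted_list_of_set J"
  have xs: "set xs = J" "sorted xs" "distinct xs" "xs \<noteq> []"
    using assms by (auto simp: xs_def)
  define n where "n = length xs - 1"
  have len: "length xs = Suc n" using xs(4) by (cases xs) (auto simp: n_def)
  have "xs ! i < xs ! Suc i" if "i < n" for i
    using sorted_wrt_nth_less[of "(<)" xs i "Suc i"] that len
    by (simp add: xs_def)
  moreover have "(\<lambda>i. xs ! i) ` {..n} = J"
    using xs(1) len by (auto simp: set_conv_nth image_def less_Suc_eq_le)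
  moreover have "xs ! 0 = Min J"
  proof -
    have "xs ! 0 \<le> x" if "x \<in> J" for x
      using that xs(1,2) sorted_nth_mono[of xs 0] by (auto simp: in_set_conv_nth)
    moreover have "xs ! 0 \<in> J" using xs len by (metis nth_mem zero_less_Suc)
    ultimately show ?thesis using assms(1) by (metis Min_eqI)
  qed
  ultimately show thesis by (rule that)
qed

lemma sum_increments:
  "(\<Sum>i<k. f (ts (Suc i)) - f (ts i)) = f (ts k) - f (ts 0)" for f :: "real \<Rightarrow> real" and k :: nat
  by (induction k) auto

context brownian
begin

lemma subalgebra_F: "subalgebra M (F s)"
  unfolding subalgebra_def using sets_gen_sigma_least[of "{0..s}" B M M] measurable_B by auto

lemma F_sets_M: "Q \<in> sets (F s) \<Longrightarrow> Q \<in> sets M"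
  using subalgebra_F unfolding subalgebra_def by blast

lemma F_mono: "s \<le> t \<Longrightarrow> sets (F s) \<subseteq> sets (F t)"
  by (rule sets_gen_sigma_mono) auto

lemma measurable_B_F: "0 \<le> u \<Longrightarrow> u \<le> s \<Longrightarrow> B u \<in> borel_measurable (F s)"
  by (rule measurable_gen_sigma) auto

text \<open>The finite-dimensional cylinders up to time \<open>s\<close> form an intersection-stable
  generator of \<open>F s\<close>. For a cylinder, independence of the next increment follows from
  the definition; the extension to generated sigma-algebras does the rest.\<close>

lemma indep_increment:
  assumes s: "0 \<le> s" "s < t"
    and Q: "Q \<in> sets (F s)" and D: "D \<in> sets borel"
  shows "prob (Q \<inter> ((\<lambda>\<omega>. B t \<omega> - B s \<omega>) -` D \<inter> space M)) =
    prob Q * prob ((\<lambda>\<omega>. B t \<omega> - B s \<omega>) -` D \<inter> space M)"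
proof -
  define G where "G = {{\<omega>\<in>space M. \<forall>j\<in>J. B j \<omega> \<in> A j} | J A.
    finite J \<and> J \<subseteq> {0..s} \<and> (\<forall>j. A j \<in> sets (borel :: real measure))}"
  define H where "H = {(\<lambda>\<omega>. B t \<omega> - B s \<omega>) -` A \<inter> space M | A. A \<in> sets (borel :: real measure)}"
  have t: "0 \<le> t" using s by simp
  note [measurable] = measurable_B[OF s(1)] measurable_B[OF t]
  have GM: "G \<subseteq> sets M"
  proof
    fix E assume "E \<in> G"
    then obtain J A where E: "E = {\<omega>\<in>space M. \<forall>j\<in>J. B j \<omega> \<in> A j}"
      "finite J" "J \<subseteq> {0..s}" "\<forall>j. A j \<in> sets (borel :: real measure)"
      unfolding G_def by auto
    show "E \<in> sets M" unfolding E(1)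
    proof (rule sets.sets_Collect_finite_All[OF _ E(2)])
      fix j assume j: "j \<in> J"
      then have [measurable]: "B j \<in> borel_measurable M" using E(3) by (intro measurable_B) auto
      have [measurable]: "A j \<in> sets borel" using E(4) by auto
      show "{\<omega>\<in>space M. B j \<omega> \<in> A j} \<in> sets M" by measurable
    qed
  qed
  have GI: "Int_stable G"
  proof (rule Int_stableI)
    fix E1 E2 assume "E1 \<in> G" "E2 \<in> G"
    then obtain J1 A1 J2 A2 where E: "E1 = {\<omega>\<in>space M. \<forall>j\<in>J1. B j \<omega> \<in> A1 j}"
        "finite J1" "J1 \<subseteq> {0..s}" "\<forall>j. A1 j \<in> sets (borel :: real measure)"
        "E2 = {\<omega>\<in>space M. \<forall>j\<in>J2. B j \<omega> \<in> A2 j}"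
        "finite J2" "J2 \<subseteq> {0..s}" "\<forall>j. A2 j \<in> sets (borel :: real measure)"
      unfolding G_def by auto
    let ?A = "\<lambda>j. (if j \<in> J1 then A1 j else UNIV) \<inter> (if j \<in> J2 then A2 j else UNIV)"
    have "E1 \<inter> E2 = {\<omega>\<in>space M. \<forall>j\<in>J1 \<union> J2. B j \<omega> \<in> ?A j}"
      unfolding E by auto
    moreover have "\<forall>j. ?A j \<in> sets borel" using E(4,8) by auto
    ultimately show "E1 \<inter> E2 \<in> G" unfolding G_def mem_Collect_eq using E(2,3,6,7)
      by (intro exI[of _ "J1 \<union> J2"] exI[of _ ?A]) simp
  qed
  have HI: "Int_stable H"
  proof (rule Int_stableI)
    fix E1 E2 assume "E1 \<in> H" "E2 \<in> H"
    then obtain A1 A2 where E: "E1 = (\<lambda>\<omega>. B t \<omega> - B s \<omega>) -` A1 \<inter> space M" "A1 \<in> sets (borel :: real measure)"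
      "E2 = (\<lambda>\<omega>. B t \<omega> - B s \<omega>) -` A2 \<inter> space M" "A2 \<in> sets (borel :: real measure)"
      unfolding H_def by auto
    then have "E1 \<inter> E2 = (\<lambda>\<omega>. B t \<omega> - B s \<omega>) -` (A1 \<inter> A2) \<inter> space M" "A1 \<inter> A2 \<in> sets borel" by auto
    then show "E1 \<inter> E2 \<in> H" unfolding H_def mem_Collect_eq by (intro exI[of _ "A1 \<inter> A2"]) simp
  qed
  have HM: "H \<subseteq> sets M"
    unfolding H_def by (auto intro!: measurable_sets)
  have ind: "indep_set G H"
    unfolding indep_set_def
  proof (rule indep_setsI)
    fix i show "case_bool G H i \<subseteq> events" using GM HM by (cases i) auto
  next
    fix A and J :: "bool set" assume A: "J \<noteq> {}" "J \<subseteq> UNIV" "finite J" "\<forall>j\<in>J. A j \<in> case_bool G H j"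
    have key: "prob (E1 \<inter> E2) = prob E1 * prob E2" if EE: "E1 \<in> G" "E2 \<in> H" for E1 E2
    proof -
      obtain J A where E1: "E1 = {\<omega>\<in>space M. \<forall>j\<in>J. B j \<omega> \<in> A j}"
        "finite J" "J \<subseteq> {0..s}" "\<forall>j. A j \<in> sets (borel :: real measure)"
        using EE unfolding G_def by auto
      obtain D where E2: "E2 = (\<lambda>\<omega>. B t \<omega> - B s \<omega>) -` D \<inter> space M" "D \<in> sets (borel :: real measure)"
        using EE unfolding H_def by auto
      \<comment> \<open>With 0 in the chain each \<open>B j\<close> is a sum of increments, because
        \<open>B 0 = 0\<close>. With \<open>s\<close> in it the increment from \<open>s\<close> to
        \<open>t\<close> can be appended as the last one.\<close>
      have "finite (insert 0 (insert s J))" "insert 0 (insert s J) \<noteq> {}" using E1 by auto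
      from sorted_enumeration[OF this] obtain ts n where ts: "\<And>i. i < n \<Longrightarrow> ts i < ts (Suc i)"
        "ts ` {..n} = insert 0 (insert s J)" "ts 0 = Min (insert 0 (insert s J))" by metis
      have Min0: "ts 0 = 0"
        unfolding ts(3) using E1 s by (intro Min_eqI) auto
      have mono: "ts i \<le> ts j" if "i \<le> j" "j \<le> n" for i j
        using that
      proof (induction j)
        case (Suc j)
        then show ?case using ts(1)[of j] by (cases "i = Suc j") (auto intro: order_trans)
      qed auto
      have tsn: "ts n = s"
      proof -
        obtain k where k: "k \<le> n" "ts k = s" using ts(2) by (metis atMost_iff imageE insertI1 insertI2)
        have "ts n \<in> insert 0 (insert s J)" using ts(2) by auto
        then have "ts n \<le> s" using E1 s by auto
        moreover have "s \<le> ts n" using mono[of k n] k by auto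
        ultimately show ?thesis by simp
      qed
      define tt where "tt i = (if i \<le> n then ts i else t)" for i
      have tt: "tt i < tt (Suc i)" if "i < Suc n" for i
        using that ts(1)[of i] tsn s by (cases "i = n") (auto simp: tt_def)
      define X where "X i \<omega> = B (tt (Suc i)) \<omega> - B (tt i) \<omega>" for i \<omega>
      have ind: "indep_vars (\<lambda>_. borel) X {..<Suc n}"
        unfolding X_def[abs_def] by (rule increments_indep) (use tt Min0 in \<open>auto simp: tt_def\<close>)
      have "indep_var (PiM {..<n} (\<lambda>_. borel)) (\<lambda>\<omega>. restrict (\<lambda>i. X i \<omega>) {..<n})
         (PiM {n} (\<lambda>_. borel)) (\<lambda>\<omega>. restrict (\<lambda>i. X i \<omega>) {n})"
        by (rule indep_var_restrict[OF ind]) auto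
      note iv = indep_varD[OF this]
      have "\<forall>j\<in>J. \<exists>k\<le>n. ts k = j" using ts(2) by (metis atMost_iff imageE insertI2)
      then obtain kk where kk: "\<And>j. j \<in> J \<Longrightarrow> kk j \<le> n \<and> ts (kk j) = j" by metis
      have Bj: "B j \<omega> = (\<Sum>i<kk j. X i \<omega>)" if "j \<in> J" "\<omega> \<in> space M" for j \<omega>
      proof -
        have "(\<Sum>i<kk j. X i \<omega>) = B (tt (kk j)) \<omega> - B (tt 0) \<omega>"
          unfolding X_def using sum_increments[where f="\<lambda>r. B r \<omega>" and ts=tt and k="kk j"] by simp
        then show ?thesis using kk[OF that(1)] that B_zero[of \<omega>] Min0 by (simp add: tt_def)
      qed
      define XA where "XA = {x\<in>space (PiM {..<n} (\<lambda>_. borel :: real measure)). \<forall>j\<in>J. (\<Sum>i<kk j. x i) \<in> A j}"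
      have XA: "XA \<in> sets (PiM {..<n} (\<lambda>_. borel))"
        unfolding XA_def
      proof (rule sets.sets_Collect_finite_All[OF _ E1(2)])
        fix j assume j: "j \<in> J"
        have [measurable]: "A j \<in> sets borel" using E1(4) by auto
        have [measurable]: "(\<lambda>x. \<Sum>i<kk j. x i) \<in> borel_measurable (PiM {..<n} (\<lambda>_. borel :: real measure))"
          by (rule borel_measurable_sum, rule measurable_component_singleton) (use kk[OF j] in auto)
        show "{x\<in>space (PiM {..<n} (\<lambda>_. borel :: real measure)). (\<Sum>i<kk j. x i) \<in> A j} \<in> sets (PiM {..<n} (\<lambda>_. borel))" 
          by measurable
      qed
      define XB where "XB = {x\<in>space (PiM {n} (\<lambda>_. borel :: real measure)). x n \<in> D}"
      have XB: "XB \<in> sets (PiM {n} (\<lambda>_. borel))"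
        unfolding XB_def using E2(2) by measurable
      have e1: "(\<lambda>\<omega>. restrict (\<lambda>i. X i \<omega>) {..<n}) -` XA \<inter> space M = E1"
      proof -
        have "(\<Sum>i<kk j. restrict (\<lambda>i. X i \<omega>) {..<n} i) = B j \<omega>" if "j \<in> J" "\<omega> \<in> space M" for j \<omega>
          using Bj[OF that] kk[OF that(1)] by (auto intro!: sum.cong)
        then show ?thesis unfolding XA_def E1 by (auto simp: space_PiM)
      qed
      have e2: "(\<lambda>\<omega>. restrict (\<lambda>i. X i \<omega>) {n}) -` XB \<inter> space M = E2"
        unfolding XB_def E2 by (auto simp: space_PiM X_def tt_def tsn)
      have e3: "(\<lambda>x. (restrict (\<lambda>i. X i x) {..<n}, restrict (\<lambda>i. X i x) {n})) -` (XA \<times> XB) \<inter> space M = E1 \<inter> E2"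
        unfolding e1[symmetric] e2[symmetric] by auto
      show ?thesis using iv[OF XA XB] unfolding e1 e2 e3 .
    qed
    consider "J = {True}" | "J = {False}" | "J = {True, False}"
      using A(1) subset_UNIV[of J] unfolding UNIV_bool by blast
    then show "prob (\<Inter>j\<in>J. A j) = (\<Prod>j\<in>J. prob (A j))"
      using A(4) key by cases auto
  qed
  have ind2: "indep_set (sigma_sets (space M) G) (sigma_sets (space M) H)"
    by (rule indep_set_sigma_sets[OF ind GI HI])
  have FG: "sets (F s) \<subseteq> sigma_sets (space M) G"
  proof -
    have "\<exists>J A. E = {\<omega>\<in>space M. \<forall>j\<in>J. B j \<omega> \<in> A j} \<and> finite J \<and> J \<subseteq> {0..s} \<and> (\<forall>j. A j \<in> sets (borel :: real measure))"
      if "r \<in> {0..s}" "D \<in> sets (borel :: real measure)" "E = B r -` D \<inter> space M" for r D E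
      using that by (intro exI[of _ "{r}"] exI[of _ "\<lambda>_. D"]) auto
    then have "(\<Union>r\<in>{0..s}. {B r -` A \<inter> space M | A. A \<in> sets borel}) \<subseteq> G"
      unfolding G_def by fastforce
    then show ?thesis unfolding sets_gen_sigma by (rule sigma_sets_mono')
  qed
  show ?thesis
    by (rule indep_setD[OF ind2]) (use Q FG D in \<open>auto simp: H_def\<close>)
qed

text \<open>The Markov property of \<open>B\<close> in the form used throughout: whatever is known
  at time \<open>s\<close> is frozen while the increment is integrated against its Gaussian
  density.\<close>

lemma nn_integral_increment:
  assumes s: "0 \<le> s" "s < t" and g[measurable]: "g \<in> borel_measurable (F s \<Otimes>\<^sub>M borel)"
  shows "(\<integral>\<^sup>+\<omega>. g (\<omega>, B t \<omega> - B s \<omega>) \<partial>M) =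
    (\<integral>\<^sup>+\<omega>. (\<integral>\<^sup>+x. ennreal (normal_density 0 (sqrt (t - s)) x) * g (\<omega>, x) \<partial>lborel) \<partial>M)"
proof -
  have t: "0 \<le> t" using s by simp
  note [measurable] = measurable_B[OF s(1)] measurable_B[OF t]
  have iF[measurable]: "(\<lambda>\<omega>. \<omega>) \<in> measurable M (F s)"
    using subalgebra_F by (auto simp: subalgebra_def measurable_def)
  define D where "D = density lborel (\<lambda>x. ennreal (normal_density 0 (sqrt (t - s)) x))"
  have D: "distr M borel (\<lambda>\<omega>. B t \<omega> - B s \<omega>) = D"
    using distributed_distr_eq_density[OF increment_distributed[OF s]] 
    by (simp add: D_def cong: distr_cong)
  have sD: "sigma_finite_measure D"
    unfolding D_def by (intro prob_space_imp_sigma_finite prob_space_normal_density) (use s in auto)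
  interpret D: sigma_finite_measure D by (rule sD)
  have setsD[measurable_cong]: "sets D = sets borel" by (simp add: D_def)
  interpret P: prob_space "distr M (F s) (\<lambda>\<omega>. \<omega>)" by (rule prob_space_distr) (rule iF)
  \<comment> \<open>Independence says that the identity into \<open>F s\<close> and the increment
    have a product law. On rectangles this is \<open>indep_increment\<close>.\<close>
  have J: "distr M (F s) (\<lambda>\<omega>. \<omega>) \<Otimes>\<^sub>M D = distr M (F s \<Otimes>\<^sub>M borel) (\<lambda>\<omega>. (\<omega>, B t \<omega> - B s \<omega>))"
  proof (rule pair_measure_eqI)
    fix Q A assume Q: "Q \<in> sets (distr M (F s) (\<lambda>\<omega>. \<omega>))" and A: "A \<in> sets D"
    have QM: "Q \<in> sets M" "Q \<subseteq> space M" using F_sets_M[of Q s] Q sets.sets_into_space[of Q "F s"] by auto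
    have "emeasure (distr M (F s \<Otimes>\<^sub>M borel) (\<lambda>\<omega>. (\<omega>, B t \<omega> - B s \<omega>))) (Q \<times> A)
       = emeasure M (Q \<inter> ((\<lambda>\<omega>. B t \<omega> - B s \<omega>) -` A \<inter> space M))"
      using Q A QM setsD by (subst emeasure_distr) (auto intro!: arg_cong[where f="emeasure M"])
    also have "\<dots> = emeasure M Q * emeasure M ((\<lambda>\<omega>. B t \<omega> - B s \<omega>) -` A \<inter> space M)"
      unfolding emeasure_eq_measure using indep_increment[OF s, of Q A] Q A setsD
      by (simp add: ennreal_mult)
    also have "emeasure M ((\<lambda>\<omega>. B t \<omega> - B s \<omega>) -` A \<inter> space M) = emeasure D A"
      unfolding D[symmetric] using A setsD by (subst emeasure_distr) auto
    also have "emeasure M Q = emeasure (distr M (F s) (\<lambda>\<omega>. \<omega>)) Q"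
      using Q QM by (subst emeasure_distr) (auto simp: Int_absorb2)
    finally show "emeasure (distr M (F s) (\<lambda>\<omega>. \<omega>)) Q * emeasure D A =
      emeasure (distr M (F s \<Otimes>\<^sub>M borel) (\<lambda>\<omega>. (\<omega>, B t \<omega> - B s \<omega>))) (Q \<times> A)" by simp
  qed (auto intro: sD P.sigma_finite_measure_axioms simp: setsD cong: sets_pair_measure_cong)
  have "(\<integral>\<^sup>+\<omega>. g (\<omega>, B t \<omega> - B s \<omega>) \<partial>M) = integral\<^sup>N (distr M (F s) (\<lambda>\<omega>. \<omega>) \<Otimes>\<^sub>M D) g"
    unfolding J by (subst nn_integral_distr) auto
  also have "\<dots> = (\<integral>\<^sup>+\<omega>. (\<integral>\<^sup>+x. g (\<omega>, x) \<partial>D) \<partial>distr M (F s) (\<lambda>\<omega>. \<omega>))"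
    by (rule D.nn_integral_fst[symmetric]) simp
  also have "\<dots> = (\<integral>\<^sup>+\<omega>. (\<integral>\<^sup>+x. g (\<omega>, x) \<partial>D) \<partial>M)"
    by (subst nn_integral_distr) (auto intro!: D.borel_measurable_nn_integral_fst)
  also have "\<dots> = (\<integral>\<^sup>+\<omega>. (\<integral>\<^sup>+x. ennreal (normal_density 0 (sqrt (t - s)) x) * g (\<omega>, x) \<partial>lborel) \<partial>M)"
  proof (rule nn_integral_cong)
    fix \<omega> assume "\<omega> \<in> space M"
    then have [measurable]: "(\<lambda>x. g (\<omega>, x)) \<in> borel_measurable borel"
      by (intro measurable_compose[OF measurable_Pair1' g]) auto
    show "(\<integral>\<^sup>+x. g (\<omega>, x) \<partial>D) = (\<integral>\<^sup>+x. ennreal (normal_density 0 (sqrt (t - s)) x) * g (\<omega>, x) \<partial>lborel)"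
      unfolding D_def by (subst nn_integral_density) auto
  qed
  finally show ?thesis .
qed

end

section \<open>Reflection and exit estimates\<close>

lemma nn_integral_normal_density [simp]:
  "0 < \<sigma> \<Longrightarrow> (\<integral>\<^sup>+x. ennreal (normal_density \<mu> \<sigma> x) \<partial>lborel) = 1"
  by (subst nn_integral_eq_integral) auto

lemma nn_integral_normal_exp:
  assumes "0 < \<sigma>"
  shows "(\<integral>\<^sup>+x. ennreal (normal_density 0 \<sigma> x) * ennreal (exp (c * x)) \<partial>lborel) = ennreal (exp (c\<^sup>2 * \<sigma>\<^sup>2 / 2))"
proof -
  have "normal_density 0 \<sigma> x * exp (c * x) = exp (c\<^sup>2 * \<sigma>\<^sup>2 / 2) * normal_density (c * \<sigma>\<^sup>2) \<sigma> x" for x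
  proof -
    have "- (x - 0)\<^sup>2 / (2 * \<sigma>\<^sup>2) + c * x = c\<^sup>2 * \<sigma>\<^sup>2 / 2 + - (x - c * \<sigma>\<^sup>2)\<^sup>2 / (2 * \<sigma>\<^sup>2)"
      using assms by (simp add: field_simps power2_eq_square)
    then show ?thesis unfolding normal_density_def
      by (simp add: exp_add[symmetric] mult.assoc mult.left_commute)
  qed
  then have "(\<integral>\<^sup>+x. ennreal (normal_density 0 \<sigma> x) * ennreal (exp (c * x)) \<partial>lborel)
    = (\<integral>\<^sup>+x. ennreal (exp (c\<^sup>2 * \<sigma>\<^sup>2 / 2)) * ennreal (normal_density (c * \<sigma>\<^sup>2) \<sigma> x) \<partial>lborel)"
    by (simp add: ennreal_mult[symmetric])
  also have "\<dots> = ennreal (exp (c\<^sup>2 * \<sigma>\<^sup>2 / 2))"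
    using assms by (subst nn_integral_cmult) auto
  finally show ?thesis .
qed

lemma normal_density_le:
  assumes "0 < \<sigma>" "\<bar>z - x\<bar> \<ge> \<bar>z' - x'\<bar>"
  shows "normal_density x \<sigma> z \<le> normal_density x' \<sigma> z'"
proof -
  have "(z' - x')\<^sup>2 \<le> (z - x)\<^sup>2" using assms(2) by (simp add: abs_le_square_iff)
  then show ?thesis using assms(1)
    by (auto simp: normal_density_def intro!: mult_left_mono divide_right_mono)
qed

text \<open>Rounding \<open>u\<close> down to the grid of level \<open>n\<close> gives grid points
  converging to \<open>u\<close>, and continuity carries the bound over.\<close>

lemma dyadic_grid_dense:
  fixes f :: "real \<Rightarrow> real"
  assumes f: "continuous_on {s..t} f" and st: "s < t" 
    and le: "\<And>n i. i \<le> 2 ^ n \<Longrightarrow> f (s + (t - s) * real i / 2 ^ n) \<le> 0"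
    and u: "u \<in> {s..t}"
  shows "f u \<le> 0"
proof -
  define r where "r = (u - s) / (t - s)"
  have r: "0 \<le> r" "r \<le> 1" "u = s + (t - s) * r" using u st by (auto simp: r_def)
  define x where "x n = s + (t - s) * real (nat \<lfloor>r * 2 ^ n\<rfloor>) / 2 ^ n" for n :: nat
  have fl: "real (nat \<lfloor>r * 2 ^ n\<rfloor>) \<le> r * 2 ^ n" "r * 2 ^ n - 1 \<le> real (nat \<lfloor>r * 2 ^ n\<rfloor>)" for n
    using r(1) by (auto simp: of_nat_nat)
  have ile: "nat \<lfloor>r * 2 ^ n\<rfloor> \<le> 2 ^ n" for n
  proof -
    have "real (nat \<lfloor>r * 2 ^ n\<rfloor>) \<le> real (2 ^ n)"
    proof -
      have "r * 2 ^ n \<le> 1 * 2 ^ n" using r(2) by (intro mult_right_mono) auto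
      then show ?thesis using fl(1)[of n] unfolding of_nat_power of_nat_numeral mult_1 by (rule order_trans[rotated])
    qed
    then show ?thesis by (simp only: of_nat_le_iff)
  qed
  have xin: "x n \<in> {s..t}" for n
  proof -
    have "real (nat \<lfloor>r * 2 ^ n\<rfloor>) \<le> real (2 ^ n)" using ile[of n] by (simp only: of_nat_le_iff)
    then have "real (nat \<lfloor>r * 2 ^ n\<rfloor>) / 2 ^ n \<le> 1" by simp
    then have "(t - s) * (real (nat \<lfloor>r * 2 ^ n\<rfloor>) / 2 ^ n) \<le> (t - s) * 1" using st by (intro mult_left_mono) auto
    moreover have "0 \<le> (t - s) * (real (nat \<lfloor>r * 2 ^ n\<rfloor>) / 2 ^ n)" using st by simp
    ultimately show ?thesis by (simp add: x_def)
  qed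
  have "(\<lambda>n. real (nat \<lfloor>r * 2 ^ n\<rfloor>) / 2 ^ n) \<longlonglongrightarrow> r"
  proof (rule tendsto_sandwich[where f="\<lambda>n. r - (1/2) ^ n" and h="\<lambda>_. r"])
    show "(\<lambda>n. r - (1/2) ^ n) \<longlonglongrightarrow> r" by (rule tendsto_eq_intros | simp)+
    show "\<forall>\<^sub>F n in sequentially. r - (1/2) ^ n \<le> real (nat \<lfloor>r * 2 ^ n\<rfloor>) / 2 ^ n"
    proof (rule always_eventually, rule allI)
      fix n show "r - (1/2) ^ n \<le> real (nat \<lfloor>r * 2 ^ n\<rfloor>) / 2 ^ n"
      proof -
        have "(r - (1/2) ^ n) * 2 ^ n = r * 2 ^ n - 1" by (simp add: left_diff_distrib power_divide)
        then show ?thesis using fl(2)[of n] by (simp add: pos_le_divide_eq)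
      qed
    qed
    show "\<forall>\<^sub>F n in sequentially. real (nat \<lfloor>r * 2 ^ n\<rfloor>) / 2 ^ n \<le> r"
      using fl(1) by (intro always_eventually allI) (simp add: pos_divide_le_eq)
  qed simp
  then have "(\<lambda>n. s + (t - s) * (real (nat \<lfloor>r * 2 ^ n\<rfloor>) / 2 ^ n)) \<longlonglongrightarrow> s + (t - s) * r"
    by (intro tendsto_intros)
  then have "x \<longlonglongrightarrow> u" unfolding x_def r(3) by simp
  then have "(\<lambda>n. f (x n)) \<longlonglongrightarrow> f u"
    using continuous_on_tendsto_compose[OF f, of x u sequentially] u xin by simp
  moreover have "f (x n) \<le> 0" for n unfolding x_def by (rule le) (rule ile)
  ultimately show ?thesis by (intro LIMSEQ_le_const2[where X="\<lambda>n. f (x n)"]) auto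
qed

text \<open>A discrete substitute for stopping at the first exit: the event that some
  \<open>A i\<close> occurs is split by the first such \<open>i\<close>, an inequality is available
  on each piece, and the pieces are added up. The terms \<open>e i\<close> make room for overshoot
  errors.\<close>

lemma (in finite_measure) nn_integral_first_exit:
  fixes f g :: "'a \<Rightarrow> ennreal" and e :: "nat \<Rightarrow> ennreal"
  assumes [measurable]: "f \<in> borel_measurable M" "g \<in> borel_measurable M"
    and Q[measurable]: "Q \<in> sets M" and A: "\<And>i. i \<le> N \<Longrightarrow> A i \<in> sets M"
    and le: "\<And>i. i \<le> N \<Longrightarrow> (\<integral>\<^sup>+\<omega>. indicator {\<omega>\<in>Q. \<omega> \<in> A i \<and> (\<forall>j<i. \<omega> \<notin> A j)} \<omega> * f \<omega> \<partial>M) \<le>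
      (\<integral>\<^sup>+\<omega>. indicator {\<omega>\<in>Q. \<omega> \<in> A i \<and> (\<forall>j<i. \<omega> \<notin> A j)} \<omega> * g \<omega> \<partial>M) + e i"
  shows "(\<integral>\<^sup>+\<omega>. indicator {\<omega>\<in>Q. \<exists>i\<le>N. \<omega> \<in> A i} \<omega> * f \<omega> \<partial>M) \<le>
    (\<integral>\<^sup>+\<omega>. indicator {\<omega>\<in>Q. \<exists>i\<le>N. \<omega> \<in> A i} \<omega> * g \<omega> \<partial>M) + (\<Sum>i\<le>N. e i)"
proof -
  define E where "E i = {\<omega>\<in>Q. \<omega> \<in> A i \<and> (\<forall>j<i. \<omega> \<notin> A j)}" for i
  have Em[measurable]: "E i \<in> sets M" if "i \<le> N" for i
  proof -
    have "E i = (Q \<inter> A i) - (\<Union>j<i. A j)" unfolding E_def by auto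
    also have "\<dots> \<in> sets M" using A that by auto
    finally show ?thesis .
  qed
  have dis: "disjoint_family_on E {..N}"
    unfolding disjoint_family_on_def E_def by (auto, metis nat_neq_iff)
  have un: "{\<omega>\<in>Q. \<exists>i\<le>N. \<omega> \<in> A i} = (\<Union>i\<in>{..N}. E i)"
  proof (intro set_eqI iffI)
    fix \<omega> assume "\<omega> \<in> {\<omega>\<in>Q. \<exists>i\<le>N. \<omega> \<in> A i}"
    then obtain i where i: "\<omega> \<in> Q" "i \<le> N" "\<omega> \<in> A i" by auto
    define k where "k = (LEAST k. \<omega> \<in> A k)"
    have "\<omega> \<in> A k" "k \<le> i" "\<forall>j<k. \<omega> \<notin> A j" unfolding k_def
      using i(3) by (auto intro: LeastI Least_le dest: not_less_Least)
    then show "\<omega> \<in> (\<Union>i\<in>{..N}. E i)" using i by (intro UN_I[of k]) (auto simp: E_def)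
  qed (auto simp: E_def)
  have split: "(\<integral>\<^sup>+\<omega>. indicator {\<omega>\<in>Q. \<exists>i\<le>N. \<omega> \<in> A i} \<omega> * h \<omega> \<partial>M) = (\<Sum>i\<le>N. \<integral>\<^sup>+\<omega>. indicator (E i) \<omega> * h \<omega> \<partial>M)"
    if [measurable]: "h \<in> borel_measurable M" for h :: "'a \<Rightarrow> ennreal"
    unfolding un indicator_UN_disjoint[OF finite_atMost dis] sum_distrib_right
    by (rule nn_integral_sum) auto
  show ?thesis
    unfolding split[OF assms(1)] split[OF assms(2)] sum.distrib[symmetric]
    by (rule sum_mono) (use le in \<open>auto simp: E_def\<close>)
qed

context brownian
begin

text \<open>The increment formula rewritten for functions of \<open>B t\<close>: given
  \<open>F s\<close>, the value \<open>B t\<close> is Gaussian around \<open>B s\<close>.\<close>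

lemma nn_integral_B:
  assumes s: "0 \<le> s" "s < t" and u[measurable]: "u \<in> borel_measurable (F s)"
    and f[measurable]: "f \<in> borel_measurable borel"
  shows "(\<integral>\<^sup>+\<omega>. u \<omega> * f (B t \<omega>) \<partial>M) =
    (\<integral>\<^sup>+\<omega>. u \<omega> * (\<integral>\<^sup>+z. ennreal (normal_density (B s \<omega>) (sqrt (t - s)) z) * f z \<partial>lborel) \<partial>M)"
proof -
  note [measurable] = measurable_B_F[OF s(1) order_refl]
  have "(\<integral>\<^sup>+\<omega>. u \<omega> * f (B t \<omega>) \<partial>M) = (\<integral>\<^sup>+\<omega>. (\<lambda>(\<omega>, x). u \<omega> * f (B s \<omega> + x)) (\<omega>, B t \<omega> - B s \<omega>) \<partial>M)"
    by simp
  also have "\<dots> = (\<integral>\<^sup>+\<omega>. (\<integral>\<^sup>+x. ennreal (normal_density 0 (sqrt (t - s)) x) *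
      (\<lambda>(\<omega>, x). u \<omega> * f (B s \<omega> + x)) (\<omega>, x) \<partial>lborel) \<partial>M)"
    by (rule nn_integral_increment[OF s]) measurable
  also have "\<dots> = (\<integral>\<^sup>+\<omega>. u \<omega> * (\<integral>\<^sup>+z. ennreal (normal_density (B s \<omega>) (sqrt (t - s)) z) * f z \<partial>lborel) \<partial>M)"
  proof (rule nn_integral_cong)
    fix \<omega>
    have "(\<integral>\<^sup>+z. ennreal (normal_density (B s \<omega>) (sqrt (t - s)) z) * f z \<partial>lborel) =
      (\<integral>\<^sup>+x. ennreal (normal_density (B s \<omega>) (sqrt (t - s)) (B s \<omega> + x)) * f (B s \<omega> + x) \<partial>lborel)"
      by (subst nn_integral_real_affine[where c=1 and t="B s \<omega>"]) auto
    also have "\<dots> = (\<integral>\<^sup>+x. ennreal (normal_density 0 (sqrt (t - s)) x) * f (B s \<omega> + x) \<partial>lborel)"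
      by (simp add: normal_density_def)
    finally show "(\<integral>\<^sup>+x. ennreal (normal_density 0 (sqrt (t - s)) x) * (case (\<omega>, x) of (\<omega>, x) \<Rightarrow> u \<omega> * f (B s \<omega> + x)) \<partial>lborel)
      = u \<omega> * (\<integral>\<^sup>+z. ennreal (normal_density (B s \<omega>) (sqrt (t - s)) z) * f z \<partial>lborel)"
      by (simp add: nn_integral_cmult[symmetric] mult_ac)
  qed
  finally show ?thesis .
qed

lemma nn_integral_indep_increment:
  assumes s: "0 \<le> s" "s < t" and u[measurable]: "u \<in> borel_measurable (F s)"
    and f[measurable]: "f \<in> borel_measurable borel"
  shows "(\<integral>\<^sup>+\<omega>. u \<omega> * f (B t \<omega> - B s \<omega>) \<partial>M) =
    (\<integral>\<^sup>+\<omega>. u \<omega> \<partial>M) * (\<integral>\<^sup>+x. ennreal (normal_density 0 (sqrt (t - s)) x) * f x \<partial>lborel)"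
proof -
  have uM[measurable]: "u \<in> borel_measurable M"
    using measurable_from_subalg[OF subalgebra_F u] .
  have "(\<integral>\<^sup>+\<omega>. u \<omega> * f (B t \<omega> - B s \<omega>) \<partial>M) = (\<integral>\<^sup>+\<omega>. (\<lambda>(\<omega>, x). u \<omega> * f x) (\<omega>, B t \<omega> - B s \<omega>) \<partial>M)"
    by simp
  also have "\<dots> = (\<integral>\<^sup>+\<omega>. (\<integral>\<^sup>+x. ennreal (normal_density 0 (sqrt (t - s)) x) *
      (\<lambda>(\<omega>, x). u \<omega> * f x) (\<omega>, x) \<partial>lborel) \<partial>M)"
    by (rule nn_integral_increment[OF s]) measurable
  also have "\<dots> = (\<integral>\<^sup>+\<omega>. u \<omega> * (\<integral>\<^sup>+x. ennreal (normal_density 0 (sqrt (t - s)) x) * f x \<partial>lborel) \<partial>M)"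
    by (simp add: nn_integral_cmult[symmetric] mult_ac)
  finally show ?thesis by (simp add: nn_integral_multc)
qed

text \<open>Markov's inequality for the fourth moment. The second moment would be too weak for
  \<open>reflection_upper\<close>: summed over the steps of a grid it does not vanish as the mesh is
  refined, while here the sum is of the order of the mesh.\<close>

lemma increment_abs_tail_bound:
  assumes s: "0 \<le> s" "s < t" and k: "0 < \<kappa>"
  shows "emeasure M {\<omega>\<in>space M. \<kappa> < \<bar>B t \<omega> - B s \<omega>\<bar>} \<le> ennreal (3 * (t - s)\<^sup>2 / \<kappa> ^ 4)"
proof -
  have t: "0 \<le> t" using s by simp
  note [measurable] = measurable_B[OF s(1)] measurable_B[OF t]
  let ?p = "normal_density 0 (sqrt (t - s))"
  have E: "{\<omega>\<in>space M. \<kappa> < \<bar>B t \<omega> - B s \<omega>\<bar>} \<in> sets M" by measurable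
  have "emeasure M {\<omega>\<in>space M. \<kappa> < \<bar>B t \<omega> - B s \<omega>\<bar>} = (\<integral>\<^sup>+\<omega>. 1 * indicator {x. \<kappa> < \<bar>x\<bar>} (B t \<omega> - B s \<omega>) \<partial>M)"
    by (subst nn_integral_indicator[OF E, symmetric], rule nn_integral_cong) (auto split: split_indicator)
  also have "\<dots> = (\<integral>\<^sup>+x. ennreal (?p x) * indicator {x. \<kappa> < \<bar>x\<bar>} x \<partial>lborel)"
    by (subst nn_integral_indep_increment[OF s]) (auto simp: emeasure_space_1)
  also have "\<dots> \<le> (\<integral>\<^sup>+x. ennreal (?p x * (x - 0) ^ (2 * 2)) * ennreal (1 / \<kappa> ^ 4) \<partial>lborel)"
  proof (rule nn_integral_mono)
    fix x :: real
    have "?p x * 1 \<le> ?p x * (x ^ 4 / \<kappa> ^ 4)" if "\<kappa> < \<bar>x\<bar>"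
      using power_mono[of \<kappa> "\<bar>x\<bar>" 4] that k by (intro mult_left_mono) (auto simp: pos_le_divide_eq)
    then show "ennreal (?p x) * indicator {x. \<kappa> < \<bar>x\<bar>} x \<le> ennreal (?p x * (x - 0) ^ (2 * 2)) * ennreal (1 / \<kappa> ^ 4)"
      using k by (auto split: split_indicator simp: ennreal_mult[symmetric] intro!: ennreal_leI)
  qed
  also have "\<dots> = (\<integral>\<^sup>+x. ennreal (?p x * (x - 0) ^ (2 * 2)) \<partial>lborel) * ennreal (1 / \<kappa> ^ 4)"
    by (rule nn_integral_multc) auto
  also have "(\<integral>\<^sup>+x. ennreal (?p x * (x - 0) ^ (2 * 2)) \<partial>lborel) = ennreal (3 * (t - s)\<^sup>2)"
  proof -
    have "has_bochner_integral lborel (\<lambda>x. ?p x * (x - 0) ^ (2 * 2)) (fact (2 * 2) / ((2 / (sqrt (t - s))\<^sup>2)^2 * fact 2))"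
      by (rule normal_moment_even) (use s in auto)
    moreover have "fact (2 * 2) / ((2 / (sqrt (t - s))\<^sup>2)^2 * fact 2) = 3 * (t - s)\<^sup>2"
      using s by (simp add: fact_numeral power2_eq_square field_simps)
    ultimately have "has_bochner_integral lborel (\<lambda>x. ?p x * (x - 0) ^ (2 * 2)) (3 * (t - s)\<^sup>2)" by simp
    then show ?thesis by (subst nn_integral_eq_integral) (auto simp: has_bochner_integral_iff)
  qed
  also have "ennreal (3 * (t - s)\<^sup>2) * ennreal (1 / \<kappa> ^ 4) = ennreal (3 * (t - s)\<^sup>2 / \<kappa> ^ 4)"
    using k by (simp add: ennreal_mult[symmetric])
  finally show ?thesis .
qed

lemma increment_tail_bound:
  assumes s: "0 \<le> s" "s < t" and k: "0 < \<kappa>"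
  shows "emeasure M {\<omega>\<in>space M. \<kappa> < B t \<omega> - B s \<omega>} \<le> ennreal (3 * (t - s)\<^sup>2 / \<kappa> ^ 4)"
proof -
  have t: "0 \<le> t" using s by simp
  note [measurable] = measurable_B[OF s(1)] measurable_B[OF t]
  have "emeasure M {\<omega>\<in>space M. \<kappa> < B t \<omega> - B s \<omega>} \<le> emeasure M {\<omega>\<in>space M. \<kappa> < \<bar>B t \<omega> - B s \<omega>\<bar>}"
    by (rule emeasure_mono) auto
  then show ?thesis using increment_abs_tail_bound[OF assms] by (rule order_trans)
qed

text \<open>Given \<open>F s\<close>, the substitution of \<open>2 * m - z\<close> for
  \<open>z\<close> reduces the comparison of \<open>f\<close> and \<open>g\<close> to a pointwise
  inequality between Gaussian densities. All reflection arguments below are instances of it.\<close>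

lemma reflect_aux:
  assumes s: "0 \<le> s" "s < t" and Q: "Q \<in> sets (F s)" and f[measurable]: "f \<in> borel_measurable borel" "g \<in> borel_measurable borel"
    and le: "\<And>x z. x \<in> B s ` Q \<Longrightarrow> ennreal (normal_density x (sqrt (t - s)) z) * f z \<le> ennreal (normal_density x (sqrt (t - s)) (2 * m - z)) * g (2 * m - z)"
  shows "(\<integral>\<^sup>+\<omega>. indicator Q \<omega> * f (B t \<omega>) \<partial>M) \<le> (\<integral>\<^sup>+\<omega>. indicator Q \<omega> * g (B t \<omega>) \<partial>M)"
proof -
  have [measurable]: "indicator Q \<in> borel_measurable (F s)" using Q by simp
  show ?thesis
    unfolding nn_integral_B[OF s \<open>indicator Q \<in> borel_measurable (F s)\<close> f(1)] 
      nn_integral_B[OF s \<open>indicator Q \<in> borel_measurable (F s)\<close> f(2)]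
  proof (intro nn_integral_mono)
    fix \<omega>
    have "(\<integral>\<^sup>+z. ennreal (normal_density (B s \<omega>) (sqrt (t - s)) z) * f z \<partial>lborel) \<le>
      (\<integral>\<^sup>+z. ennreal (normal_density (B s \<omega>) (sqrt (t - s)) (2 * m - z)) * g (2 * m - z) \<partial>lborel)"
      if "\<omega> \<in> Q" using that le by (intro nn_integral_mono) auto
    also have "(\<integral>\<^sup>+z. ennreal (normal_density (B s \<omega>) (sqrt (t - s)) (2 * m - z)) * g (2 * m - z) \<partial>lborel) =
      (\<integral>\<^sup>+z. ennreal (normal_density (B s \<omega>) (sqrt (t - s)) z) * g z \<partial>lborel)"
      by (subst (2) nn_integral_real_affine[where c="-1" and t="2 * m"]) auto
    finally show "indicator Q \<omega> * (\<integral>\<^sup>+z. ennreal (normal_density (B s \<omega>) (sqrt (t - s)) z) * f z \<partial>lborel) \<le>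
      indicator Q \<omega> * (\<integral>\<^sup>+z. ennreal (normal_density (B s \<omega>) (sqrt (t - s)) z) * g z \<partial>lborel)"
      by (auto split: split_indicator)
  qed
qed

text \<open>Seen from a starting point above \<open>m\<close>, a target \<open>z\<close> below
  \<open>m\<close> is at least as far away as its mirror image \<open>2 * m - z\<close>, hence has
  the smaller density.\<close>

lemma reflect_above:
  assumes s: "0 \<le> s" "s < t" and Q: "Q \<in> sets (F s)" and W[measurable]: "W \<in> sets borel" "W \<subseteq> {..m}"
    and m: "\<And>\<omega>. \<omega> \<in> Q \<Longrightarrow> m \<le> B s \<omega>"
  shows "(\<integral>\<^sup>+\<omega>. indicator Q \<omega> * indicator W (B t \<omega>) \<partial>M) \<le> (\<integral>\<^sup>+\<omega>. indicator Q \<omega> * indicator W (2 * m - B t \<omega>) \<partial>M)"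
proof (rule reflect_aux[OF s Q, of "indicator W" "\<lambda>z. indicator W (2 * m - z)" m])
  fix x z assume "x \<in> B s ` Q"
  then have "m \<le> x" using m by auto
  then have "z \<le> m \<Longrightarrow> \<bar>2 * m - z - x\<bar> \<le> \<bar>z - x\<bar>" by linarith
  then have "z \<in> W \<Longrightarrow> normal_density x (sqrt (t - s)) z \<le> normal_density x (sqrt (t - s)) (2 * m - z)"
    using W(2) s by (intro normal_density_le) auto
  then show "ennreal (normal_density x (sqrt (t - s)) z) * indicator W z \<le>
      ennreal (normal_density x (sqrt (t - s)) (2 * m - z)) * indicator W (2 * m - (2 * m - z))"
    by (auto split: split_indicator intro!: ennreal_leI)
qed auto

text \<open>Seen from below \<open>m\<close> it is the point of \<open>W\<close> that is closer than
  its mirror image.\<close>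

lemma reflect_below:
  assumes s: "0 \<le> s" "s < t" and Q: "Q \<in> sets (F s)" and W[measurable]: "W \<in> sets borel" "W \<subseteq> {..m}"
    and m: "\<And>\<omega>. \<omega> \<in> Q \<Longrightarrow> B s \<omega> \<le> m"
  shows "(\<integral>\<^sup>+\<omega>. indicator Q \<omega> * indicator W (2 * m - B t \<omega>) \<partial>M) \<le> (\<integral>\<^sup>+\<omega>. indicator Q \<omega> * indicator W (B t \<omega>) \<partial>M)"
proof (rule reflect_aux[OF s Q, of "\<lambda>z. indicator W (2 * m - z)" "indicator W" m])
  fix x z assume "x \<in> B s ` Q"
  then have "x \<le> m" using m by auto
  then have "2 * m - z \<le> m \<Longrightarrow> \<bar>2 * m - z - x\<bar> \<le> \<bar>z - x\<bar>" by linarith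
  then have "2 * m - z \<in> W \<Longrightarrow> normal_density x (sqrt (t - s)) z \<le> normal_density x (sqrt (t - s)) (2 * m - z)"
    using W(2) s by (intro normal_density_le) auto
  then show "ennreal (normal_density x (sqrt (t - s)) z) * indicator W (2 * m - z) \<le>
      ennreal (normal_density x (sqrt (t - s)) (2 * m - z)) * indicator W (2 * m - z)"
    by (auto split: split_indicator intro!: ennreal_leI)
qed auto

text \<open>Up to the constant factor \<open>exp (- 2 * a * b)\<close> this is the exponential
  martingale \<open>exp (2 * b * B t - 2 * b\<^sup>2 * t)\<close>, normalised so as to equal 1 when
  the path is on the line \<open>a + b * t\<close>.\<close>

lemma exp_martingale:
  assumes s: "0 \<le> s" "s < t" and Q: "Q \<in> sets (F s)"
  shows "(\<integral>\<^sup>+\<omega>. indicator Q \<omega> * ennreal (exp (- 2 * b * (a + b * t - B t \<omega>))) \<partial>M) =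
    (\<integral>\<^sup>+\<omega>. indicator Q \<omega> * ennreal (exp (- 2 * b * (a + b * s - B s \<omega>))) \<partial>M)"
proof -
  note [measurable] = measurable_B_F[OF s(1) order_refl] Q
  have "(\<integral>\<^sup>+\<omega>. indicator Q \<omega> * ennreal (exp (- 2 * b * (a + b * t - B t \<omega>))) \<partial>M) =
    (\<integral>\<^sup>+\<omega>. (indicator Q \<omega> * ennreal (exp (- 2 * b * (a + b * t - B s \<omega>)))) * ennreal (exp (2 * b * (B t \<omega> - B s \<omega>))) \<partial>M)"
    by (intro nn_integral_cong) (auto split: split_indicator simp: ennreal_mult[symmetric] exp_add[symmetric] algebra_simps)
  also have "\<dots> = (\<integral>\<^sup>+\<omega>. (indicator Q \<omega> * ennreal (exp (- 2 * b * (a + b * t - B s \<omega>)))) \<partial>M) * ennreal (exp ((2 * b)\<^sup>2 * (sqrt (t - s))\<^sup>2 / 2))"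
    by (subst nn_integral_indep_increment[OF s]) (use s nn_integral_normal_exp[of "sqrt (t - s)" "2 * b"] in auto)
  also have "\<dots> = (\<integral>\<^sup>+\<omega>. (indicator Q \<omega> * ennreal (exp (- 2 * b * (a + b * t - B s \<omega>)))) * ennreal (exp ((2 * b)\<^sup>2 * (sqrt (t - s))\<^sup>2 / 2)) \<partial>M)"
  proof (rule nn_integral_multc[symmetric])
    have [measurable]: "B s \<in> borel_measurable M" "Q \<in> sets M" using s F_sets_M[OF Q] by (auto intro: measurable_B)
    show "(\<lambda>\<omega>. indicator Q \<omega> * ennreal (exp (- 2 * b * (a + b * t - B s \<omega>)))) \<in> borel_measurable M" by measurable
  qed
  also have "\<dots> = (\<integral>\<^sup>+\<omega>. indicator Q \<omega> * ennreal (exp (- 2 * b * (a + b * s - B s \<omega>))) \<partial>M)"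
  proof (rule nn_integral_cong)
    fix \<omega>
    have "(2 * b)\<^sup>2 * (sqrt (t - s))\<^sup>2 / 2 = 2 * b * b * (t - s)"
      using s by (simp add: power2_eq_square)
    then have "exp (- 2 * b * (a + b * t - B s \<omega>)) * exp ((2 * b)\<^sup>2 * (sqrt (t - s))\<^sup>2 / 2) = exp (- 2 * b * (a + b * s - B s \<omega>))"
      by (simp add: exp_add[symmetric] algebra_simps)
    then show "indicator Q \<omega> * ennreal (exp (- 2 * b * (a + b * t - B s \<omega>))) * ennreal (exp ((2 * b)\<^sup>2 * (sqrt (t - s))\<^sup>2 / 2)) =
      indicator Q \<omega> * ennreal (exp (- 2 * b * (a + b * s - B s \<omega>)))"
      by (simp add: mult.assoc ennreal_mult[symmetric])
  qed
  finally show ?thesis .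
qed

section \<open>Staying below a line: dyadic grids, reflection and exit from a line\<close>

definition grid :: "real \<Rightarrow> real \<Rightarrow> nat \<Rightarrow> nat \<Rightarrow> real" where
  "grid s t n i = s + (t - s) * real i / 2 ^ n"

lemma grid_simps [simp]: "grid s t n 0 = s" "grid s t n (2 ^ n) = t"
  by (auto simp: grid_def)

lemma grid_less: "s < t \<Longrightarrow> grid s t n i < grid s t n j \<longleftrightarrow> i < j"
  by (auto simp: grid_def divide_less_cancel mult_less_cancel_left)

lemma grid_le: "s < t \<Longrightarrow> grid s t n i \<le> grid s t n j \<longleftrightarrow> i \<le> j"
  using grid_less[of s t n j i] by (metis not_less)

lemma grid_ge: "s < t \<Longrightarrow> s \<le> grid s t n i"
  by (simp add: grid_def)

lemma grid_le_end: "s < t \<Longrightarrow> i \<le> 2 ^ n \<Longrightarrow> grid s t n i \<le> t"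
  using grid_le[of s t n i "2 ^ n"] by simp

lemma grid_Suc: "grid s t n (Suc i) - grid s t n i = (t - s) / 2 ^ n"
  by (simp add: grid_def field_simps)

lemma grid_refine: "grid s t n i = grid s t (Suc n) (2 * i)"
  by (simp add: grid_def)

definition below :: "real \<Rightarrow> real \<Rightarrow> real \<Rightarrow> real \<Rightarrow> 'a set" where
  "below a b s t = {\<omega>\<in>space M. \<forall>u\<in>{s..t}. B u \<omega> \<le> a + b * u}"

definition below_grid :: "real \<Rightarrow> real \<Rightarrow> real \<Rightarrow> real \<Rightarrow> nat \<Rightarrow> 'a set" where
  "below_grid a b s t n = {\<omega>\<in>space M. \<forall>i\<le>2 ^ n. B (grid s t n i) \<omega> \<le> a + b * grid s t n i}"

text \<open>Continuity of the path reduces the closed interval to its dyadic points. This is also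
  what makes the event measurable.\<close>

lemma below_eq:
  assumes s: "0 \<le> s" "s < t"
  shows "below a b s t = (\<Inter>n. below_grid a b s t n)"
proof (intro set_eqI iffI)
  fix \<omega> assume "\<omega> \<in> below a b s t"
  then show "\<omega> \<in> (\<Inter>n. below_grid a b s t n)"
    using grid_ge[OF s(2)] grid_le_end[OF s(2)] by (auto simp: below_def below_grid_def)
next
  fix \<omega> assume w: "\<omega> \<in> (\<Inter>n. below_grid a b s t n)"
  then have sp: "\<omega> \<in> space M" by (auto simp: below_grid_def)
  have "B u \<omega> - (a + b * u) \<le> 0" if "u \<in> {s..t}" for u
  proof (rule dyadic_grid_dense[OF _ s(2) _ that])
    show "continuous_on {s..t} (\<lambda>u. B u \<omega> - (a + b * u))"
      using continuous_on_subset[OF continuous_B[OF sp], of "{s..t}"] s by (auto intro!: continuous_intros)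
    fix n i :: nat assume "i \<le> 2 ^ n"
    then show "B (s + (t - s) * real i / 2 ^ n) \<omega> - (a + b * (s + (t - s) * real i / 2 ^ n)) \<le> 0"
      using w by (auto simp: below_grid_def grid_def)
  qed
  then show "\<omega> \<in> below a b s t" using sp by (auto simp: below_def)
qed

lemma below_grid_measurable:
  assumes s: "0 \<le> s" "s < t"
  shows "below_grid a b s t n \<in> sets (F t)"
proof -
  have "below_grid a b s t n = {\<omega>\<in>space (F t). \<forall>i\<in>{..2 ^ n}. B (grid s t n i) \<omega> \<le> a + b * grid s t n i}"
    by (auto simp: below_grid_def)
  also have "\<dots> \<in> sets (F t)"
  proof (rule sets.sets_Collect_finite_All)
    fix i :: nat assume "i \<in> {..2 ^ n}"
    then have [measurable]: "B (grid s t n i) \<in> borel_measurable (F t)"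
      using grid_ge[OF s(2)] grid_le[OF s(2), of n i "2 ^ n"] s by (intro measurable_B_F) (auto intro: order_trans)
    show "{\<omega>\<in>space (F t). B (grid s t n i) \<omega> \<le> a + b * grid s t n i} \<in> sets (F t)" by measurable
  qed auto
  finally show ?thesis .
qed

lemma below_measurable: "0 \<le> s \<Longrightarrow> s < t \<Longrightarrow> below a b s t \<in> sets (F t)"
  using below_grid_measurable by (auto simp: below_eq)

lemma below_grid_decseq: "decseq (below_grid a b s t)"
proof (rule decseq_SucI)
  fix n
  show "below_grid a b s t (Suc n) \<subseteq> below_grid a b s t n"
    by (auto simp: below_grid_def grid_refine[of s t n])
qed

text \<open>The grid events decrease to \<open>below\<close>, so a lower bound that is uniform in
  the mesh survives the limit.\<close>

lemma below_lower_limit: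
  assumes s: "0 \<le> s" "s < t" and Q: "Q \<in> sets M"
    and le: "\<And>n. c \<le> emeasure M (Q \<inter> below_grid a b s t n) + d"
  shows "c \<le> emeasure M (Q \<inter> below a b s t) + d"
proof -
  have "(\<lambda>n. emeasure M (Q \<inter> below_grid a b s t n)) \<longlonglongrightarrow> emeasure M (\<Inter>n. Q \<inter> below_grid a b s t n)"
    using below_grid_decseq[of a b s t] Q F_sets_M[OF below_grid_measurable[OF s]]
    by (intro Lim_emeasure_decseq) (auto simp: decseq_def)
  also have "(\<Inter>n. Q \<inter> below_grid a b s t n) = Q \<inter> below a b s t"
    unfolding below_eq[OF s] by auto
  finally have "(\<lambda>n. emeasure M (Q \<inter> below_grid a b s t n) + d) \<longlonglongrightarrow> emeasure M (Q \<inter> below a b s t) + d"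
    by (intro tendsto_intros)
  then show ?thesis by (rule LIMSEQ_le_const) (use le in auto)
qed

text \<open>That the first exit happens at grid point \<open>i\<close> is known at that time, so the
  ordinary Markov property can be applied there. This takes the place of the strong Markov
  property.\<close>

lemma first_exit_measurable:
  assumes s: "0 \<le> s" "s < t" and Q: "Q \<in> sets (F s)"
  shows "{\<omega>\<in>Q. \<omega> \<in> {\<omega>\<in>space M. a + b * grid s t n i < B (grid s t n i) \<omega>} \<and>
    (\<forall>j<i. \<omega> \<notin> {\<omega>\<in>space M. a + b * grid s t n j < B (grid s t n j) \<omega>})} \<in> sets (F (grid s t n i))"
proof -
  let ?N = "F (grid s t n i)"
  have "Q \<in> sets ?N" using Q F_mono[OF grid_ge[OF s(2)]] by blast
  moreover have "{\<omega>\<in>space M. a + b * grid s t n j < B (grid s t n j) \<omega>} \<in> sets ?N" if "j \<le> i" for j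
  proof -
    have [measurable]: "B (grid s t n j) \<in> borel_measurable ?N"
      using grid_ge[OF s(2)] grid_le[OF s(2), of n j i] s that by (intro measurable_B_F) (auto intro: order_trans)
    have "{\<omega>\<in>space ?N. a + b * grid s t n j < B (grid s t n j) \<omega>} \<in> sets ?N" by measurable
    then show ?thesis by simp
  qed
  ultimately have "Q \<inter> {\<omega>\<in>space M. a + b * grid s t n i < B (grid s t n i) \<omega>} -
    (\<Union>j<i. {\<omega>\<in>space M. a + b * grid s t n j < B (grid s t n j) \<omega>}) \<in> sets ?N" by auto
  also have "Q \<inter> {\<omega>\<in>space M. a + b * grid s t n i < B (grid s t n i) \<omega>} -
    (\<Union>j<i. {\<omega>\<in>space M. a + b * grid s t n j < B (grid s t n j) \<omega>}) = {\<omega>\<in>Q. \<omega> \<in> {\<omega>\<in>space M. a + b * grid s t n i < B (grid s t n i) \<omega>} \<and>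
    (\<forall>j<i. \<omega> \<notin> {\<omega>\<in>space M. a + b * grid s t n j < B (grid s t n j) \<omega>})}" by auto
  finally show ?thesis .
qed

text \<open>One half of the reflection principle. At the first grid point above \<open>m\<close> the
  path may be reflected at \<open>m\<close> itself: the overshoot only makes a target in
  \<open>W\<close> less likely than its mirror image, so no error term arises.\<close>

lemma reflection_lower:
  assumes s: "0 \<le> s" "s < t" and Q: "Q \<in> sets (F s)" and W[measurable]: "W \<in> sets borel" and Wm: "W \<subseteq> {..m}"
  shows "emeasure M {\<omega>\<in>Q. B t \<omega> \<in> W} \<le>
    emeasure M ({\<omega>\<in>Q. B t \<omega> \<in> W} \<inter> below m 0 s t) + emeasure M {\<omega>\<in>Q. 2 * m - B t \<omega> \<in> W}"
proof (rule below_lower_limit[OF s])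
  have t: "0 \<le> t" using s by simp
  note [measurable] = measurable_B[OF s(1)] measurable_B[OF t]
  have QM[measurable]: "Q \<in> sets M" using Q by (rule F_sets_M)
  show QW: "{\<omega>\<in>Q. B t \<omega> \<in> W} \<in> sets M" by measurable
  fix n
  define A where "A i = {\<omega>\<in>space M. m + 0 * grid s t n i < B (grid s t n i) \<omega>}" for i
  have A[measurable]: "A i \<in> sets M" for i
    using measurable_B[OF order_trans[OF s(1) grid_ge[OF s(2), of n i]]] unfolding A_def by measurable
  have exit: "(\<integral>\<^sup>+\<omega>. indicator {\<omega>\<in>Q. \<exists>i\<le>2 ^ n. \<omega> \<in> A i} \<omega> * indicator W (B t \<omega>) \<partial>M) \<le>
    (\<integral>\<^sup>+\<omega>. indicator {\<omega>\<in>Q. \<exists>i\<le>2 ^ n. \<omega> \<in> A i} \<omega> * indicator W (2 * m - B t \<omega>) \<partial>M) + (\<Sum>i\<le>2 ^ n::nat. 0)"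
  proof (rule nn_integral_first_exit)
    fix i :: nat assume i: "i \<le> 2 ^ n"
    let ?E = "{\<omega>\<in>Q. \<omega> \<in> A i \<and> (\<forall>j<i. \<omega> \<notin> A j)}"
    have E: "?E \<in> sets (F (grid s t n i))" using first_exit_measurable[OF s Q, of m 0 n i] unfolding A_def .
    have "(\<integral>\<^sup>+\<omega>. indicator ?E \<omega> * indicator W (B t \<omega>) \<partial>M) \<le>
      (\<integral>\<^sup>+\<omega>. indicator ?E \<omega> * indicator W (2 * m - B t \<omega>) \<partial>M)"
    proof (cases "i = 2 ^ n")
      \<comment> \<open>An exit at the last grid point means \<open>B t > m\<close>, which excludes
        \<open>B t \<in> W\<close>; there is nothing to reflect.\<close>
      case True
      have "(\<integral>\<^sup>+\<omega>. indicator ?E \<omega> * indicator W (B t \<omega>) \<partial>M) = (\<integral>\<^sup>+\<omega>. 0 \<partial>M)"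
        using True Wm by (intro nn_integral_cong) (auto simp: A_def split: split_indicator)
      then show ?thesis by simp
    next
      case False
      then show ?thesis using i s grid_less[OF s(2), of n i "2 ^ n"] grid_ge[OF s(2), of n i]
        by (intro reflect_above[OF _ _ E W Wm]) (auto simp: A_def)
    qed
    then show "(\<integral>\<^sup>+\<omega>. indicator ?E \<omega> * indicator W (B t \<omega>) \<partial>M) \<le>
      (\<integral>\<^sup>+\<omega>. indicator ?E \<omega> * indicator W (2 * m - B t \<omega>) \<partial>M) + 0" by simp
  qed auto
  define X where "X = {\<omega>\<in>Q. \<exists>i\<le>2 ^ n. \<omega> \<in> A i}"
  note exit = exit[folded X_def]
  have XM[measurable]: "X \<in> sets M"
  proof -
    have "X = Q \<inter> (\<Union>i\<in>{..2 ^ n}. A i)" by (auto simp: X_def)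
    also have "\<dots> \<in> sets M" by (intro sets.Int QM sets.finite_UN A) auto
    finally show ?thesis .
  qed
  have Qsp: "\<omega> \<in> space M" if "\<omega> \<in> Q" for \<omega> using that sets.sets_into_space[OF QM] by auto
  have gm[measurable]: "below_grid m 0 s t n \<in> sets M" by (rule F_sets_M[OF below_grid_measurable[OF s]])
  have "emeasure M {\<omega>\<in>Q. B t \<omega> \<in> W} \<le> emeasure M (({\<omega>\<in>Q. B t \<omega> \<in> W} \<inter> below_grid m 0 s t n) \<union> {\<omega>\<in>X. B t \<omega> \<in> W})"
  proof (rule emeasure_mono)
    show "{\<omega>\<in>Q. B t \<omega> \<in> W} \<subseteq> ({\<omega>\<in>Q. B t \<omega> \<in> W} \<inter> below_grid m 0 s t n) \<union> {\<omega>\<in>X. B t \<omega> \<in> W}"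
      using Qsp by (auto simp: X_def below_grid_def A_def not_less)
  qed measurable
  also have "\<dots> \<le> emeasure M ({\<omega>\<in>Q. B t \<omega> \<in> W} \<inter> below_grid m 0 s t n) + emeasure M {\<omega>\<in>X. B t \<omega> \<in> W}"
    by (rule emeasure_subadditive) measurable
  also have "emeasure M {\<omega>\<in>X. B t \<omega> \<in> W} = (\<integral>\<^sup>+\<omega>. indicator X \<omega> * indicator W (B t \<omega>) \<partial>M)"
    by (subst nn_integral_indicator[symmetric], measurable, rule nn_integral_cong) (auto split: split_indicator)
  also have "\<dots> \<le> (\<integral>\<^sup>+\<omega>. indicator X \<omega> * indicator W (2 * m - B t \<omega>) \<partial>M)" using exit by simp
  also have "\<dots> \<le> (\<integral>\<^sup>+\<omega>. indicator {\<omega>\<in>Q. 2 * m - B t \<omega> \<in> W} \<omega> \<partial>M)"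
    by (intro nn_integral_mono) (auto simp: X_def split: split_indicator)
  also have "\<dots> = emeasure M {\<omega>\<in>Q. 2 * m - B t \<omega> \<in> W}" by (rule nn_integral_indicator) measurable
  finally show "emeasure M {\<omega>\<in>Q. B t \<omega> \<in> W} \<le>
    emeasure M ({\<omega>\<in>Q. B t \<omega> \<in> W} \<inter> below_grid m 0 s t n) + emeasure M {\<omega>\<in>Q. 2 * m - B t \<omega> \<in> W}"
    by (simp add: add_left_mono)
qed

text \<open>At the first grid point above the line the exponential martingale is at least 1, so the
  probability of an exit is at most the expectation of the martingale at time \<open>s\<close>. This
  bound does not depend on the mesh or on the horizon, so both can be sent to their limits.\<close>

lemma tail_lower:
  assumes s: "0 \<le> s" and Q: "Q \<in> sets (F s)" and b: "0 \<le> b"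
  shows "emeasure M Q \<le> emeasure M {\<omega>\<in>Q. \<forall>u\<ge>s. B u \<omega> \<le> a + b * u} +
    (\<integral>\<^sup>+\<omega>. indicator Q \<omega> * ennreal (exp (- 2 * b * (a + b * s - B s \<omega>))) \<partial>M)"
    (is "_ \<le> _ + ?G") and tail_measurable: "{\<omega>\<in>Q. \<forall>u\<ge>s. B u \<omega> \<le> a + b * u} \<in> sets M"
proof -
  have QM[measurable]: "Q \<in> sets M" using Q by (rule F_sets_M)
  have Qsp: "\<omega> \<in> space M" if "\<omega> \<in> Q" for \<omega> using that sets.sets_into_space[OF QM] by auto
  have *: "emeasure M Q \<le> emeasure M (Q \<inter> below a b s t) + ?G" if t: "s < t" for t
  proof (rule below_lower_limit[OF s t QM])
    fix n
    have t0: "0 \<le> t" using s t by simp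
    note [measurable] = measurable_B[OF s] measurable_B[OF t0]
    define A where "A i = {\<omega>\<in>space M. a + b * grid s t n i < B (grid s t n i) \<omega>}" for i
    have A[measurable]: "A i \<in> sets M" for i
      using measurable_B[OF order_trans[OF s(1) grid_ge[OF t, of n i]]] unfolding A_def by measurable
    have exit: "(\<integral>\<^sup>+\<omega>. indicator {\<omega>\<in>Q. \<exists>i\<le>2 ^ n. \<omega> \<in> A i} \<omega> * 1 \<partial>M) \<le>
      (\<integral>\<^sup>+\<omega>. indicator {\<omega>\<in>Q. \<exists>i\<le>2 ^ n. \<omega> \<in> A i} \<omega> * ennreal (exp (- 2 * b * (a + b * t - B t \<omega>))) \<partial>M) + (\<Sum>i\<le>2 ^ n::nat. 0)"
    proof (rule nn_integral_first_exit)
      fix i :: nat assume i: "i \<le> 2 ^ n"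
      let ?E = "{\<omega>\<in>Q. \<omega> \<in> A i \<and> (\<forall>j<i. \<omega> \<notin> A j)}"
      have E: "?E \<in> sets (F (grid s t n i))" using first_exit_measurable[OF s t Q, of a b n i] unfolding A_def .
      have "(\<integral>\<^sup>+\<omega>. indicator ?E \<omega> * 1 \<partial>M) \<le>
        (\<integral>\<^sup>+\<omega>. indicator ?E \<omega> * ennreal (exp (- 2 * b * (a + b * grid s t n i - B (grid s t n i) \<omega>))) \<partial>M)"
      proof (rule nn_integral_mono)
        fix \<omega>
        have "1 \<le> ennreal (exp (- 2 * b * (a + b * grid s t n i - B (grid s t n i) \<omega>)))" if "\<omega> \<in> A i"
        proof -
          have "b * (a + b * grid s t n i - B (grid s t n i) \<omega>) \<le> 0"
            using that by (intro mult_nonneg_nonpos b) (auto simp: A_def)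
          then have "1 \<le> exp (- 2 * b * (a + b * grid s t n i - B (grid s t n i) \<omega>))"
            unfolding one_le_exp_iff by linarith
          then show ?thesis using ennreal_leI by fastforce
        qed
        then show "indicator ?E \<omega> * 1 \<le> indicator ?E \<omega> * ennreal (exp (- 2 * b * (a + b * grid s t n i - B (grid s t n i) \<omega>)))"
          by (auto split: split_indicator)
      qed
      also have "\<dots> = (\<integral>\<^sup>+\<omega>. indicator ?E \<omega> * ennreal (exp (- 2 * b * (a + b * t - B t \<omega>))) \<partial>M)"
      proof (cases "i = 2 ^ n")
        case False
        then show ?thesis using i s t grid_less[OF t, of n i "2 ^ n"] grid_ge[OF t, of n i]
          by (intro exp_martingale[OF _ _ E, symmetric]) auto
      qed simp
      finally show "(\<integral>\<^sup>+\<omega>. indicator ?E \<omega> * 1 \<partial>M) \<le>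
        (\<integral>\<^sup>+\<omega>. indicator ?E \<omega> * ennreal (exp (- 2 * b * (a + b * t - B t \<omega>))) \<partial>M) + 0" by simp
    qed auto
    define X where "X = {\<omega>\<in>Q. \<exists>i\<le>2 ^ n. \<omega> \<in> A i}"
    note exit = exit[folded X_def]
    have XM[measurable]: "X \<in> sets M"
    proof -
      have "X = Q \<inter> (\<Union>i\<in>{..2 ^ n}. A i)" by (auto simp: X_def)
      also have "\<dots> \<in> sets M" by (intro sets.Int QM sets.finite_UN A) auto
      finally show ?thesis .
    qed
    have gm[measurable]: "below_grid a b s t n \<in> sets M" by (rule F_sets_M[OF below_grid_measurable[OF s t]])
    have "emeasure M Q \<le> emeasure M ((Q \<inter> below_grid a b s t n) \<union> X)"
    proof (rule emeasure_mono)
      show "Q \<subseteq> (Q \<inter> below_grid a b s t n) \<union> X"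
        using Qsp by (auto simp: X_def below_grid_def A_def not_less)
    qed auto
    also have "\<dots> \<le> emeasure M (Q \<inter> below_grid a b s t n) + emeasure M X"
      by (rule emeasure_subadditive) measurable
    also have "emeasure M X = (\<integral>\<^sup>+\<omega>. indicator X \<omega> * 1 \<partial>M)" by simp
    also have "\<dots> \<le> (\<integral>\<^sup>+\<omega>. indicator X \<omega> * ennreal (exp (- 2 * b * (a + b * t - B t \<omega>))) \<partial>M)" using exit by simp
    also have "\<dots> \<le> (\<integral>\<^sup>+\<omega>. indicator Q \<omega> * ennreal (exp (- 2 * b * (a + b * t - B t \<omega>))) \<partial>M)"
      by (intro nn_integral_mono) (auto simp: X_def split: split_indicator)
    also have "\<dots> = ?G" by (rule exp_martingale[OF s t Q])
    finally show "emeasure M Q \<le> emeasure M (Q \<inter> below_grid a b s t n) + ?G" by (simp add: add_left_mono)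
  qed
  \<comment> \<open>The summand 1 keeps the horizon strictly beyond \<open>s\<close> also for
    \<open>k = 0\<close>.\<close>
  define C where "C k = Q \<inter> below a b s (s + 1 + real k)" for k :: nat
  have C[measurable]: "C k \<in> sets M" for k
    unfolding C_def using s by (intro sets.Int QM F_sets_M[OF below_measurable]) auto
  have eq: "{\<omega>\<in>Q. \<forall>u\<ge>s. B u \<omega> \<le> a + b * u} = (\<Inter>k. C k)"
  proof (intro set_eqI iffI)
    fix \<omega> assume w: "\<omega> \<in> (\<Inter>k. C k)"
    then have "B u \<omega> \<le> a + b * u" if "s \<le> u" for u
    proof -
      obtain k :: nat where "u \<le> s + 1 + real k" using real_arch_simple[of "u - s - 1"] by (metis diff_le_eq add.commute add.assoc)
      then show ?thesis using w that by (auto simp: C_def below_def)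
    qed
    then show "\<omega> \<in> {\<omega>\<in>Q. \<forall>u\<ge>s. B u \<omega> \<le> a + b * u}" using w by (auto simp: C_def)
  qed (auto simp: C_def below_def Qsp)
  show "{\<omega>\<in>Q. \<forall>u\<ge>s. B u \<omega> \<le> a + b * u} \<in> sets M" unfolding eq by measurable
  have "(\<lambda>k. emeasure M (C k)) \<longlonglongrightarrow> emeasure M (\<Inter>k. C k)"
  proof (rule Lim_emeasure_decseq)
    show "decseq C" unfolding decseq_def C_def below_def by fastforce
  qed auto
  then have "(\<lambda>k. emeasure M (C k) + ?G) \<longlonglongrightarrow> emeasure M (\<Inter>k. C k) + ?G" by (intro tendsto_intros)
  moreover have "emeasure M Q \<le> emeasure M (C k) + ?G" for k
    unfolding C_def by (rule *) simp
  ultimately show "emeasure M Q \<le> emeasure M {\<omega>\<in>Q. \<forall>u\<ge>s. B u \<omega> \<le> a + b * u} + ?G"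
    unfolding eq by (intro LIMSEQ_le_const[where X="\<lambda>k. emeasure M (C k) + ?G"]) auto
qed

end

section \<open>Bounds for one block of time spent below a level\<close>

lemma normal_density_reflect:
  assumes "\<sigma> \<noteq> 0"
  shows "normal_density x \<sigma> (2 * m - z) = normal_density x \<sigma> z * exp (- 2 * (m - z) * (m - x) / \<sigma>\<^sup>2)"
proof -
  have "- (2 * m - z - x)\<^sup>2 / (2 * \<sigma>\<^sup>2) = - (z - x)\<^sup>2 / (2 * \<sigma>\<^sup>2) + - 2 * (m - z) * (m - x) / \<sigma>\<^sup>2"
    using assms by (simp add: field_simps power2_eq_square)
  then show ?thesis
    unfolding normal_density_def by (simp only: exp_add mult.assoc)
qed

lemma nn_integral_normal_abs:
  assumes "0 < \<sigma>" "0 \<le> a"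
  shows "(\<integral>\<^sup>+x. ennreal (normal_density 0 \<sigma> x) * ennreal (a + \<bar>x\<bar>) \<partial>lborel) \<le> ennreal (a + \<sigma>)"
proof -
  have abs: "has_bochner_integral lborel (\<lambda>x. normal_density 0 \<sigma> x * \<bar>x\<bar>) (\<sigma> * sqrt (2 / pi))"
    using normal_moment_abs_odd[OF assms(1), of 0 0] by simp
  have sq: "sqrt (2 / pi) \<le> 1" using pi_gt3 by (simp add: real_le_lsqrt)
  have "has_bochner_integral lborel (\<lambda>x. a * normal_density 0 \<sigma> x + normal_density 0 \<sigma> x * \<bar>x\<bar>) (a * 1 + \<sigma> * sqrt (2 / pi))"
    by (intro has_bochner_integral_add abs has_bochner_integral_mult_right)
      (use assms in \<open>simp add: has_bochner_integral_iff\<close>)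
  then have "(\<integral>\<^sup>+x. ennreal (a * normal_density 0 \<sigma> x + normal_density 0 \<sigma> x * \<bar>x\<bar>) \<partial>lborel) = ennreal (a * 1 + \<sigma> * sqrt (2 / pi))"
    by (subst nn_integral_eq_integral) (use assms in \<open>auto simp: has_bochner_integral_iff\<close>)
  moreover have "(\<integral>\<^sup>+x. ennreal (normal_density 0 \<sigma> x) * ennreal (a + \<bar>x\<bar>) \<partial>lborel) =
    (\<integral>\<^sup>+x. ennreal (a * normal_density 0 \<sigma> x + normal_density 0 \<sigma> x * \<bar>x\<bar>) \<partial>lborel)"
    by (intro nn_integral_cong) (use assms in \<open>simp add: ennreal_mult[symmetric] algebra_simps\<close>)
  ultimately show ?thesis
    using mult_left_mono[OF sq, of \<sigma>] assms by (simp add: ennreal_leI)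
qed

text \<open>Where \<open>\<bar>x\<bar> \<ge> L\<close> one has
  \<open>1 + \<bar>x\<bar> \<le> (\<bar>x\<bar> + x\<^sup>2) / L\<close>, and the first absolute
  moment and the second moment of the standard normal law are both at most 1.\<close>

lemma nn_integral_normal_abs_tail:
  assumes "0 < L"
  shows "(\<integral>\<^sup>+x. ennreal (normal_density 0 1 x) * (indicator {x. L \<le> \<bar>x\<bar>} x * ennreal (1 + \<bar>x\<bar>)) \<partial>lborel) \<le> ennreal (2 / L)"
proof -
  have abs: "has_bochner_integral lborel (\<lambda>x. normal_density 0 1 x * \<bar>x\<bar>) (sqrt (2 / pi))"
    using normal_moment_abs_odd[of 1 0 0] by simp
  have sqr: "has_bochner_integral lborel (\<lambda>x. normal_density 0 1 x * x\<^sup>2) 1"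
    using normal_moment_even[of 1 0 1] by simp
  have sq: "sqrt (2 / pi) \<le> 1" using pi_gt3 by (simp add: real_le_lsqrt)
  have "(\<integral>\<^sup>+x. ennreal (normal_density 0 1 x) * (indicator {x. L \<le> \<bar>x\<bar>} x * ennreal (1 + \<bar>x\<bar>)) \<partial>lborel)
    \<le> (\<integral>\<^sup>+x. ennreal ((normal_density 0 1 x * \<bar>x\<bar> + normal_density 0 1 x * x\<^sup>2) * (1 / L)) \<partial>lborel)"
  proof (rule nn_integral_mono)
    fix x :: real
    have "normal_density 0 1 x * (1 + \<bar>x\<bar>) \<le> (normal_density 0 1 x * \<bar>x\<bar> + normal_density 0 1 x * x\<^sup>2) * (1 / L)" if "L \<le> \<bar>x\<bar>"
    proof -
      have "(1 + \<bar>x\<bar>) * L \<le> (1 + \<bar>x\<bar>) * \<bar>x\<bar>" using that by (intro mult_left_mono) auto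
      then have "1 + \<bar>x\<bar> \<le> (\<bar>x\<bar> + x\<^sup>2) * (1 / L)" using assms by (simp add: field_simps power2_eq_square)
      then have "normal_density 0 1 x * (1 + \<bar>x\<bar>) \<le> normal_density 0 1 x * ((\<bar>x\<bar> + x\<^sup>2) * (1 / L))"
        by (intro mult_left_mono) auto
      then show ?thesis by (simp add: algebra_simps)
    qed
    then show "ennreal (normal_density 0 1 x) * (indicator {x. L \<le> \<bar>x\<bar>} x * ennreal (1 + \<bar>x\<bar>)) \<le> ennreal ((normal_density 0 1 x * \<bar>x\<bar> + normal_density 0 1 x * x\<^sup>2) * (1 / L))"
      by (auto split: split_indicator simp: ennreal_mult[symmetric] simp del: ennreal_plus intro!: ennreal_leI)
  qed
  also have "\<dots> = ennreal ((sqrt (2 / pi) + 1) * (1 / L))"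
  proof -
    have "has_bochner_integral lborel (\<lambda>x. (normal_density 0 1 x * \<bar>x\<bar> + normal_density 0 1 x * x\<^sup>2) * (1 / L)) ((sqrt (2 / pi) + 1) * (1 / L))"
      by (intro has_bochner_integral_mult_left has_bochner_integral_add abs sqr)
    then show ?thesis
      by (subst nn_integral_eq_integral) (use assms in \<open>auto simp: has_bochner_integral_iff\<close>)
  qed
  also have "\<dots> \<le> ennreal (2 / L)"
    using sq assms by (intro ennreal_leI) (simp add: field_simps)
  finally show ?thesis .
qed

context brownian
begin

text \<open>The other half of the reflection principle, where the overshoot at a first grid exit
  works in the wrong direction. The path is therefore reflected at \<open>m + \<kappa>\<close>, and
  the event that a single grid increment exceeds \<kappa> is paid for separately.\<close>

lemma reflection_upper:
  assumes s: "0 \<le> s" "s < t" and Q: "Q \<in> sets (F s)" and Qm: "\<And>\<omega>. \<omega> \<in> Q \<Longrightarrow> B s \<omega> \<le> m"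
    and W[measurable]: "W \<in> sets borel" and Wm: "W \<subseteq> {..m}" and k: "0 < \<kappa>"
  shows "emeasure M ({\<omega>\<in>Q. B t \<omega> \<in> W} \<inter> below m 0 s t) + emeasure M {\<omega>\<in>Q. 2 * (m + \<kappa>) - B t \<omega> \<in> W}
    \<le> emeasure M {\<omega>\<in>Q. B t \<omega> \<in> W}" (is "?S + ?R \<le> ?P")
proof -
  have t: "0 \<le> t" using s by simp
  note [measurable] = measurable_B[OF s(1)] measurable_B[OF t]
  have QM[measurable]: "Q \<in> sets M" using Q by (rule F_sets_M)
  have Qsp: "\<omega> \<in> space M" if "\<omega> \<in> Q" for \<omega> using that sets.sets_into_space[OF QM] by auto
  have bm[measurable]: "below m 0 s t \<in> sets M" by (rule F_sets_M[OF below_measurable[OF s]])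
  have QW[measurable]: "{\<omega>\<in>Q. B t \<omega> \<in> W} \<in> sets M" by measurable
  have *: "?S + ?R \<le> ?P + ennreal (3 * (t - s)\<^sup>2 / \<kappa> ^ 4 * (1 / 2) ^ n)" for n
  proof -
    define h where "h = (t - s) / 2 ^ n"
    \<comment> \<open>No exit can occur at index 0, because \<open>Q\<close> starts at or below
      \<open>m\<close>. At a later first exit the previous grid value is still at most
      \<open>m\<close>, so an overshoot beyond \<kappa> needs an increment larger than
      \<kappa>.\<close>
    define e where "e i = (if i = 0 then 0 else ennreal (3 * h\<^sup>2 / \<kappa> ^ 4))" for i :: nat
    define A where "A i = {\<omega>\<in>space M. m + 0 * grid s t n i < B (grid s t n i) \<omega>}" for i
    have gm: "0 \<le> grid s t n i" for i using order_trans[OF s(1) grid_ge[OF s(2), of n i]] .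
    have A[measurable]: "A i \<in> sets M" for i
      using measurable_B[OF gm, of i] unfolding A_def by measurable
    define X where "X = {\<omega>\<in>Q. \<exists>i\<le>2 ^ n. \<omega> \<in> A i}"
    have XM[measurable]: "X \<in> sets M"
    proof -
      have "X = Q \<inter> (\<Union>i\<in>{..2 ^ n}. A i)" by (auto simp: X_def)
      also have "\<dots> \<in> sets M" by (intro sets.Int QM sets.finite_UN A) auto
      finally show ?thesis .
    qed
    have exit: "(\<integral>\<^sup>+\<omega>. indicator X \<omega> * indicator W (2 * (m + \<kappa>) - B t \<omega>) \<partial>M) \<le>
      (\<integral>\<^sup>+\<omega>. indicator X \<omega> * indicator W (B t \<omega>) \<partial>M) + (\<Sum>i\<le>2 ^ n. e i)"
      unfolding X_def
    proof (rule nn_integral_first_exit)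
      fix i :: nat assume i: "i \<le> 2 ^ n"
      define E where "E = {\<omega>\<in>Q. \<omega> \<in> A i \<and> (\<forall>j<i. \<omega> \<notin> A j)}"
      have E: "E \<in> sets (F (grid s t n i))" using first_exit_measurable[OF s Q, of m 0 n i] unfolding A_def E_def .
      have EM[measurable]: "E \<in> sets M" by (rule F_sets_M[OF E])
      define E1 where "E1 = {\<omega>\<in>E. B (grid s t n i) \<omega> \<le> m + \<kappa>}"
      have E1: "E1 \<in> sets (F (grid s t n i))"
      proof -
        have "{\<omega>\<in>space (F (grid s t n i)). B (grid s t n i) \<omega> \<le> m + \<kappa>} \<in> sets (F (grid s t n i))"
          using measurable_B_F[OF gm order_refl, of i] by measurable
        then have "E \<inter> {\<omega>\<in>space (F (grid s t n i)). B (grid s t n i) \<omega> \<le> m + \<kappa>} \<in> sets (F (grid s t n i))" using E by auto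
        also have "E \<inter> {\<omega>\<in>space (F (grid s t n i)). B (grid s t n i) \<omega> \<le> m + \<kappa>} = E1"
          using Qsp by (auto simp: E1_def E_def)
        finally show ?thesis .
      qed
      have E1M[measurable]: "E1 \<in> sets M" by (rule F_sets_M[OF E1])
      have "(\<integral>\<^sup>+\<omega>. indicator E \<omega> * indicator W (2 * (m + \<kappa>) - B t \<omega>) \<partial>M) \<le>
        (\<integral>\<^sup>+\<omega>. indicator E \<omega> * indicator W (B t \<omega>) \<partial>M) + e i"
      proof (cases "i = 0")
        case True
        then have "E = {}" using Qm by (auto simp: E_def A_def not_less)
        then show ?thesis by simp
      next
        case False
        then obtain j where j: "i = Suc j" by (cases i) auto
        define Ov where "Ov = {\<omega>\<in>space M. \<kappa> < B (grid s t n i) \<omega> - B (grid s t n j) \<omega>}"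
        have OM[measurable]: "Ov \<in> sets M" using measurable_B[OF gm, of i] measurable_B[OF gm, of j] unfolding Ov_def by measurable
        have Oe: "emeasure M Ov \<le> e i"
          using increment_tail_bound[OF gm _ k, of j "grid s t n i"] grid_less[OF s(2), of n j i] grid_Suc[of s t n j]
          by (simp add: Ov_def e_def h_def j)
        have sub: "E \<subseteq> E1 \<union> Ov"
          using Qsp by (auto simp: E_def E1_def Ov_def A_def j not_less)
        have "(\<integral>\<^sup>+\<omega>. indicator E \<omega> * indicator W (2 * (m + \<kappa>) - B t \<omega>) \<partial>M) \<le>
          (\<integral>\<^sup>+\<omega>. indicator E1 \<omega> * indicator W (2 * (m + \<kappa>) - B t \<omega>) + indicator Ov \<omega> \<partial>M)"
          using sub by (intro nn_integral_mono) (auto split: split_indicator)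
        also have "\<dots> = (\<integral>\<^sup>+\<omega>. indicator E1 \<omega> * indicator W (2 * (m + \<kappa>) - B t \<omega>) \<partial>M) + emeasure M Ov"
          by (subst nn_integral_add) auto
        also have "(\<integral>\<^sup>+\<omega>. indicator E1 \<omega> * indicator W (2 * (m + \<kappa>) - B t \<omega>) \<partial>M) \<le>
          (\<integral>\<^sup>+\<omega>. indicator E1 \<omega> * indicator W (B t \<omega>) \<partial>M)"
        proof (cases "i = 2 ^ n")
          \<comment> \<open>Here \<open>B t \<le> m + \<kappa>\<close>, so the mirror image of
            \<open>B t\<close> is at least \<open>m + \<kappa>\<close> and lies outside
            \<open>W\<close>.\<close>
          case True
          have "(\<integral>\<^sup>+\<omega>. indicator E1 \<omega> * indicator W (2 * (m + \<kappa>) - B t \<omega>) \<partial>M) = (\<integral>\<^sup>+\<omega>. 0 \<partial>M)"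
            using True Wm k by (intro nn_integral_cong) (auto simp: E1_def split: split_indicator)
          then show ?thesis by simp
        next
          case False
          then show ?thesis using i s grid_less[OF s(2), of n i "2 ^ n"] gm Wm k
            by (intro reflect_below[OF _ _ E1 W]) (auto simp: E1_def)
        qed
        also have "(\<integral>\<^sup>+\<omega>. indicator E1 \<omega> * indicator W (B t \<omega>) \<partial>M) \<le> (\<integral>\<^sup>+\<omega>. indicator E \<omega> * indicator W (B t \<omega>) \<partial>M)"
          by (intro nn_integral_mono) (auto simp: E1_def split: split_indicator)
        finally have "(\<integral>\<^sup>+\<omega>. indicator E \<omega> * indicator W (2 * (m + \<kappa>) - B t \<omega>) \<partial>M) \<le>
          (\<integral>\<^sup>+\<omega>. indicator E \<omega> * indicator W (B t \<omega>) \<partial>M) + emeasure M Ov"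
          by (simp add: add_right_mono)
        then show ?thesis by (rule order_trans[OF _ add_left_mono[OF Oe]])
      qed
      then show "(\<integral>\<^sup>+\<omega>. indicator {\<omega>\<in>Q. \<omega> \<in> A i \<and> (\<forall>j<i. \<omega> \<notin> A j)} \<omega> * indicator W (2 * (m + \<kappa>) - B t \<omega>) \<partial>M) \<le>
        (\<integral>\<^sup>+\<omega>. indicator {\<omega>\<in>Q. \<omega> \<in> A i \<and> (\<forall>j<i. \<omega> \<notin> A j)} \<omega> * indicator W (B t \<omega>) \<partial>M) + e i"
        unfolding E_def .
    qed auto
    have end_ge: "B t \<omega> \<le> m" if "\<omega> \<in> Q" "\<omega> \<notin> X" for \<omega>
    proof -
      have "\<omega> \<notin> A (2 ^ n)" using that by (auto simp: X_def)
      then show ?thesis using Qsp[OF that(1)] by (simp add: A_def not_less)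
    qed
    have "?R = (\<integral>\<^sup>+\<omega>. indicator {\<omega>\<in>Q. 2 * (m + \<kappa>) - B t \<omega> \<in> W} \<omega> \<partial>M)"
      by (rule nn_integral_indicator[symmetric]) measurable
    also have "\<dots> \<le> (\<integral>\<^sup>+\<omega>. indicator X \<omega> * indicator W (2 * (m + \<kappa>) - B t \<omega>) \<partial>M)"
    proof (intro nn_integral_mono)
      fix \<omega>
      have "\<omega> \<in> X" if "\<omega> \<in> Q" "2 * (m + \<kappa>) - B t \<omega> \<in> W"
        using end_ge[of \<omega>] that Wm k by fastforce
      then show "indicator {\<omega>\<in>Q. 2 * (m + \<kappa>) - B t \<omega> \<in> W} \<omega> \<le> (indicator X \<omega> * indicator W (2 * (m + \<kappa>) - B t \<omega>) :: ennreal)"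
        by (auto split: split_indicator)
    qed
    finally have R: "?R \<le> (\<integral>\<^sup>+\<omega>. indicator X \<omega> * indicator W (B t \<omega>) \<partial>M) + (\<Sum>i\<le>2 ^ n. e i)"
      using exit by (rule order_trans)
    have "?S + (\<integral>\<^sup>+\<omega>. indicator X \<omega> * indicator W (B t \<omega>) \<partial>M) =
      (\<integral>\<^sup>+\<omega>. indicator ({\<omega>\<in>Q. B t \<omega> \<in> W} \<inter> below m 0 s t) \<omega> + indicator X \<omega> * indicator W (B t \<omega>) \<partial>M)"
      by (subst nn_integral_add) auto
    also have "\<dots> \<le> (\<integral>\<^sup>+\<omega>. indicator {\<omega>\<in>Q. B t \<omega> \<in> W} \<omega> \<partial>M)"
    proof (intro nn_integral_mono)
      fix \<omega>
      have "\<omega> \<notin> X" if "\<omega> \<in> below m 0 s t"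
        using that grid_ge[OF s(2)] grid_le_end[OF s(2)] by (auto simp: X_def A_def below_def not_less)
      then show "indicator ({\<omega>\<in>Q. B t \<omega> \<in> W} \<inter> below m 0 s t) \<omega> + indicator X \<omega> * indicator W (B t \<omega>) \<le> (indicator {\<omega>\<in>Q. B t \<omega> \<in> W} \<omega> :: ennreal)"
        by (auto split: split_indicator simp: X_def)
    qed
    also have "\<dots> = ?P" by (rule nn_integral_indicator) measurable
    finally have S: "?S + (\<integral>\<^sup>+\<omega>. indicator X \<omega> * indicator W (B t \<omega>) \<partial>M) \<le> ?P" .
    have "(\<Sum>i\<le>2 ^ n. e i) = (\<Sum>i\<in>{0<..2 ^ n :: nat}. ennreal (3 * h\<^sup>2 / \<kappa> ^ 4))"
      by (intro sum.mono_neutral_cong_right) (auto simp: e_def)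
    also have "\<dots> = ennreal (2 ^ n * (3 * h\<^sup>2 / \<kappa> ^ 4))"
    proof -
      have "ennreal (2 ^ n) = 2 ^ n" by (subst ennreal_power[symmetric]) auto
      then show ?thesis using ennreal_mult'[of "2 ^ n" "3 * h\<^sup>2 / \<kappa> ^ 4"] by simp
    qed
    also have "2 ^ n * (3 * h\<^sup>2 / \<kappa> ^ 4) = 3 * (t - s)\<^sup>2 / \<kappa> ^ 4 * (1 / 2) ^ n"
      by (simp add: h_def power2_eq_square power_divide)
    finally have e: "(\<Sum>i\<le>2 ^ n. e i) = ennreal (3 * (t - s)\<^sup>2 / \<kappa> ^ 4 * (1 / 2) ^ n)" .
    have "?S + ?R \<le> ?S + (\<integral>\<^sup>+\<omega>. indicator X \<omega> * indicator W (B t \<omega>) \<partial>M) + (\<Sum>i\<le>2 ^ n. e i)"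
      using add_left_mono[OF R, of ?S] by (simp add: add.assoc)
    also have "\<dots> \<le> ?P + (\<Sum>i\<le>2 ^ n. e i)" using S by (rule add_right_mono)
    finally show ?thesis unfolding e .
  qed
  \<comment> \<open>There are \<open>2 ^ n\<close> error terms, each of order
    \<open>4 ^ (- n)\<close>, so they disappear with the mesh while \<kappa> stays fixed.\<close>
  have "(\<lambda>n. 3 * (t - s)\<^sup>2 / \<kappa> ^ 4 * (1 / 2) ^ n) \<longlonglongrightarrow> 3 * (t - s)\<^sup>2 / \<kappa> ^ 4 * 0"
    by (intro tendsto_mult tendsto_const) (rule LIMSEQ_power_zero, simp)
  then have "(\<lambda>n. ?P + ennreal (3 * (t - s)\<^sup>2 / \<kappa> ^ 4 * (1 / 2) ^ n)) \<longlonglongrightarrow> ?P + ennreal (3 * (t - s)\<^sup>2 / \<kappa> ^ 4 * 0)"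
    by (intro tendsto_add tendsto_const tendsto_ennrealI)
  then show ?thesis
    using * LIMSEQ_le_const[of "\<lambda>n. ?P + ennreal (3 * (t - s)\<^sup>2 / \<kappa> ^ 4 * (1 / 2) ^ n)" ?P "?S + ?R"] by simp
qed

text \<open>The Gaussian density on the window is at least its value at the distance
  \<open>d\<close>. Among the paths from \<open>x\<close> to \<open>z\<close>, reflection removes a
  fraction \<open>exp (- 2 * (m - z) * (m - x) / (t - s))\<close>, which is the crossing probability
  of a Brownian bridge; it is largest at the upper ends \<open>x2\<close> and
  \<open>w2\<close>.\<close>

lemma block_lower:
  assumes s: "0 \<le> s" "s < t" and Q: "Q \<in> sets (F s)"
    and Qx: "\<And>\<omega>. \<omega> \<in> Q \<Longrightarrow> x1 \<le> B s \<omega> \<and> B s \<omega> \<le> x2"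
    and w: "w1 \<le> w2" "w2 \<le> m" "x2 \<le> m"
    and d: "\<And>x z. x1 \<le> x \<Longrightarrow> x \<le> x2 \<Longrightarrow> w1 \<le> z \<Longrightarrow> z \<le> w2 \<Longrightarrow> \<bar>z - x\<bar> \<le> d"
  shows "(w2 - w1) * normal_density 0 (sqrt (t - s)) d * (1 - exp (- 2 * (m - w2) * (m - x2) / (t - s))) * prob Q
    \<le> prob ({\<omega>\<in>Q. B t \<omega> \<in> {w1..w2}} \<inter> below m 0 s t)"
proof -
  have t: "0 \<le> t" using s by simp
  note [measurable] = measurable_B[OF s(1)] measurable_B[OF t]
  have QM[measurable]: "Q \<in> sets M" using Q by (rule F_sets_M)
  have Qsp: "\<omega> \<in> space M" if "\<omega> \<in> Q" for \<omega> using that sets.sets_into_space[OF QM] by auto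
  have Qi: "indicator Q \<in> borel_measurable (F s)" using Q by simp
  let ?W = "{w1..w2}"
  let ?e = "exp (- 2 * (m - w2) * (m - x2) / (t - s))"
  let ?\<sigma> = "sqrt (t - s)"
  have e1: "?e \<le> 1" using s w 
    by (simp add: divide_nonpos_pos mult_nonpos_nonneg)
  have W: "?W \<in> sets borel" "?W \<subseteq> {..m}" using w by auto
  have r1: "emeasure M {\<omega>\<in>Q. 2 * m - B t \<omega> \<in> ?W} = (\<integral>\<^sup>+\<omega>. indicator Q \<omega> * indicator ?W (2 * m - B t \<omega>) \<partial>M)"
    by (subst nn_integral_indicator[symmetric], measurable, rule nn_integral_cong) (auto split: split_indicator)
  have r2: "emeasure M {\<omega>\<in>Q. B t \<omega> \<in> ?W} = (\<integral>\<^sup>+\<omega>. indicator Q \<omega> * indicator ?W (B t \<omega>) \<partial>M)"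
    by (subst nn_integral_indicator[symmetric], measurable, rule nn_integral_cong) (auto split: split_indicator)
  have "emeasure M {\<omega>\<in>Q. 2 * m - B t \<omega> \<in> ?W} \<le> (\<integral>\<^sup>+\<omega>. indicator Q \<omega> * (ennreal ?e * indicator ?W (B t \<omega>)) \<partial>M)"
    unfolding r1
  proof (rule reflect_aux[OF s Q, of "\<lambda>z. indicator ?W (2 * m - z)" "\<lambda>z. ennreal ?e * indicator ?W z" m])
    fix x z assume "x \<in> B s ` Q"
    then have x: "x \<le> x2" using Qx by auto
    have "normal_density x ?\<sigma> z \<le> normal_density x ?\<sigma> (2 * m - z) * ?e" if "2 * m - z \<in> ?W"
    proof -
      have "(m - w2) * (m - x2) \<le> (m - (2 * m - z)) * (m - x)"
        using that w x by (intro mult_mono) auto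
      then have "- 2 * ((m - (2 * m - z)) * (m - x)) / (t - s) \<le> - 2 * ((m - w2) * (m - x2)) / (t - s)"
        using s by (intro divide_right_mono) linarith+
      then have "- 2 * (m - (2 * m - z)) * (m - x) / ?\<sigma>\<^sup>2 \<le> - 2 * (m - w2) * (m - x2) / (t - s)"
        using s by (simp only: mult.assoc) simp
      then have "normal_density x ?\<sigma> (2 * m - z) * exp (- 2 * (m - (2 * m - z)) * (m - x) / ?\<sigma>\<^sup>2) \<le> normal_density x ?\<sigma> (2 * m - z) * ?e"
        by (intro mult_left_mono) auto
      then show ?thesis using normal_density_reflect[of ?\<sigma> x m "2 * m - z"] s by simp
    qed
    then show "ennreal (normal_density x ?\<sigma> z) * indicator ?W (2 * m - z) \<le> ennreal (normal_density x ?\<sigma> (2 * m - z)) * (ennreal ?e * indicator ?W (2 * m - z))"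
      by (auto split: split_indicator simp: ennreal_mult[symmetric] intro!: ennreal_leI)
  qed auto
  also have "\<dots> = ennreal ?e * emeasure M {\<omega>\<in>Q. B t \<omega> \<in> ?W}"
    unfolding r2 by (subst nn_integral_cmult[symmetric]) (auto simp: mult_ac)
  finally have "prob {\<omega>\<in>Q. 2 * m - B t \<omega> \<in> ?W} \<le> ?e * prob {\<omega>\<in>Q. B t \<omega> \<in> ?W}"
    by (simp add: emeasure_eq_measure ennreal_mult[symmetric])
  moreover have "prob {\<omega>\<in>Q. B t \<omega> \<in> ?W} \<le> prob ({\<omega>\<in>Q. B t \<omega> \<in> ?W} \<inter> below m 0 s t) + prob {\<omega>\<in>Q. 2 * m - B t \<omega> \<in> ?W}"
    using reflection_lower[OF s Q W] by (simp add: emeasure_eq_measure ennreal_plus[symmetric] del: ennreal_plus)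
  ultimately have 1: "(1 - ?e) * prob {\<omega>\<in>Q. B t \<omega> \<in> ?W} \<le> prob ({\<omega>\<in>Q. B t \<omega> \<in> ?W} \<inter> below m 0 s t)"
    by (simp add: algebra_simps)
  let ?c = "(w2 - w1) * normal_density 0 ?\<sigma> d"
  have "ennreal ?c * emeasure M Q = (\<integral>\<^sup>+\<omega>. indicator Q \<omega> * ennreal ?c \<partial>M)"
    by (subst nn_integral_multc) (auto simp: mult.commute)
  also have "\<dots> \<le> (\<integral>\<^sup>+\<omega>. indicator Q \<omega> * (\<integral>\<^sup>+z. ennreal (normal_density (B s \<omega>) ?\<sigma> z) * indicator ?W z \<partial>lborel) \<partial>M)"
  proof (rule nn_integral_mono)
    fix \<omega>
    have "ennreal ?c \<le> (\<integral>\<^sup>+z. ennreal (normal_density (B s \<omega>) ?\<sigma> z) * indicator ?W z \<partial>lborel)" if "\<omega> \<in> Q"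
    proof -
      have "ennreal ?c = (\<integral>\<^sup>+z. ennreal (normal_density 0 ?\<sigma> d) * indicator ?W z \<partial>lborel)"
        using w by (subst nn_integral_cmult_indicator) (auto simp: ennreal_mult' mult.commute)
      also have "\<dots> \<le> (\<integral>\<^sup>+z. ennreal (normal_density (B s \<omega>) ?\<sigma> z) * indicator ?W z \<partial>lborel)"
        using Qx[OF that] d[of "B s \<omega>"] s
        by (intro nn_integral_mono) (auto split: split_indicator intro!: ennreal_leI normal_density_le intro: order_trans[OF _ abs_ge_self])
      finally show ?thesis .
    qed
    then show "indicator Q \<omega> * ennreal ?c \<le> indicator Q \<omega> * (\<integral>\<^sup>+z. ennreal (normal_density (B s \<omega>) ?\<sigma> z) * indicator ?W z \<partial>lborel)"
      by (auto split: split_indicator)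
  qed
  also have "\<dots> = emeasure M {\<omega>\<in>Q. B t \<omega> \<in> ?W}"
    unfolding r2 by (rule nn_integral_B[OF s Qi, symmetric]) auto
  finally have 2: "?c * prob Q \<le> prob {\<omega>\<in>Q. B t \<omega> \<in> ?W}"
    using w by (simp add: emeasure_eq_measure ennreal_mult[symmetric])
  have "?c * (1 - ?e) * prob Q = (1 - ?e) * (?c * prob Q)" by simp
  also have "\<dots> \<le> (1 - ?e) * prob {\<omega>\<in>Q. B t \<omega> \<in> ?W}" using 2 e1 by (intro mult_left_mono) auto
  finally show ?thesis using 1 by linarith
qed

text \<open>Reflection leaves the factor \<open>1 - exp (- y)\<close> with
  \<open>y = 2 * (m + \<kappa> - z) * (m + \<kappa> - x) / (t - s)\<close>, and
  \<open>1 - exp (- y) \<le> y\<close> turns it into a product of the two distances to the barrier;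
  \<open>C\<close> absorbs the starting distance. In this way each end of a block that lies within a
  multiple of \<delta> of the barrier contributes one power of \<delta>.\<close>

lemma block_upper:
  assumes s: "0 \<le> s" "s < t" and Q: "Q \<in> sets (F s)" and Qm: "\<And>\<omega>. \<omega> \<in> Q \<Longrightarrow> B s \<omega> \<le> m"
    and W[measurable]: "W \<in> sets borel" and Wm: "W \<subseteq> {..m}" and k: "0 < \<kappa>"
    and C: "\<And>\<omega>. \<omega> \<in> Q \<Longrightarrow> 2 * (m + \<kappa> - B s \<omega>) / (t - s) \<le> C"
  shows "emeasure M ({\<omega>\<in>Q. B t \<omega> \<in> W} \<inter> below m 0 s t) \<le>
    (\<integral>\<^sup>+\<omega>. indicator Q \<omega> * (indicator W (B t \<omega>) * ennreal (C * (m + \<kappa> - B t \<omega>))) \<partial>M)" (is "?S \<le> ?D")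
proof -
  have t: "0 \<le> t" using s by simp
  note [measurable] = measurable_B[OF s(1)] measurable_B[OF t]
  have QM[measurable]: "Q \<in> sets M" using Q by (rule F_sets_M)
  have Qi: "indicator Q \<in> borel_measurable (F s)" using Q by simp
  let ?\<sigma> = "sqrt (t - s)"
  let ?m = "m + \<kappa>"
  let ?P = "emeasure M {\<omega>\<in>Q. B t \<omega> \<in> W}" and ?R = "emeasure M {\<omega>\<in>Q. 2 * ?m - B t \<omega> \<in> W}"
  have r1: "?R = (\<integral>\<^sup>+\<omega>. indicator Q \<omega> * indicator W (2 * ?m - B t \<omega>) \<partial>M)"
    by (subst nn_integral_indicator[symmetric], measurable, rule nn_integral_cong) (auto split: split_indicator)
  have r2: "?P = (\<integral>\<^sup>+\<omega>. indicator Q \<omega> * indicator W (B t \<omega>) \<partial>M)"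
    by (subst nn_integral_indicator[symmetric], measurable, rule nn_integral_cong) (auto split: split_indicator)
  have SR: "?S + ?R \<le> ?P" by (rule reflection_upper[OF s Q Qm W Wm k])
  have "?P = (\<integral>\<^sup>+\<omega>. indicator Q \<omega> * (\<integral>\<^sup>+z. ennreal (normal_density (B s \<omega>) ?\<sigma> z) * indicator W z \<partial>lborel) \<partial>M)"
    unfolding r2 by (rule nn_integral_B[OF s Qi]) auto
  also have "\<dots> \<le> (\<integral>\<^sup>+\<omega>. indicator Q \<omega> * (\<integral>\<^sup>+z. ennreal (normal_density (B s \<omega>) ?\<sigma> z) * (indicator W (2 * ?m - z) + indicator W z * ennreal (C * (?m - z))) \<partial>lborel) \<partial>M)"
  proof (rule nn_integral_mono)
    fix \<omega>
    let ?x = "B s \<omega>"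
    have "(\<integral>\<^sup>+z. ennreal (normal_density ?x ?\<sigma> z) * indicator W z \<partial>lborel) \<le>
      (\<integral>\<^sup>+z. ennreal (normal_density ?x ?\<sigma> z) * (indicator W (2 * ?m - z) + indicator W z * ennreal (C * (?m - z))) \<partial>lborel)"
      if w: "\<omega> \<in> Q"
    proof -
      have "(\<integral>\<^sup>+z. ennreal (normal_density ?x ?\<sigma> z) * indicator W z \<partial>lborel) \<le>
        (\<integral>\<^sup>+z. ennreal (normal_density ?x ?\<sigma> (2 * ?m - z)) * indicator W z + ennreal (normal_density ?x ?\<sigma> z) * (indicator W z * ennreal (C * (?m - z))) \<partial>lborel)"
      proof (rule nn_integral_mono)
        fix z
        have "normal_density ?x ?\<sigma> z \<le> normal_density ?x ?\<sigma> (2 * ?m - z) + normal_density ?x ?\<sigma> z * (C * (?m - z))" and "0 \<le> C * (?m - z)" if z: "z \<in> W"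
        proof -
          have zm: "0 \<le> ?m - z" using z Wm k by auto
          have Y: "2 * (?m - z) * (?m - ?x) / ?\<sigma>\<^sup>2 \<le> C * (?m - z)"
          proof -
            have "2 * (?m - z) * (?m - ?x) / ?\<sigma>\<^sup>2 = 2 * (?m - ?x) / (t - s) * (?m - z)"
              using s by (simp add: algebra_simps)
            also have "\<dots> \<le> C * (?m - z)" by (rule mult_right_mono[OF C[OF w] zm])
            finally show ?thesis .
          qed
          have "0 \<le> 2 * (?m - ?x) / (t - s)" using Qm[OF w] k s by auto
          then have "0 \<le> C" using C[OF w] by linarith
          then show "0 \<le> C * (?m - z)" using zm by simp
          have "1 \<le> exp (- (2 * (?m - z) * (?m - ?x) / ?\<sigma>\<^sup>2)) + C * (?m - z)"
            using exp_ge_add_one_self[of "- (2 * (?m - z) * (?m - ?x) / ?\<sigma>\<^sup>2)"] Y by linarith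
          then have *: "normal_density ?x ?\<sigma> z * 1 \<le> normal_density ?x ?\<sigma> z * (exp (- (2 * (?m - z) * (?m - ?x) / ?\<sigma>\<^sup>2)) + C * (?m - z))"
            by (rule mult_left_mono) simp
          then show "normal_density ?x ?\<sigma> z \<le> normal_density ?x ?\<sigma> (2 * ?m - z) + normal_density ?x ?\<sigma> z * (C * (?m - z))"
          proof -
            have "normal_density ?x ?\<sigma> (2 * ?m - z) = normal_density ?x ?\<sigma> z * exp (- (2 * (?m - z) * (?m - ?x) / ?\<sigma>\<^sup>2))"
              using normal_density_reflect[of ?\<sigma> ?x ?m z] s by (simp only: mult_minus_left minus_divide_left) simp
            then show ?thesis using * by (simp only: distrib_left mult_1_right)
          qed
        qed
        then show "ennreal (normal_density ?x ?\<sigma> z) * indicator W z \<le> ennreal (normal_density ?x ?\<sigma> (2 * ?m - z)) * indicator W z + ennreal (normal_density ?x ?\<sigma> z) * (indicator W z * ennreal (C * (?m - z)))"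
          by (auto split: split_indicator simp: ennreal_mult[symmetric] ennreal_plus[symmetric] simp del: ennreal_plus intro!: ennreal_leI)
      qed
      also have "\<dots> = (\<integral>\<^sup>+z. ennreal (normal_density ?x ?\<sigma> (2 * ?m - z)) * indicator W z \<partial>lborel) + (\<integral>\<^sup>+z. ennreal (normal_density ?x ?\<sigma> z) * (indicator W z * ennreal (C * (?m - z))) \<partial>lborel)"
        by (rule nn_integral_add) measurable
      also have "(\<integral>\<^sup>+z. ennreal (normal_density ?x ?\<sigma> (2 * ?m - z)) * indicator W z \<partial>lborel) = (\<integral>\<^sup>+z. ennreal (normal_density ?x ?\<sigma> z) * indicator W (2 * ?m - z) \<partial>lborel)"
        by (subst nn_integral_real_affine[where c="-1" and t="2 * ?m"]) auto
      also have "\<dots> + (\<integral>\<^sup>+z. ennreal (normal_density ?x ?\<sigma> z) * (indicator W z * ennreal (C * (?m - z))) \<partial>lborel) =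
        (\<integral>\<^sup>+z. ennreal (normal_density ?x ?\<sigma> z) * (indicator W (2 * ?m - z) + indicator W z * ennreal (C * (?m - z))) \<partial>lborel)"
        by (subst nn_integral_add[symmetric]) (auto simp: distrib_left)
      finally show ?thesis .
    qed
    then show "indicator Q \<omega> * (\<integral>\<^sup>+z. ennreal (normal_density ?x ?\<sigma> z) * indicator W z \<partial>lborel) \<le>
      indicator Q \<omega> * (\<integral>\<^sup>+z. ennreal (normal_density ?x ?\<sigma> z) * (indicator W (2 * ?m - z) + indicator W z * ennreal (C * (?m - z))) \<partial>lborel)"
      by (auto split: split_indicator)
  qed
  also have "\<dots> = (\<integral>\<^sup>+\<omega>. indicator Q \<omega> * (indicator W (2 * ?m - B t \<omega>) + indicator W (B t \<omega>) * ennreal (C * (?m - B t \<omega>))) \<partial>M)"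
    by (rule nn_integral_B[OF s Qi, symmetric]) measurable
  also have "\<dots> = ?R + ?D"
    unfolding r1 by (subst nn_integral_add[symmetric]) (auto simp: distrib_left)
  finally have "?R + ?S \<le> ?R + ?D" unfolding add.commute[of ?R ?S] by (rule order_trans[OF SR])
  \<comment> \<open>The reflected term is a finite measure, so it cancels.\<close>
  then show ?thesis by (subst (asm) ennreal_add_left_cancel_le) auto
qed

end

section \<open>Probability of staying low\<close>

context brownian
begin

text \<open>The end distance is at most \<open>m + \<kappa> + l\<close> plus the size of the
  increment, and the increment is independent of \<open>F s\<close>; the bound therefore factors
  into the measure of \<open>Q\<close> and a Gaussian integral. \<open>V\<close> records what the
  target \<open>W\<close> forces upon the increment.\<close>

lemma block_upper_increment:
  assumes s: "0 \<le> s" "s < t" and Q: "Q \<in> sets (F s)"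
    and Qm: "\<And>\<omega>. \<omega> \<in> Q \<Longrightarrow> - l \<le> B s \<omega> \<and> B s \<omega> \<le> m"
    and W: "W \<in> sets borel" and Wm: "W \<subseteq> {..m}" and k: "0 < \<kappa>" and l: "0 \<le> m + \<kappa> + l"
    and V[measurable]: "V \<in> sets borel" and QV: "\<And>\<omega>. \<omega> \<in> Q \<Longrightarrow> B t \<omega> \<in> W \<Longrightarrow> B t \<omega> - B s \<omega> \<in> V"
  shows "emeasure M ({\<omega>\<in>Q. B t \<omega> \<in> W} \<inter> below m 0 s t) \<le>
    emeasure M Q * (\<integral>\<^sup>+x. ennreal (normal_density 0 (sqrt (t - s)) x) *
      (indicator V x * ennreal (2 * (m + \<kappa> + l) / (t - s) * (m + \<kappa> + l + \<bar>x\<bar>))) \<partial>lborel)"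
proof -
  have QM[measurable]: "Q \<in> sets M" using Q by (rule F_sets_M)
  have Qi: "indicator Q \<in> borel_measurable (F s)" using Q by simp
  let ?C = "2 * (m + \<kappa> + l) / (t - s)"
  have C0: "0 \<le> ?C" using l s by auto
  have "emeasure M ({\<omega>\<in>Q. B t \<omega> \<in> W} \<inter> below m 0 s t) \<le>
    (\<integral>\<^sup>+\<omega>. indicator Q \<omega> * (indicator W (B t \<omega>) * ennreal (?C * (m + \<kappa> - B t \<omega>))) \<partial>M)"
  proof (rule block_upper[OF s Q _ W Wm k])
    fix \<omega> assume "\<omega> \<in> Q"
    from Qm[OF this] show "B s \<omega> \<le> m" and "2 * (m + \<kappa> - B s \<omega>) / (t - s) \<le> ?C"
      using s by (auto intro!: divide_right_mono)
  qed
  also have "\<dots> \<le> (\<integral>\<^sup>+\<omega>. indicator Q \<omega> * (indicator V (B t \<omega> - B s \<omega>) * ennreal (?C * (m + \<kappa> + l + \<bar>B t \<omega> - B s \<omega>\<bar>))) \<partial>M)"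
  proof (rule nn_integral_mono)
    fix \<omega>
    have "?C * (m + \<kappa> - B t \<omega>) \<le> ?C * (m + \<kappa> + l + \<bar>B t \<omega> - B s \<omega>\<bar>)" if "\<omega> \<in> Q"
      using Qm[OF that] by (intro mult_left_mono C0) linarith
    then show "indicator Q \<omega> * (indicator W (B t \<omega>) * ennreal (?C * (m + \<kappa> - B t \<omega>))) \<le>
      indicator Q \<omega> * (indicator V (B t \<omega> - B s \<omega>) * ennreal (?C * (m + \<kappa> + l + \<bar>B t \<omega> - B s \<omega>\<bar>)))"
      using QV by (auto split: split_indicator intro!: ennreal_leI)
  qed
  also have "\<dots> = (\<integral>\<^sup>+\<omega>. indicator Q \<omega> \<partial>M) * (\<integral>\<^sup>+x. ennreal (normal_density 0 (sqrt (t - s)) x) *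
      (indicator V x * ennreal (?C * (m + \<kappa> + l + \<bar>x\<bar>))) \<partial>lborel)"
    by (rule nn_integral_indep_increment[OF s Qi]) measurable
  finally show ?thesis by simp
qed

text \<open>What \<open>X r \<le> \<delta>\<close> almost surely implies for the path up to time
  \<open>r\<close>, in terms of \<open>B\<close> alone.\<close>

definition start_low :: "real \<Rightarrow> real \<Rightarrow> 'a set" where
  "start_low r \<delta> = {\<omega>\<in>space M. B r \<omega> \<in> {-\<delta>..\<delta>}} \<inter> below \<delta> 0 0 r"

text \<open>For \<open>r \<ge> 1\<close> the line of slope \<open>\<delta> / r\<close> through the
  origin is at most \<open>2 * \<delta>\<close> up to time \<open>r + 1\<close>, so this is a
  consequence of \<open>X r \<le> \<delta>\<close> as well.\<close>

definition stay_low :: "real \<Rightarrow> real \<Rightarrow> 'a set" where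
  "stay_low r \<delta> = {\<omega>\<in>start_low r \<delta>. B (r + 1) \<omega> \<in> {..2 * \<delta>}} \<inter> below (2 * \<delta>) 0 r (r + 1)"

lemma value_measurable_F:
  assumes "0 \<le> s" "s \<le> t" "Q \<in> sets (F t)" "W \<in> sets borel"
  shows "{\<omega>\<in>Q. B s \<omega> \<in> W} \<in> sets (F t)"
proof -
  have [measurable]: "B s \<in> borel_measurable (F t)" by (rule measurable_B_F) fact+
  note [measurable] = assms(3,4)
  show ?thesis by measurable
qed

lemma start_low_measurable: "0 < r \<Longrightarrow> start_low r \<delta> \<in> sets (F r)"
  unfolding start_low_def using value_measurable_F[of r r "space M" "{-\<delta>..\<delta>}"] below_measurable[of 0 r \<delta> 0]
    sets.top[of "F r"] by auto

lemma stay_low_measurable: "0 < r \<Longrightarrow> stay_low r \<delta> \<in> sets (F (r + 1))"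
  unfolding stay_low_def using below_measurable[of r "r + 1" "2 * \<delta>" 0] start_low_measurable[of r \<delta>] F_mono[of r "r + 1"]
  by (intro sets.Int value_measurable_F) auto

text \<open>The three powers of \<delta> are the width of the window and the distances to the
  barrier at time 0 and at time \<open>r\<close>. The slack \<kappa> is chosen as \<delta>, which
  leaves the order of these distances unchanged.\<close>

lemma start_low_bound:
  assumes r: "1 \<le> r" and d: "0 < \<delta>"
  shows "emeasure M (start_low r \<delta>) \<le> ennreal (24 * \<delta> ^ 3)"
proof -
  have r0: "0 < r" "0 \<le> r" using r by auto
  have sp: "space M \<in> sets (F 0)" using sets.top[of "F 0"] by simp
  note [measurable] = measurable_B[OF r0(2)]
  let ?W = "{-\<delta>..\<delta>}"
  have "emeasure M (start_low r \<delta>) \<le>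
    (\<integral>\<^sup>+\<omega>. indicator (space M) \<omega> * (indicator ?W (B r \<omega>) * ennreal (4 * \<delta> * (\<delta> + \<delta> - B r \<omega>))) \<partial>M)"
    unfolding start_low_def
  proof (rule block_upper[OF order_refl r0(1) sp])
    fix \<omega> assume "\<omega> \<in> space M"
    then show "B 0 \<omega> \<le> \<delta>" "2 * (\<delta> + \<delta> - B 0 \<omega>) / (r - 0) \<le> 4 * \<delta>"
      using d r by (auto simp: B_zero field_simps)
  qed (use d in auto)
  also have "\<dots> \<le> (\<integral>\<^sup>+\<omega>. indicator (space M) \<omega> * (ennreal (12 * \<delta>\<^sup>2) * indicator ?W (B r \<omega>)) \<partial>M)"
  proof (rule nn_integral_mono)
    fix \<omega>
    have "4 * \<delta> * (\<delta> + \<delta> - B r \<omega>) \<le> 12 * \<delta>\<^sup>2" if "-\<delta> \<le> B r \<omega>"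
    proof -
      have "4 * \<delta> * (\<delta> + \<delta> - B r \<omega>) \<le> 4 * \<delta> * (3 * \<delta>)" using that d by (intro mult_left_mono) auto
      then show ?thesis by (simp add: power2_eq_square)
    qed
    then show "indicator (space M) \<omega> * (indicator ?W (B r \<omega>) * ennreal (4 * \<delta> * (\<delta> + \<delta> - B r \<omega>))) \<le>
      indicator (space M) \<omega> * (ennreal (12 * \<delta>\<^sup>2) * indicator ?W (B r \<omega>))"
      by (auto split: split_indicator intro!: ennreal_leI)
  qed
  also have "\<dots> = (\<integral>\<^sup>+\<omega>. indicator (space M) \<omega> * (\<integral>\<^sup>+z. ennreal (normal_density (B 0 \<omega>) (sqrt (r - 0)) z) * (ennreal (12 * \<delta>\<^sup>2) * indicator ?W z) \<partial>lborel) \<partial>M)"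
    by (rule nn_integral_B[OF order_refl r0(1)]) (use sp in auto)
  also have "\<dots> \<le> (\<integral>\<^sup>+\<omega>. ennreal (24 * \<delta> ^ 3) \<partial>M)"
  proof (rule nn_integral_mono)
    fix \<omega>
    have "(\<integral>\<^sup>+z. ennreal (normal_density (B 0 \<omega>) (sqrt (r - 0)) z) * (ennreal (12 * \<delta>\<^sup>2) * indicator ?W z) \<partial>lborel) \<le>
      (\<integral>\<^sup>+z. ennreal (12 * \<delta>\<^sup>2) * indicator ?W z \<partial>lborel)"
    proof (rule nn_integral_mono)
      fix z
      have "1 * 1 \<le> 2 * pi * r" using pi_gt3 r by (intro mult_mono) auto
      then have "1 / sqrt (2 * pi * r) \<le> 1" by simp
      moreover have "exp (- (z - B 0 \<omega>)\<^sup>2 / (2 * r)) \<le> 1" using r by (simp add: divide_nonpos_pos)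
      ultimately have "1 / sqrt (2 * pi * r) * exp (- (z - B 0 \<omega>)\<^sup>2 / (2 * r)) \<le> 1"
        by (intro mult_le_one) auto
      then have "normal_density (B 0 \<omega>) (sqrt (r - 0)) z \<le> 1"
        unfolding normal_density_def using r by simp
      then have "ennreal (normal_density (B 0 \<omega>) (sqrt (r - 0)) z) \<le> 1" by (simp add: ennreal_le_1)
      from mult_right_mono[OF this, of "ennreal (12 * \<delta>\<^sup>2) * indicator ?W z"]
      show "ennreal (normal_density (B 0 \<omega>) (sqrt (r - 0)) z) * (ennreal (12 * \<delta>\<^sup>2) * indicator ?W z) \<le> ennreal (12 * \<delta>\<^sup>2) * indicator ?W z" by simp
    qed
    also have "\<dots> = ennreal (24 * \<delta> ^ 3)"
      using d by (subst nn_integral_cmult_indicator) (auto simp: ennreal_mult[symmetric] power2_eq_square power3_eq_cube)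
    finally show "indicator (space M) \<omega> * (\<integral>\<^sup>+z. ennreal (normal_density (B 0 \<omega>) (sqrt (r - 0)) z) * (ennreal (12 * \<delta>\<^sup>2) * indicator ?W z) \<partial>lborel) \<le> ennreal (24 * \<delta> ^ 3)"
      by (auto split: split_indicator)
  qed
  finally show ?thesis by (simp add: emeasure_space_1)
qed

lemma start_lowD: "\<omega> \<in> start_low r \<delta> \<Longrightarrow> - \<delta> \<le> B r \<omega> \<and> B r \<omega> \<le> \<delta>"
  by (auto simp: start_low_def)

text \<open>Another unit of time costs one power only: the starting distance is at most
  \<open>4 * \<delta>\<close>, slack included, but the end point is free. The constant is 24 * 8 *
  2.\<close>

lemma stay_low_bound:
  assumes r: "1 \<le> r" and d: "0 < \<delta>" "\<delta> \<le> 1 / 4"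
  shows "emeasure M (stay_low r \<delta>) \<le> ennreal (384 * \<delta> ^ 4)"
proof -
  have r0: "0 \<le> r" "r < r + 1" "0 < r" using r by auto
  have "emeasure M (stay_low r \<delta>) \<le> emeasure M (start_low r \<delta>) * (\<integral>\<^sup>+x. ennreal (normal_density 0 (sqrt (r + 1 - r)) x) *
      (indicator UNIV x * ennreal (2 * (2 * \<delta> + \<delta> + \<delta>) / (r + 1 - r) * (2 * \<delta> + \<delta> + \<delta> + \<bar>x\<bar>))) \<partial>lborel)"
    unfolding stay_low_def
  proof (rule block_upper_increment[OF r0(1,2) start_low_measurable[OF r0(3)]])
    fix \<omega> assume \<omega>: "\<omega> \<in> start_low r \<delta>"
    show "- \<delta> \<le> B r \<omega> \<and> B r \<omega> \<le> 2 * \<delta>" using start_lowD[OF \<omega>] d by auto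
  qed (use d in auto)
  also have "\<dots> = emeasure M (start_low r \<delta>) * (\<integral>\<^sup>+x. ennreal (8 * \<delta>) * (ennreal (normal_density 0 1 x) * ennreal (4 * \<delta> + \<bar>x\<bar>)) \<partial>lborel)"
    using d by (intro arg_cong[where f="(*) (emeasure M (start_low r \<delta>))"] nn_integral_cong)
      (simp add: ennreal_mult[symmetric] mult_ac del: ennreal_plus)
  also have "\<dots> = emeasure M (start_low r \<delta>) * (ennreal (8 * \<delta>) * (\<integral>\<^sup>+x. ennreal (normal_density 0 1 x) * ennreal (4 * \<delta> + \<bar>x\<bar>) \<partial>lborel))"
    by (subst nn_integral_cmult) auto
  also have "\<dots> \<le> ennreal (24 * \<delta> ^ 3) * (ennreal (8 * \<delta>) * ennreal (4 * \<delta> + 1))"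
    by (intro mult_mono start_low_bound r d nn_integral_normal_abs) (use d in auto)
  also have "\<dots> \<le> ennreal (24 * \<delta> ^ 3) * (ennreal (8 * \<delta>) * ennreal 2)"
    using d by (intro mult_left_mono ennreal_leI) auto
  also have "\<dots> = ennreal (384 * \<delta> ^ 4)"
    using d by (simp add: ennreal_mult[symmetric] power3_eq_cube power4_eq_xxxx del: ennreal_numeral)
  finally show ?thesis .
qed

text \<open>Reaching \<open>- L\<close> takes an increment of size at least \<open>L / 2\<close>,
  and the truncated Gaussian moment supplies the factor \<open>1 / L\<close>. The bound disposes of
  starting points that are too deep for the long block that follows.\<close>

lemma stay_low_deep_bound:
  assumes r: "1 \<le> r" and d: "0 < \<delta>" "\<delta> \<le> 1 / 4" and L: "1 \<le> L"
  shows "emeasure M {\<omega>\<in>stay_low r \<delta>. B (r + 1) \<omega> \<in> {..-L}} \<le> ennreal (768 * \<delta> ^ 4 / L)"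
proof -
  have r0: "0 \<le> r" "r < r + 1" "0 < r" using r by auto
  have eq: "{\<omega>\<in>stay_low r \<delta>. B (r + 1) \<omega> \<in> {..-L}} = {\<omega>\<in>start_low r \<delta>. B (r + 1) \<omega> \<in> {..-L}} \<inter> below (2 * \<delta>) 0 r (r + 1)"
    using d L by (auto simp: stay_low_def)
  have "emeasure M {\<omega>\<in>stay_low r \<delta>. B (r + 1) \<omega> \<in> {..-L}} \<le> emeasure M (start_low r \<delta>) * (\<integral>\<^sup>+x. ennreal (normal_density 0 (sqrt (r + 1 - r)) x) *
      (indicator {x. L / 2 \<le> \<bar>x\<bar>} x * ennreal (2 * (2 * \<delta> + \<delta> + \<delta>) / (r + 1 - r) * (2 * \<delta> + \<delta> + \<delta> + \<bar>x\<bar>))) \<partial>lborel)"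
    unfolding eq
  proof (rule block_upper_increment[OF r0(1,2) start_low_measurable[OF r0(3)]])
    fix \<omega> assume \<omega>: "\<omega> \<in> start_low r \<delta>"
    show "- \<delta> \<le> B r \<omega> \<and> B r \<omega> \<le> 2 * \<delta>" using start_lowD[OF \<omega>] d by auto
    assume "B (r + 1) \<omega> \<in> {..-L}"
    then show "B (r + 1) \<omega> - B r \<omega> \<in> {x. L / 2 \<le> \<bar>x\<bar>}" using start_lowD[OF \<omega>] d L by auto
  next
    show "{x. L / 2 \<le> \<bar>x\<bar>} \<in> sets borel" by measurable
  next
    show "{..-L} \<subseteq> {..2 * \<delta>}" using d L by auto
  qed (use d in auto)
  also have "\<dots> \<le> emeasure M (start_low r \<delta>) * (\<integral>\<^sup>+x. ennreal (8 * \<delta>) * (ennreal (normal_density 0 1 x) * (indicator {x. L / 2 \<le> \<bar>x\<bar>} x * ennreal (1 + \<bar>x\<bar>))) \<partial>lborel)"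
  proof (rule mult_left_mono[OF nn_integral_mono])
    fix x :: real
    have "8 * \<delta> * (4 * \<delta> + \<bar>x\<bar>) \<le> 8 * \<delta> * (1 + \<bar>x\<bar>)" using d by (intro mult_left_mono) auto
    then have "normal_density 0 1 x * (8 * \<delta> * (4 * \<delta> + \<bar>x\<bar>)) \<le> normal_density 0 1 x * (8 * \<delta> * (1 + \<bar>x\<bar>))"
      by (rule mult_left_mono) simp
    then show "ennreal (normal_density 0 (sqrt (r + 1 - r)) x) * (indicator {x. L / 2 \<le> \<bar>x\<bar>} x * ennreal (2 * (2 * \<delta> + \<delta> + \<delta>) / (r + 1 - r) * (2 * \<delta> + \<delta> + \<delta> + \<bar>x\<bar>)))
      \<le> ennreal (8 * \<delta>) * (ennreal (normal_density 0 1 x) * (indicator {x. L / 2 \<le> \<bar>x\<bar>} x * ennreal (1 + \<bar>x\<bar>)))"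
    proof (cases "L / 2 \<le> \<bar>x\<bar>")
      case True
      have "ennreal (normal_density 0 1 x) * ennreal (8 * \<delta> * (4 * \<delta> + \<bar>x\<bar>)) = ennreal (normal_density 0 1 x * (8 * \<delta> * (4 * \<delta> + \<bar>x\<bar>)))"
        using d by (intro ennreal_mult[symmetric]) auto
      also have "\<dots> \<le> ennreal (normal_density 0 1 x * (8 * \<delta> * (1 + \<bar>x\<bar>)))" by (rule ennreal_leI) fact
      also have "\<dots> = ennreal (8 * \<delta>) * (ennreal (normal_density 0 1 x) * ennreal (1 + \<bar>x\<bar>))"
        using d by (simp only: ennreal_mult[symmetric] normal_density_nonneg mult_nonneg_nonneg) (simp add: ennreal_mult[symmetric] mult.left_commute mult.commute del: ennreal_plus)
      finally show ?thesis using True by simp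
    qed simp
  qed auto
  also have "\<dots> = emeasure M (start_low r \<delta>) * (ennreal (8 * \<delta>) * (\<integral>\<^sup>+x. ennreal (normal_density 0 1 x) * (indicator {x. L / 2 \<le> \<bar>x\<bar>} x * ennreal (1 + \<bar>x\<bar>)) \<partial>lborel))"
    by (subst nn_integral_cmult) auto
  also have "\<dots> \<le> ennreal (24 * \<delta> ^ 3) * (ennreal (8 * \<delta>) * ennreal (2 / (L / 2)))"
    by (intro mult_mono start_low_bound r d nn_integral_normal_abs_tail) (use L in auto)
  also have "\<dots> = ennreal (768 * \<delta> ^ 4 / L)"
    using d L by (simp add: ennreal_mult[symmetric] power3_eq_cube power4_eq_xxxx del: ennreal_numeral)
  finally show ?thesis .
qed

text \<open>Over a time \<open>1 / \<delta>\<close> a line of slope at most \<delta> rises by at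
  most 1, so a barrier of height \<open>2 * \<delta> + 2\<close> still applies. From a start no
  deeper than \<open>1 / \<epsilon>\<close> the cost is of order
  \<open>(1 / \<epsilon>) * \<delta> * sqrt (1 / \<delta>)\<close>, which is of order \<epsilon>;
  deeper starts also cost a factor of order \<epsilon>, which is why this cutoff is the right
  one.\<close>

lemma stay_low_long_bound:
  assumes r: "1 \<le> r" "r \<le> 8" and e: "0 < \<epsilon>" "\<epsilon> \<le> 1 / 4" and d: "\<delta> = \<epsilon> ^ 4"
  shows "emeasure M (stay_low r \<delta> \<inter> below (2 * \<delta> + 2) 0 (r + 1) (r + 1 + 1 / \<delta>)) \<le> ennreal (5376 * \<epsilon> ^ 17)"
proof -
  let ?t = "r + 1 + 1 / \<delta>"
  let ?L = "1 / \<epsilon>"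
  let ?m = "2 * \<delta> + 2"
  have d0: "0 < \<delta>" "\<delta> \<le> 1 / 4"
  proof -
    show "0 < \<delta>" using e d by simp
    have "\<epsilon> ^ 4 \<le> (1/4) ^ 4" using e by (intro power_mono) auto
    then show "\<delta> \<le> 1 / 4" using d by (simp add: power4_eq_xxxx)
  qed
  have r0: "0 < r" "0 \<le> r + 1" "r + 1 < ?t" "0 \<le> ?t" using r d0 by auto
  note [measurable] = measurable_B[OF r0(2)] measurable_B[OF r0(4)]
  have L: "4 \<le> ?L" using e by (simp add: field_simps)
  define Q where "Q = {\<omega>\<in>stay_low r \<delta>. B (r + 1) \<omega> \<in> {-?L..}}"
  have QF: "Q \<in> sets (F (r + 1))"
    unfolding Q_def using stay_low_measurable[OF r0(1)] r0 by (intro value_measurable_F) auto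
  have stayM[measurable]: "stay_low r \<delta> \<in> sets M" by (rule F_sets_M[OF stay_low_measurable[OF r0(1)]])
  have QM[measurable]: "Q \<in> sets M" by (rule F_sets_M[OF QF])
  have bM[measurable]: "below ?m 0 (r + 1) ?t \<in> sets M" using below_measurable[OF r0(2,3)] by (rule F_sets_M)
  have "emeasure M (stay_low r \<delta> \<inter> below ?m 0 (r + 1) ?t) \<le>
    emeasure M (({\<omega>\<in>Q. B ?t \<omega> \<in> {..?m}} \<inter> below ?m 0 (r + 1) ?t) \<union> {\<omega>\<in>stay_low r \<delta>. B (r + 1) \<omega> \<in> {..-?L}})"
  proof (rule emeasure_mono)
    show "stay_low r \<delta> \<inter> below ?m 0 (r + 1) ?t \<subseteq>
      ({\<omega>\<in>Q. B ?t \<omega> \<in> {..?m}} \<inter> below ?m 0 (r + 1) ?t) \<union> {\<omega>\<in>stay_low r \<delta>. B (r + 1) \<omega> \<in> {..-?L}}"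
      using r0(3) unfolding Q_def below_def by force
  qed measurable
  also have "\<dots> \<le> emeasure M ({\<omega>\<in>Q. B ?t \<omega> \<in> {..?m}} \<inter> below ?m 0 (r + 1) ?t) + emeasure M {\<omega>\<in>stay_low r \<delta>. B (r + 1) \<omega> \<in> {..-?L}}"
    by (rule emeasure_subadditive) measurable
  finally have 1: "emeasure M (stay_low r \<delta> \<inter> below ?m 0 (r + 1) ?t) \<le> \<dots>" .
  have 2: "emeasure M {\<omega>\<in>stay_low r \<delta>. B (r + 1) \<omega> \<in> {..-?L}} \<le> ennreal (768 * \<delta> ^ 4 / ?L)"
    by (rule stay_low_deep_bound) (use r d0 L in auto)
  have 3: "emeasure M ({\<omega>\<in>Q. B ?t \<omega> \<in> {..?m}} \<inter> below ?m 0 (r + 1) ?t) \<le> ennreal (384 * \<delta> ^ 4) * ennreal (12 * \<epsilon>)"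
  proof -
    let ?c = "?m + 1 + ?L"
    have c: "0 \<le> ?c" "?c \<le> 2 / \<epsilon>"
    proof -
      have "2 / \<epsilon> = 2 * ?L" by simp
      then show "0 \<le> ?c" "?c \<le> 2 / \<epsilon>" using d0 L by linarith+
    qed
    have sq: "sqrt (1 / \<delta>) = 1 / \<epsilon>\<^sup>2"
      using e by (simp add: d real_sqrt_divide power4_eq_xxxx power2_eq_square real_sqrt_mult)
    have "emeasure M ({\<omega>\<in>Q. B ?t \<omega> \<in> {..?m}} \<inter> below ?m 0 (r + 1) ?t) \<le>
      emeasure M Q * (\<integral>\<^sup>+x. ennreal (normal_density 0 (sqrt (?t - (r + 1))) x) *
      (indicator UNIV x * ennreal (2 * ?c / (?t - (r + 1)) * (?c + \<bar>x\<bar>))) \<partial>lborel)"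
    proof (rule block_upper_increment[OF r0(2,3) QF])
      fix \<omega> assume "\<omega> \<in> Q"
      then show "- ?L \<le> B (r + 1) \<omega> \<and> B (r + 1) \<omega> \<le> ?m" by (auto simp: Q_def stay_low_def)
    qed (use c in auto)
    also have "\<dots> = emeasure M Q * (\<integral>\<^sup>+x. ennreal (2 * ?c * \<delta>) * (ennreal (normal_density 0 (sqrt (1 / \<delta>)) x) * ennreal (?c + \<bar>x\<bar>)) \<partial>lborel)"
      using d0 c by (intro arg_cong[where f="(*) (emeasure M Q)"] nn_integral_cong)
        (simp add: ennreal_mult[symmetric] mult_ac del: ennreal_plus)
    also have "\<dots> = emeasure M Q * (ennreal (2 * ?c * \<delta>) * (\<integral>\<^sup>+x. ennreal (normal_density 0 (sqrt (1 / \<delta>)) x) * ennreal (?c + \<bar>x\<bar>) \<partial>lborel))"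
      by (subst nn_integral_cmult) auto
    also have "\<dots> \<le> emeasure M (stay_low r \<delta>) * (ennreal (2 * ?c * \<delta>) * ennreal (?c + sqrt (1 / \<delta>)))"
    proof (intro mult_mono nn_integral_normal_abs)
      show "emeasure M Q \<le> emeasure M (stay_low r \<delta>)" by (rule emeasure_mono) (auto simp: Q_def)
    qed (use d0 c in auto)
    also have "\<dots> \<le> ennreal (384 * \<delta> ^ 4) * ennreal (12 * \<epsilon>)"
    proof (intro mult_mono stay_low_bound)
      have "?c + sqrt (1 / \<delta>) \<le> 3 / \<epsilon>\<^sup>2"
      proof -
        have "2 / \<epsilon> \<le> 2 / \<epsilon>\<^sup>2" using e by (simp add: field_simps power2_eq_square)
        moreover have "3 / \<epsilon>\<^sup>2 = 2 / \<epsilon>\<^sup>2 + 1 / \<epsilon>\<^sup>2" by (simp add: add_divide_distrib[symmetric])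
        ultimately show ?thesis using c sq by linarith
      qed
      moreover have "2 * ?c * \<delta> \<le> 4 / \<epsilon> * \<delta>" using c d0 by (intro mult_right_mono) auto
      moreover have "4 / \<epsilon> * \<delta> * (3 / \<epsilon>\<^sup>2) = 12 * \<epsilon>" using e by (simp add: d power4_eq_xxxx power2_eq_square)
      ultimately have "2 * ?c * \<delta> * (?c + sqrt (1 / \<delta>)) \<le> 12 * \<epsilon>"
        using mult_mono[of "2 * ?c * \<delta>" "4 / \<epsilon> * \<delta>" "?c + sqrt (1 / \<delta>)" "3 / \<epsilon>\<^sup>2"] c d0 e by auto
      then show "ennreal (2 * ?c * \<delta>) * ennreal (?c + sqrt (1 / \<delta>)) \<le> ennreal (12 * \<epsilon>)"
        using c d0 by (simp add: ennreal_mult[symmetric] ennreal_leI del: ennreal_plus)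
    qed (use r d0 in auto)
    finally show ?thesis .
  qed
  \<comment> \<open>384 * 12 + 768 = 5376, and
    \<open>\<delta> ^ 4 = \<epsilon> ^ 16\<close>.\<close>
  have 4: "ennreal (384 * \<delta> ^ 4) * ennreal (12 * \<epsilon>) + ennreal (768 * \<delta> ^ 4 / ?L) = ennreal (5376 * \<epsilon> ^ 17)"
  proof -
    have "\<delta> ^ 4 = \<epsilon> ^ 16" by (simp add: d power_mult[symmetric])
    moreover have "\<epsilon> ^ 17 = \<epsilon> ^ 16 * \<epsilon>" by (simp add: power_Suc2[symmetric] del: power_Suc)
    ultimately show ?thesis
      using e by (simp add: ennreal_mult[symmetric] ennreal_plus[symmetric] del: ennreal_plus)
  qed
  show ?thesis unfolding 4[symmetric] by (rule order_trans[OF 1 add_mono[OF 3 2]])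
qed

end

section \<open>Concave majorants and chords\<close>

text \<open>The value at \<open>t\<close> of the line through the points of the graph over
  \<open>a\<close> and \<open>b\<close>. For \<open>t = a\<close> or \<open>t = b\<close> it is
  \<open>f t\<close>, so degenerate chords cover the path itself.\<close>

definition chord :: "(real \<Rightarrow> real) \<Rightarrow> real \<Rightarrow> real \<Rightarrow> real \<Rightarrow> real" where
  "chord f t a b = ((b - t) * f a + (t - a) * f b) / (b - a)"

text \<open>If \<open>f\<close> has no concave majorant, \<^const>\<open>concave_majorant\<close> is an infimum over the empty set.\<close>

definition majorized :: "(real \<Rightarrow> real) \<Rightarrow> bool" where
  "majorized f \<longleftrightarrow> (\<exists>c. concave_on {0..} c \<and> (\<forall>s\<ge>0. f s \<le> c s))"

lemma concave_on_affine: "concave_on {0..} (\<lambda>u. p + q * u :: real)"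
  unfolding concave_on_iff
proof (intro conjI ballI allI impI)
  fix x y u v :: real assume "u + v = 1"
  then have v: "v = 1 - u" by simp
  show "u * (p + q * x) + v * (p + q * y) \<le> p + q * (u *\<^sub>R x + v *\<^sub>R y)"
    unfolding v by (simp add: algebra_simps)
qed (rule convex_real_interval)

lemma majorized_affine: "(\<And>u. 0 \<le> u \<Longrightarrow> f u \<le> p + q * u) \<Longrightarrow> majorized f"
  unfolding majorized_def using concave_on_affine by blast

lemma majorized_add_bounded:
  assumes "majorized f" "\<And>u. 0 \<le> u \<Longrightarrow> g u \<le> C"
  shows "majorized (\<lambda>u. f u + g u)"
proof -
  obtain c where c: "concave_on {0..} c" "\<And>s. 0 \<le> s \<Longrightarrow> f s \<le> c s" using assms(1) by (auto simp: majorized_def)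
  have "concave_on {0..} (\<lambda>u. c u + C)"
    using c(1) by (intro concave_on_add) (auto simp: concave_on_const)
  then show ?thesis using c(2) assms(2) unfolding majorized_def by (meson add_mono)
qed

lemma concave_majorant_le:
  assumes "concave_on {0..} c" "\<And>s. 0 \<le> s \<Longrightarrow> f s \<le> c s" "0 \<le> t"
  shows "concave_majorant f t \<le> c t"
  unfolding concave_majorant_def
  by (rule cInf_lower) (use assms in \<open>auto intro!: bdd_belowI[of _ "f t"]\<close>)

lemma concave_majorant_ge:
  assumes "majorized f" "\<And>c. concave_on {0..} c \<Longrightarrow> (\<And>s. 0 \<le> s \<Longrightarrow> f s \<le> c s) \<Longrightarrow> y \<le> c t"
  shows "y \<le> concave_majorant f t"
  unfolding concave_majorant_def
  by (rule cInf_greatest) (use assms in \<open>auto simp: majorized_def\<close>)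

lemma chord_le_concave:
  assumes c: "concave_on {0..} c" "\<And>s. 0 \<le> s \<Longrightarrow> f s \<le> c s" and ab: "0 \<le> a" "a \<le> t" "t \<le> b" "a < b"
  shows "chord f t a b \<le> c t"
proof -
  let ?l = "(b - t) / (b - a)" and ?m = "(t - a) / (b - a)"
  have s: "?l + ?m = 1" "?l * a + ?m * b = t"
    using ab by (auto simp: add_divide_distrib[symmetric] field_simps)
  have "chord f t a b = ?l * f a + ?m * f b" by (simp add: chord_def add_divide_distrib)
  also have "\<dots> \<le> ?l * c a + ?m * c b" using ab c(2) by (intro add_mono mult_left_mono) auto
  also have "\<dots> \<le> c (?l * a + ?m * b)"
  proof -
    have *: "\<forall>x\<in>{0..}. \<forall>y\<in>{0..}. \<forall>u\<ge>0. \<forall>v\<ge>0. u + v = 1 \<longrightarrow> u * c x + v * c y \<le> c (u * x + v * y)"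
      using c(1) by (simp add: concave_on_iff)
    show ?thesis by (rule *[rule_format]) (use ab s(1) in auto)
  qed
  finally show ?thesis using s(2) by simp
qed

lemma chord_le_concave_majorant:
  assumes "majorized f" "0 \<le> a" "a \<le> t" "t \<le> b" "a < b"
  shows "chord f t a b \<le> concave_majorant f t"
  by (rule concave_majorant_ge) (use assms chord_le_concave in auto)

lemma le_concave_majorant: "majorized f \<Longrightarrow> 0 \<le> t \<Longrightarrow> f t \<le> concave_majorant f t"
  using chord_le_concave_majorant[of f t t "t + 1"] by (simp add: chord_def)

text \<open>The hypothesis says that every slope from \<open>(t, y)\<close> to the graph on the
  right is at most every slope to the graph on the left. The supremum \<beta> of the right slopes
  therefore defines a line through \<open>(t, y)\<close> that lies above \<open>f\<close>, and a
  line is concave.\<close>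

lemma concave_majorant_le_chords:
  assumes t: "0 < t" and y: "\<And>a b. 0 \<le> a \<Longrightarrow> a < t \<Longrightarrow> t < b \<Longrightarrow> chord f t a b \<le> y" and ft: "f t \<le> y"
  shows "concave_majorant f t \<le> y"
proof -
  have slope: "(f b - y) / (b - t) \<le> (y - f a) / (t - a)" if "0 \<le> a" "a < t" "t < b" for a b
  proof -
    have "(b - t) * f a + (t - a) * f b \<le> y * (b - a)" using y[OF that] that by (simp add: chord_def pos_divide_le_eq)
    then show ?thesis using that by (simp add: field_simps)
  qed
  define \<beta> where "\<beta> = (SUP b\<in>{t<..}. (f b - y) / (b - t))"
  have bdd: "bdd_above ((\<lambda>b. (f b - y) / (b - t)) ` {t<..})"
    using slope[of 0] t by (intro bdd_aboveI[of _ "(y - f 0) / (t - 0)"]) auto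
  have up: "(f b - y) / (b - t) \<le> \<beta>" if "t < b" for b
    unfolding \<beta>_def using that by (intro cSUP_upper bdd) auto
  have lo: "\<beta> \<le> (y - f a) / (t - a)" if "0 \<le> a" "a < t" for a
    unfolding \<beta>_def by (rule cSUP_least) (use slope[OF that] in auto)
  have maj: "f u \<le> (y - \<beta> * t) + \<beta> * u" if "0 \<le> u" for u
  proof -
    consider "u < t" | "u = t" | "t < u" by linarith
    then show ?thesis
    proof cases
      case 1
      then show ?thesis using lo[OF that 1] by (simp add: field_simps)
    next
      case 3
      then show ?thesis using up[OF 3] by (simp add: field_simps)
    qed (use ft in auto)
  qed
  have "concave_majorant f t \<le> (y - \<beta> * t) + \<beta> * t"
    by (rule concave_majorant_le[OF concave_on_affine maj]) (use t in auto)
  then show ?thesis by simp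
qed

lemma Rats_Int_dense: "{l..u} \<subseteq> closure (\<rat> \<inter> {l<..<u})" if "l < u" for l u :: real
proof -
  have "closure ({l<..<u} \<inter> \<rat>) = closure {l<..<u}"
    by (rule closure_open_Int_superset) (auto simp: Rats_closure_real)
  then show ?thesis using that by (simp add: closure_greaterThanLessThan Int_commute)
qed

text \<open>Continuity lets the endpoints pass to real limits one at a time; the limiting case
  \<open>b = t\<close> yields the bound on \<open>f t\<close>. Countably many chords are what
  measurability of the majorant will rest on.\<close>

lemma concave_majorant_le_rational_chords:
  assumes f: "continuous_on {0..} f" and t: "0 < t"
    and y: "\<And>a b. a \<in> \<rat> \<Longrightarrow> b \<in> \<rat> \<Longrightarrow> 0 < a \<Longrightarrow> a < t \<Longrightarrow> t < b \<Longrightarrow> chord f t a b \<le> y"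
  shows "concave_majorant f t \<le> y"
proof -
  have cont: "continuous_on S f" if "S \<subseteq> {0..}" for S using f that by (rule continuous_on_subset)
  have 1: "chord f t a b \<le> y" if a: "a \<in> {0..t}" and b: "b \<in> \<rat>" "t < b" for a b
  proof -
    have cl: "closure (\<rat> \<inter> {0<..<t}) \<subseteq> {0..t}"
      by (rule closure_minimal) auto
    have "continuous_on {0..t} (\<lambda>a. chord f t a b)" unfolding chord_def
      using b by (intro continuous_intros cont) auto
    then have "continuous_on (closure (\<rat> \<inter> {0<..<t})) (\<lambda>a. chord f t a b)" using cl by (rule continuous_on_subset)
    then show ?thesis
      by (rule continuous_le_on_closure) (use Rats_Int_dense[OF t] a b y in auto)
  qed
  have 2: "chord f t a b \<le> y" if a: "0 \<le> a" "a < t" and b: "t \<le> b" for a b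
  proof -
    have cl: "closure (\<rat> \<inter> {t<..<b + 1}) \<subseteq> {t..b + 1}"
      by (rule closure_minimal) auto
    have "continuous_on {t..b + 1} (\<lambda>b. chord f t a b)" unfolding chord_def
      using a t by (intro continuous_intros cont) auto
    then have "continuous_on (closure (\<rat> \<inter> {t<..<b + 1})) (\<lambda>b. chord f t a b)" using cl by (rule continuous_on_subset)
    then show ?thesis
      by (rule continuous_le_on_closure) (use Rats_Int_dense[of t "b + 1"] a b 1 in auto)
  qed
  have "f t \<le> y" using 2[of 0 t] t by (simp add: chord_def)
  then show ?thesis using 2 by (intro concave_majorant_le_chords t) auto
qed

lemma chord_add: "chord (\<lambda>u. f u + z * g u) t a b = chord f t a b + z * chord g t a b"
  by (simp add: chord_def add_divide_distrib[symmetric] algebra_simps)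

text \<open>Since \<open>f\<close> comes back above \<open>- \<epsilon> * w\<close> at arbitrarily
  late times, chords from 0 show that the majorant at \<open>r\<close> is nonnegative; with
  \<open>f r \<le> concave_majorant f r\<close> a small
  \<open>2 * concave_majorant f r - f r\<close> then traps both terms. The line bound after
  \<open>r\<close> comes from the chords from 0 to \<open>u\<close>, the bound before
  \<open>r\<close> from chords joining \<open>u\<close> to a very late time.\<close>

lemma small_value_consequences:
  assumes maj: "majorized f" and f0: "f 0 = 0" and r: "0 < r"
    and large: "\<And>\<epsilon> N. 0 < \<epsilon> \<Longrightarrow> \<exists>w\<ge>N. - \<epsilon> * w \<le> f w"
    and small: "2 * concave_majorant f r - f r \<le> \<delta>"
  shows "- \<delta> \<le> f r" and "\<And>u. 0 \<le> u \<Longrightarrow> u \<le> r \<Longrightarrow> f u \<le> \<delta>"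
    and "\<And>u. r \<le> u \<Longrightarrow> f u \<le> u / r * \<delta>"
proof -
  let ?K = "concave_majorant f r"
  have fK: "f r \<le> ?K" using le_concave_majorant[OF maj] r by simp
  then have Kd: "?K \<le> \<delta>" using small by linarith
  have K0: "0 \<le> ?K"
  proof (rule field_le_epsilon)
    fix e :: real assume e: "0 < e"
    then obtain w where w: "w \<ge> r + 1" "- (e / r) * w \<le> f w" using large[of "e / r"] r by auto
    have "chord f r 0 w \<le> ?K" by (rule chord_le_concave_majorant[OF maj]) (use w r in auto)
    then have "r * f w / w \<le> ?K" by (simp add: chord_def f0)
    moreover have "- e \<le> r * f w / w" using w r by (simp add: field_simps)
    ultimately show "0 \<le> ?K + e" by linarith
  qed
  show "- \<delta> \<le> f r" using K0 small by linarith
  show "f u \<le> u / r * \<delta>" if u: "r \<le> u" for u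
  proof -
    have "chord f r 0 u \<le> ?K" by (rule chord_le_concave_majorant[OF maj]) (use u r in auto)
    then have "r * f u / u \<le> \<delta>" using Kd by (simp add: chord_def f0)
    then show ?thesis using u r by (simp add: field_simps)
  qed
  show "f u \<le> \<delta>" if u: "0 \<le> u" "u \<le> r" for u
  proof (cases "u = r")
    case True
    then show ?thesis using fK Kd by simp
  next
    case False
    then have ur: "u < r" using u by simp
    show ?thesis
    proof (rule ccontr)
      assume "\<not> f u \<le> \<delta>"
      then have gap: "0 < f u - \<delta>" by simp
      \<comment> \<open>A late endpoint \<open>w\<close> lowers the chord inequality by at most
        \<open>r * \<epsilon> * w\<close>, half of the gain \<open>w * (f u - \<delta>)\<close>.
        Beyond \<open>N\<close> the terms that do not grow with \<open>w\<close> cannot make up for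
        the other half.\<close>
      define \<epsilon> where "\<epsilon> = (f u - \<delta>) / (2 * r)"
      have e: "0 < \<epsilon>" using gap r by (simp add: \<epsilon>_def)
      define N where "N = max (r + 1) ((2 * r * (\<bar>f u\<bar> + 1) + \<bar>\<delta>\<bar> * r) / (r * \<epsilon>) + r + 1)"
      obtain w where w: "w \<ge> N" "- \<epsilon> * w \<le> f w" using large[OF e] by blast
      have wr: "w \<ge> r + 1" using w by (simp add: N_def)
      have "chord f r u w \<le> ?K" by (rule chord_le_concave_majorant[OF maj]) (use wr ur u in auto)
      then have "(w - r) * f u + (r - u) * f w \<le> \<delta> * (w - u)"
        using order_trans[OF _ Kd, of "chord f r u w"] wr ur by (simp add: chord_def pos_divide_le_eq)
      moreover have "(r - u) * f w \<ge> - (r * \<epsilon>) * w"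
      proof -
        have "(r - u) * f w \<ge> (r - u) * (- \<epsilon> * w)" using ur w by (intro mult_left_mono) auto
        moreover have "(r - u) * (\<epsilon> * w) \<le> r * (\<epsilon> * w)" using u e wr r by (intro mult_right_mono) auto
        ultimately show ?thesis by (simp add: algebra_simps)
      qed
      ultimately have "(w - r) * f u - r * \<epsilon> * w \<le> \<delta> * (w - u)" by (simp only: mult_minus_left)
      then have "w * (f u - \<delta>) - r * \<epsilon> * w \<le> r * f u - \<delta> * u" by (simp add: algebra_simps)
      moreover have "w * (f u - \<delta>) = 2 * (r * \<epsilon> * w)" using r by (simp add: \<epsilon>_def)
      ultimately have "r * \<epsilon> * w \<le> r * f u - \<delta> * u" by linarith
      also have "\<dots> \<le> r * \<bar>f u\<bar> + \<bar>\<delta>\<bar> * r"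
      proof -
        have "r * f u \<le> r * \<bar>f u\<bar>" using r by (intro mult_left_mono) auto
        moreover have "- (\<delta> * u) \<le> \<bar>\<delta>\<bar> * r"
          using mult_mono[of "- \<delta>" "\<bar>\<delta>\<bar>" u r] u by simp
        ultimately show ?thesis by linarith
      qed
      finally have A: "r * \<epsilon> * w \<le> r * \<bar>f u\<bar> + \<bar>\<delta>\<bar> * r" .
      have re: "0 < r * \<epsilon>" using r e by simp
      have "(2 * r * (\<bar>f u\<bar> + 1) + \<bar>\<delta>\<bar> * r) / (r * \<epsilon>) < w"
        using w(1) r by (simp add: N_def)
      then have "2 * r * (\<bar>f u\<bar> + 1) + \<bar>\<delta>\<bar> * r < r * \<epsilon> * w" using re by (simp add: pos_divide_less_eq mult.commute)
      moreover have "0 \<le> r * \<bar>f u\<bar>" using r by simp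
      moreover have "2 * r * (\<bar>f u\<bar> + 1) = 2 * (r * \<bar>f u\<bar>) + 2 * r" by (simp add: algebra_simps)
      ultimately show False using A r by linarith
    qed
  qed
qed

section \<open>The value at time 6 as a function of the path, and its response to shifts\<close>

lemma chord_mono:
  assumes "a \<le> t" "t \<le> b" "a < b" "f a \<le> g a" "f b \<le> g b"
  shows "chord f t a b \<le> chord g t a b"
  unfolding chord_def using assms by (intro divide_right_mono add_mono mult_left_mono) auto

lemma chord_affine: "a < b \<Longrightarrow> chord (\<lambda>u. p + q * u) t a b = p + q * t"
  by (simp add: chord_def divide_eq_eq algebra_simps)

text \<open>The integral of the indicator of \<open>[p, q]\<close>, hence the Cameron-Martin
  direction of a unit drift on that interval.\<close>

definition ramp :: "real \<Rightarrow> real \<Rightarrow> real \<Rightarrow> real" where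
  "ramp p q u = max p (min u q) - p"

definition tent :: "real \<Rightarrow> real" where
  "tent u = ramp 5 6 u - ramp 6 7 u"

text \<open>Only countably many coordinates make a functional measurable on path space, hence the rational endpoints.
  Adding \<open>z * ramp 2 7\<close> raises every near chord by at least \<open>3 * z\<close>; adding a tent leaves every far chord alone.\<close>

definition near_pairs :: "(real \<times> real) set" where
  "near_pairs = {(a, b). a \<in> \<rat> \<and> b \<in> \<rat> \<and> 0 < a \<and> a < 6 \<and> 6 < b \<and> (b \<le> 7 \<or> 5 \<le> a)}"

definition far_pairs :: "(real \<times> real) set" where
  "far_pairs = {(a, b). a \<in> \<rat> \<and> b \<in> \<rat> \<and> 0 < a \<and> a \<le> 5 \<and> 7 \<le> b}"

text \<open>Taken in \<open>ereal\<close>, the supremum makes sense and is measurable on the whole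
  path space, including paths that have no concave majorant.\<close>

definition near_sup :: "(real \<Rightarrow> real) \<Rightarrow> ereal" where
  "near_sup w = (SUP p\<in>near_pairs. ereal (chord w 6 (fst p) (snd p)))"

definition far_sup :: "(real \<Rightarrow> real) \<Rightarrow> ereal" where
  "far_sup w = (SUP p\<in>far_pairs. ereal (chord w 6 (fst p) (snd p)))"

definition path_X :: "(real \<Rightarrow> real) \<Rightarrow> real" where
  "path_X w = 2 * real_of_ereal (max (near_sup w) (far_sup w)) - w 6"

abbreviation "path_space \<equiv> PiM (UNIV :: real set) (\<lambda>_. borel :: real measure)"

lemma countable_pairs: "countable near_pairs" "countable far_pairs"
proof -
  have "countable ((\<rat> :: real set) \<times> (\<rat> :: real set))" by (intro countable_SIGMA countable_rat)
  then show "countable near_pairs" "countable far_pairs"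
    by (auto intro: countable_subset[rotated] simp: near_pairs_def far_pairs_def)
qed

lemma measurable_near_far [measurable]:
  "near_sup \<in> borel_measurable path_space" "far_sup \<in> borel_measurable path_space"
  unfolding near_sup_def[abs_def] far_sup_def[abs_def] chord_def
  by (intro borel_measurable_SUP countable_pairs; measurable)+

lemma measurable_path_X [measurable]: "path_X \<in> borel_measurable path_space"
  unfolding path_X_def[abs_def] by measurable

lemma near_far_chord:
  assumes "a \<in> \<rat>" "b \<in> \<rat>" "0 < a" "a < 6" "6 < b"
  shows "ereal (chord w 6 a b) \<le> max (near_sup w) (far_sup w)"
proof (cases "(a, b) \<in> near_pairs")
  case True
  then have "ereal (chord w 6 a b) \<le> near_sup w" unfolding near_sup_def by (intro SUP_upper2[of "(a, b)"]) auto
  then show ?thesis by (simp add: le_max_iff_disj)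
next
  case False
  then have "(a, b) \<in> far_pairs" using assms by (auto simp: near_pairs_def far_pairs_def)
  then have "ereal (chord w 6 a b) \<le> far_sup w" unfolding far_sup_def by (intro SUP_upper2[of "(a, b)"]) auto
  then show ?thesis by (simp add: le_max_iff_disj)
qed

lemma near_far_le:
  assumes "majorized f"
  shows "near_sup f \<le> ereal (concave_majorant f 6)" "far_sup f \<le> ereal (concave_majorant f 6)"
  unfolding near_sup_def far_sup_def
  by (rule SUP_least; use assms in \<open>auto simp: near_pairs_def far_pairs_def intro!: chord_le_concave_majorant\<close>)+

lemma near_far_finite:
  assumes "majorized f"
  obtains x y where "near_sup f = ereal x" "far_sup f = ereal y"
proof -
  have "ereal (chord f 6 1 7) \<le> far_sup f" unfolding far_sup_def
    by (intro SUP_upper2[of "(1, 7)"]) (auto simp: far_pairs_def)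
  moreover have "ereal (chord f 6 5 7) \<le> near_sup f" unfolding near_sup_def
    by (intro SUP_upper2[of "(5, 7)"]) (auto simp: near_pairs_def)
  ultimately show thesis
    using near_far_le[OF assms] that by (cases "near_sup f"; cases "far_sup f") auto
qed

text \<open>Near and far pairs together exhaust the rational pairs around 6, so the larger of the
  two suprema is the majorant.\<close>

lemma path_X_eq:
  assumes "continuous_on {0..} f" "majorized f"
  shows "path_X f = 2 * concave_majorant f 6 - f 6"
proof -
  obtain x y where xy: "near_sup f = ereal x" "far_sup f = ereal y" using near_far_finite[OF assms(2)] .
  have "concave_majorant f 6 \<le> max x y"
    by (rule concave_majorant_le_rational_chords[OF assms(1)])
      (use near_far_chord[of _ _ f] in \<open>auto simp: xy max_def split: if_splits\<close>)
  moreover have "max x y \<le> concave_majorant f 6" using near_far_le[OF assms(2)] by (simp add: xy)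
  ultimately have "max x y = concave_majorant f 6" by (rule antisym[rotated])
  moreover have "max (ereal x) (ereal y) = ereal (max x y)" by (simp add: max_def)
  ultimately show ?thesis by (simp add: path_X_def xy)
qed

lemma far_sup_tent: "far_sup (\<lambda>u. w u + z * tent u) = far_sup w"
  unfolding far_sup_def
  by (rule SUP_cong) (auto simp: far_pairs_def chord_def tent_def ramp_def)

text \<open>While far chords dominate, a tent raises the path at 6 by \<open>z\<close> and leaves
  the majorant there unchanged; \<open>path_X\<close> falls at speed exactly 1.\<close>

lemma path_X_tent:
  assumes "near_sup (\<lambda>u. w u + z * tent u) \<le> far_sup (\<lambda>u. w u + z * tent u)"
  shows "path_X (\<lambda>u. w u + z * tent u) = 2 * real_of_ereal (far_sup w) - w 6 - z"
proof -
  have "tent 6 = 1" by (simp add: tent_def ramp_def)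
  then show ?thesis using max_absorb2[OF assms] by (simp add: path_X_def far_sup_tent)
qed

text \<open>Up to time 7 the ramp is at least the line \<open>u - 2\<close>, whose value at 6 is 4;
  from time 5 on it is at least 3. Each kind of near pair falls under one of these
  comparisons.\<close>

lemma chord_ramp_ge:
  assumes "(a, b) \<in> near_pairs"
  shows "3 \<le> chord (ramp 2 7) 6 a b"
proof -
  have ab: "0 < a" "a < 6" "6 < b" using assms by (auto simp: near_pairs_def)
  consider "b \<le> 7" | "5 \<le> a" using assms by (auto simp: near_pairs_def)
  then show ?thesis
  proof cases
    case 1
    have "chord (\<lambda>u. -2 + 1 * u) 6 a b \<le> chord (ramp 2 7) 6 a b"
      by (rule chord_mono) (use ab 1 in \<open>auto simp: ramp_def\<close>)
    then show ?thesis using ab by (simp only: chord_affine)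
  next
    case 2
    have "chord (\<lambda>u. 3 + 0 * u) 6 a b \<le> chord (ramp 2 7) 6 a b"
      by (rule chord_mono) (use ab 2 in \<open>auto simp: ramp_def\<close>)
    then show ?thesis using ab by (simp only: chord_affine)
  qed
qed

text \<open>Near chords rise at speed at least 3 and count twice, while the path at 6 rises at speed
  4, which leaves a net speed of at least 2. Domination by near chords is needed only at the smaller
  shift, because at the larger one the maximum is at least \<open>near_sup\<close> anyway.\<close>

lemma path_X_ramp:
  assumes maj: "majorized (\<lambda>u. w u + z * ramp 2 7 u)" "majorized (\<lambda>u. w u + z' * ramp 2 7 u)"
    and near: "far_sup (\<lambda>u. w u + z * ramp 2 7 u) \<le> near_sup (\<lambda>u. w u + z * ramp 2 7 u)" and z: "z \<le> z'"
  shows "path_X (\<lambda>u. w u + z * ramp 2 7 u) + 2 * (z' - z) \<le> path_X (\<lambda>u. w u + z' * ramp 2 7 u)"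
proof -
  obtain x y where xy: "near_sup (\<lambda>u. w u + z * ramp 2 7 u) = ereal x" "far_sup (\<lambda>u. w u + z * ramp 2 7 u) = ereal y"
    using near_far_finite[OF maj(1)] .
  obtain x' y' where xy': "near_sup (\<lambda>u. w u + z' * ramp 2 7 u) = ereal x'" "far_sup (\<lambda>u. w u + z' * ramp 2 7 u) = ereal y'"
    using near_far_finite[OF maj(2)] .
  have "near_sup (\<lambda>u. w u + z * ramp 2 7 u) \<le> ereal (x' - 3 * (z' - z))"
    unfolding near_sup_def
  proof (rule SUP_least)
    fix p assume p: "p \<in> near_pairs"
    have "ereal (chord (\<lambda>u. w u + z' * ramp 2 7 u) 6 (fst p) (snd p)) \<le> ereal x'"
      unfolding xy'(1)[symmetric] near_sup_def by (rule SUP_upper) fact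
    moreover have "3 \<le> chord (ramp 2 7) 6 (fst p) (snd p)" using p chord_ramp_ge[of "fst p" "snd p"] by simp
    then have "(z' - z) * 3 \<le> (z' - z) * chord (ramp 2 7) 6 (fst p) (snd p)" using z by (intro mult_left_mono) auto
    ultimately show "ereal (chord (\<lambda>u. w u + z * ramp 2 7 u) 6 (fst p) (snd p)) \<le> ereal (x' - 3 * (z' - z))"
      by (simp add: chord_add algebra_simps)
  qed
  then have "x + 3 * (z' - z) \<le> x'" by (simp add: xy)
  moreover have "x' \<le> real_of_ereal (max (near_sup (\<lambda>u. w u + z' * ramp 2 7 u)) (far_sup (\<lambda>u. w u + z' * ramp 2 7 u)))"
    by (simp add: xy' max_def)
  moreover have "real_of_ereal (max (near_sup (\<lambda>u. w u + z * ramp 2 7 u)) (far_sup (\<lambda>u. w u + z * ramp 2 7 u))) = x"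
    using max_absorb1[OF near] xy by simp
  moreover have r4: "ramp 2 7 6 = 4" by (simp add: ramp_def)
  moreover have "2 * P - (w 6 + z * 4) + 2 * (z' - z) \<le> 2 * P' - (w 6 + z' * 4)"
    if "x + 3 * (z' - z) \<le> x'" "x' \<le> P'" "P = x" for P P' :: real using that by simp
  ultimately show ?thesis unfolding path_X_def r4 by blast
qed

text \<open>On such a path the chord from 0 to 8 lies above the path on \<open>[5, 7]\<close>, so that moving the path
  there does not change its majorant.\<close>

lemma concave_majorant_tent:
  assumes f: "f 0 = 0" "- (1/64) \<le> f 8" "\<And>u. 5 \<le> u \<Longrightarrow> u \<le> 7 \<Longrightarrow> f u \<le> - 1" and z: "z \<le> 1/2"
  shows "concave_majorant (\<lambda>u. f u + z * tent u) 6 = concave_majorant f 6"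
proof -
  \<comment> \<open>The right-hand side does not mention \<open>y\<close>. A concave
    \<open>c\<close> above \<open>f\<close> at 0 and 8 satisfies
    \<open>c s \<ge> - (s / 512)\<close> in between, far above \<open>- 1 + 1/2\<close>, so the
    constraints on \<open>[5, 7]\<close> are automatic. Used with \<open>y = z\<close> and
    \<open>y = 0\<close>, this makes the two families of majorants equal.\<close>
  have iff: "(\<forall>s\<ge>0. f s + y * tent s \<le> c s) \<longleftrightarrow> (\<forall>s. 0 \<le> s \<and> \<not> (5 \<le> s \<and> s \<le> 7) \<longrightarrow> f s \<le> c s)"
    if c: "concave_on {0..} c" and y: "y \<le> 1/2" for c y
  proof
    assume "\<forall>s\<ge>0. f s + y * tent s \<le> c s"
    then show "\<forall>s. 0 \<le> s \<and> \<not> (5 \<le> s \<and> s \<le> 7) \<longrightarrow> f s \<le> c s"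
      by (auto simp: tent_def ramp_def split: if_splits)
  next
    assume out: "\<forall>s. 0 \<le> s \<and> \<not> (5 \<le> s \<and> s \<le> 7) \<longrightarrow> f s \<le> c s"
    show "\<forall>s\<ge>0. f s + y * tent s \<le> c s"
    proof (intro allI impI)
      fix s :: real assume s: "0 \<le> s"
      show "f s + y * tent s \<le> c s"
      proof (cases "5 \<le> s \<and> s \<le> 7")
        case False
        then have "tent s = 0" by (auto simp: tent_def ramp_def)
        then show ?thesis using out s False by auto
      next
        case True
        have *: "\<forall>x\<in>{0..}. \<forall>y\<in>{0..}. \<forall>u\<ge>0. \<forall>v\<ge>0. u + v = 1 \<longrightarrow> u * c x + v * c y \<le> c (u * x + v * y)"
          using c by (simp add: concave_on_iff)
        have "(1 - s / 8) * c 0 + (s / 8) * c 8 \<le> c ((1 - s / 8) * 0 + (s / 8) * 8)"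
          by (rule *[rule_format]) (use True in auto)
        moreover have "0 \<le> c 0" "- (1/64) \<le> c 8" using out f by (auto intro: order_trans)
        then have "(1 - s / 8) * 0 + (s / 8) * (- (1/64)) \<le> (1 - s / 8) * c 0 + (s / 8) * c 8"
          using True by (intro add_mono mult_left_mono) auto
        ultimately have "- (s / 8 / 64) \<le> c s" by simp
        moreover have "0 \<le> tent s" "tent s \<le> 1" using True by (auto simp: tent_def ramp_def)
        then have "y * tent s \<le> 1/2 * 1"
          by (intro order_trans[OF mult_right_mono[OF y] mult_left_mono]) auto
        ultimately show ?thesis using f(3)[of s] True by simp
      qed
    qed
  qed
  have "(\<forall>s\<ge>0. f s + z * tent s \<le> c s) \<longleftrightarrow> (\<forall>s\<ge>0. f s \<le> c s)" if "concave_on {0..} c" for c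
    using iff[OF that z] iff[OF that, of 0] by simp
  then have "{c t | c. concave_on {0..} c \<and> (\<forall>s\<ge>0. f s + z * tent s \<le> c s)} =
    {c t | c. concave_on {0..} c \<and> (\<forall>s\<ge>0. f s \<le> c s)}" for t :: real
    by (intro Collect_cong ex_cong1 conj_cong refl)
  then show ?thesis unfolding concave_majorant_def by simp
qed

text \<open>The line \<open>\<delta> + \<delta> * u\<close> bounds the majorant by
  \<open>2 * \<delta>\<close> at 1 and by \<open>9 * \<delta>\<close> at 8, whence 5 = 2 * 2 + 1 and
  19 = 2 * 9 + 1. At 6 the majorant lies between \<open>- \<delta>\<close> and
  \<open>7 * \<delta>\<close>, so for \<delta> up to 1/64 the window for \<open>f 6\<close> leads
  into \<open>{1..3/2}\<close>.\<close>

lemma low_path_values: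
  assumes d: "0 < \<delta>" "\<delta> \<le> 1/64" and f0: "f 0 = 0"
    and f: "\<And>u. 0 \<le> u \<Longrightarrow> f u \<le> \<delta> * (1 + u)" "- \<delta> \<le> f 1" "- \<delta> \<le> f 8" "- (5/4) \<le> f 6" "f 6 \<le> - (9/8)"
  shows "2 * concave_majorant f 1 - f 1 \<le> 5 * \<delta>" "2 * concave_majorant f 8 - f 8 \<le> 19 * \<delta>"
    "2 * concave_majorant f 6 - f 6 \<in> {1..3/2}"
proof -
  have "f u \<le> \<delta> + \<delta> * u" if "0 \<le> u" for u using f(1)[OF that] by (simp add: algebra_simps)
  note maj = majorized_affine[OF this] and le = concave_majorant_le[OF concave_on_affine this]
  show "2 * concave_majorant f 1 - f 1 \<le> 5 * \<delta>" "2 * concave_majorant f 8 - f 8 \<le> 19 * \<delta>"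
    using le[of 1] le[of 8] f(2,3) by auto
  have "chord f 6 0 8 \<le> concave_majorant f 6" by (rule chord_le_concave_majorant[OF maj]) auto
  then have "- \<delta> \<le> concave_majorant f 6" using f(3) d by (simp add: chord_def f0)
  then show "2 * concave_majorant f 6 - f 6 \<in> {1..3/2}"
    using le[of 6] f(4,5) d by auto
qed

section \<open>Joint lower bound and almost sure consequences\<close>

lemma one_minus_exp_ge:
  assumes "0 \<le> x" "x \<le> 1" "x \<le> y"
  shows "x / 2 \<le> 1 - exp (- y :: real)"
proof -
  have "(1 + x) * exp (- x) \<le> exp x * exp (- x)"
    using exp_ge_add_one_self[of x] by (intro mult_right_mono) auto
  then have "exp (- x) \<le> 1 / (1 + x)" using assms by (simp add: exp_minus_inverse pos_le_divide_eq mult.commute)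
  also have "\<dots> \<le> 1 - x / 2" using assms by (simp add: field_simps power2_eq_square mult_left_le)
  finally have "exp (- x) \<le> 1 - x / 2" .
  moreover have "exp (- y) \<le> exp (- x)" using assms by simp
  ultimately show ?thesis by linarith
qed

context brownian
begin

text \<open>The conditions at 5 and 7 and on \<open>{5..7}\<close> prepare the tent shifts behind
  the lower density bound; the remaining ones are the hypotheses of
  \<open>low_path_values\<close>.\<close>

definition low_event :: "real \<Rightarrow> 'a set" where
  "low_event \<delta> = {\<omega>\<in>space M. (\<forall>u\<ge>0. B u \<omega> \<le> \<delta> * (1 + u)) \<and> - \<delta> \<le> B 1 \<omega> \<and> - \<delta> \<le> B 8 \<omega> \<and>
    B 5 \<omega> \<in> {-5/4..-9/8} \<and> B 6 \<omega> \<in> {-5/4..-9/8} \<and> B 7 \<omega> \<in> {-5/4..-9/8} \<and> (\<forall>u\<in>{5..7}. B u \<omega> \<le> - 1)}"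

text \<open>The path is built block by block over the times 0, 1, 5, 6, 7, 8 and then for ever, with
  \<open>block_lower\<close> for the bounded blocks and \<open>tail_lower\<close> at the end. The
  blocks contribute \<delta> to the powers 3, 1, 0, 0, 2 and 2. A measurable subset of
  \<open>low_event\<close> is all that is needed.\<close>

lemma low_event_bound:
  obtains c where "0 < c" "\<And>\<delta>. 0 < \<delta> \<Longrightarrow> \<delta> \<le> 1/64 \<Longrightarrow> \<exists>E\<in>sets M. E \<subseteq> low_event \<delta> \<and> c * \<delta> ^ 8 \<le> prob E"
proof -
  \<comment> \<open>Gaussian densities at an upper bound for the displacement in a block: 1 or 2
    over unit time, 2 over a time of length 4. In \<open>k\<close> the exponent 1/32 is 2 * (1/8) *
    (1/8), for two ends at least 1/8 below the barrier \<open>- 1\<close>.\<close>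
  define \<phi> where "\<phi> = normal_density 0 1 1"
  define \<phi>2 where "\<phi>2 = normal_density 0 1 2"
  define \<phi>4 where "\<phi>4 = normal_density 0 2 2"
  define k where "k = 1/8 * \<phi> * (1 - exp (- 1/32))"
  have pos: "0 < \<phi>" "0 < \<phi>2" "0 < \<phi>4" "0 < k"
    by (auto simp: \<phi>_def \<phi>2_def \<phi>4_def k_def intro!: mult_pos_pos normal_density_pos)
  define c where "c = \<phi> * (1/8 * \<phi>4 * (9/32)) * k * k * \<phi>2"
  have "\<exists>E\<in>sets M. E \<subseteq> low_event \<delta> \<and> c * \<delta> ^ 8 \<le> prob E" if d: "0 < \<delta>" "\<delta> \<le> 1/64" for \<delta>
  proof -
    have d2: "\<delta>\<^sup>2 \<le> 1/64 * 1" unfolding power2_eq_square using d by (intro mult_mono) auto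
    define Q1 where "Q1 = {\<omega>\<in>space M. B 1 \<omega> \<in> {-\<delta>..0}} \<inter> below \<delta> 0 0 1"
    define Q2 where "Q2 = {\<omega>\<in>Q1. B 5 \<omega> \<in> {-5/4..-9/8}} \<inter> below \<delta> 0 1 5"
    define Q3 where "Q3 = {\<omega>\<in>Q2. B 6 \<omega> \<in> {-5/4..-9/8}} \<inter> below (-1) 0 5 6"
    define Q4 where "Q4 = {\<omega>\<in>Q3. B 7 \<omega> \<in> {-5/4..-9/8}} \<inter> below (-1) 0 6 7"
    define Q5 where "Q5 = {\<omega>\<in>Q4. B 8 \<omega> \<in> {-\<delta>..0}} \<inter> below \<delta> 0 7 8"
    \<comment> \<open>This line has the value \<delta> at time 8 and stays below
      \<open>\<delta> * (1 + u)\<close>. At time 8 the path is at least \<delta> below it and the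
      slope is \<delta>, so the path never crosses with a probability of order at least
      \<open>\<delta>\<^sup>2\<close>.\<close>
    define Q6 where "Q6 = {\<omega>\<in>Q5. \<forall>u\<ge>8. B u \<omega> \<le> - 7 * \<delta> + \<delta> * u}"
    have sp: "space M \<in> sets (F 0)" using sets.top[of "F 0"] by simp
    have step: "{\<omega>\<in>Q. B t \<omega> \<in> {x..y}} \<inter> below a b s t \<in> sets (F t)" if "Q \<in> sets (F s)" "0 \<le> s" "s < t" for Q x y a b s t
      using that F_mono[of s t] below_measurable[of s t] by (intro sets.Int value_measurable_F) auto
    have m1: "Q1 \<in> sets (F 1)" unfolding Q1_def by (rule step[OF sp]) auto
    have m2: "Q2 \<in> sets (F 5)" unfolding Q2_def by (rule step[OF m1]) auto
    have m3: "Q3 \<in> sets (F 6)" unfolding Q3_def by (rule step[OF m2]) auto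
    have m4: "Q4 \<in> sets (F 7)" unfolding Q4_def by (rule step[OF m3]) auto
    have m5: "Q5 \<in> sets (F 8)" unfolding Q5_def by (rule step[OF m4]) auto
    have m6: "Q6 \<in> sets M" unfolding Q6_def by (rule tail_measurable[OF _ m5]) (use d in auto)
    have "(0 - - \<delta>) * normal_density 0 (sqrt (1 - 0)) 1 * (1 - exp (- 2 * (\<delta> - 0) * (\<delta> - 0) / (1 - 0))) * prob (space M) \<le> prob Q1"
      unfolding Q1_def by (rule block_lower[OF _ _ sp, where ?x1.0=0]) (use d in \<open>auto simp: B_zero\<close>)
    then have b1: "\<delta> * \<phi> * (1 - exp (- 2 * \<delta> * \<delta>)) \<le> prob Q1" by (simp add: prob_space \<phi>_def)
    have "2 * \<delta>\<^sup>2 / 2 \<le> 1 - exp (- (2 * \<delta> * \<delta>))"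
      by (rule one_minus_exp_ge) (use d d2 in \<open>auto simp: power2_eq_square\<close>)
    then have "\<delta> * \<phi> * \<delta>\<^sup>2 \<le> \<delta> * \<phi> * (1 - exp (- 2 * \<delta> * \<delta>))" using d pos by (intro mult_left_mono) auto
    then have p1: "\<delta> * \<phi> * \<delta>\<^sup>2 \<le> prob Q1" using b1 by linarith
    have "(-9/8 - -5/4) * normal_density 0 (sqrt (5 - 1)) 2 * (1 - exp (- 2 * (\<delta> - -9/8) * (\<delta> - 0) / (5 - 1))) * prob Q1 \<le> prob Q2"
      unfolding Q2_def by (rule block_lower[OF _ _ m1, where ?x1.0="-\<delta>"]) (use d in \<open>auto simp: Q1_def\<close>)
    moreover have "- 2 * (\<delta> - -9/8) * (\<delta> - 0) / (5 - 1) = - ((\<delta> + 9/8) * \<delta> / 2)" by (simp add: field_simps)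
    ultimately have b2: "1/8 * \<phi>4 * (1 - exp (- ((\<delta> + 9/8) * \<delta> / 2))) * prob Q1 \<le> prob Q2"
      by (simp only: \<phi>4_def) simp
    have "9/16 * \<delta> / 2 \<le> 1 - exp (- ((\<delta> + 9/8) * \<delta> / 2))"
      by (rule one_minus_exp_ge) (use d in \<open>auto simp: algebra_simps\<close>)
    then have "1/8 * \<phi>4 * (9/16 * \<delta> / 2) * prob Q1 \<le> 1/8 * \<phi>4 * (1 - exp (- ((\<delta> + 9/8) * \<delta> / 2))) * prob Q1"
      using pos by (intro mult_right_mono mult_left_mono) auto
    then have "1/8 * \<phi>4 * (9/16 * \<delta> / 2) * prob Q1 \<le> prob Q2" using b2 by (rule order_trans)
    moreover have "9/16 * \<delta> / 2 = 9/32 * \<delta>" by simp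
    ultimately have p2: "1/8 * \<phi>4 * (9/32 * \<delta>) * prob Q1 \<le> prob Q2" by (simp only:)
    have "(-9/8 - -5/4) * normal_density 0 (sqrt (6 - 5)) 1 * (1 - exp (- 2 * (-1 - -9/8) * (-1 - -9/8) / (6 - 5))) * prob Q2 \<le> prob Q3"
      unfolding Q3_def by (rule block_lower[OF _ _ m2, where ?x1.0="-5/4"]) (auto simp: Q2_def)
    then have p3: "k * prob Q2 \<le> prob Q3" by (simp add: k_def \<phi>_def)
    have "(-9/8 - -5/4) * normal_density 0 (sqrt (7 - 6)) 1 * (1 - exp (- 2 * (-1 - -9/8) * (-1 - -9/8) / (7 - 6))) * prob Q3 \<le> prob Q4"
      unfolding Q4_def by (rule block_lower[OF _ _ m3, where ?x1.0="-5/4"]) (auto simp: Q3_def)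
    then have p4: "k * prob Q3 \<le> prob Q4" by (simp add: k_def \<phi>_def)
    have "(0 - -\<delta>) * normal_density 0 (sqrt (8 - 7)) 2 * (1 - exp (- 2 * (\<delta> - 0) * (\<delta> - -9/8) / (8 - 7))) * prob Q4 \<le> prob Q5"
      unfolding Q5_def by (rule block_lower[OF _ _ m4, where ?x1.0="-5/4"]) (use d in \<open>auto simp: Q4_def\<close>)
    then have b5: "\<delta> * \<phi>2 * (1 - exp (- (2 * \<delta> * (\<delta> + 9/8)))) * prob Q4 \<le> prob Q5" by (simp add: \<phi>2_def)
    have "2 * \<delta> * 1 \<le> 2 * \<delta> * (\<delta> + 9/8)" using d by (intro mult_left_mono) auto
    then have "2 * \<delta> / 2 \<le> 1 - exp (- (2 * \<delta> * (\<delta> + 9/8)))"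
      using d by (intro one_minus_exp_ge) auto
    then have "\<delta> * \<phi>2 * \<delta> * prob Q4 \<le> \<delta> * \<phi>2 * (1 - exp (- (2 * \<delta> * (\<delta> + 9/8)))) * prob Q4"
      using pos d by (intro mult_right_mono mult_left_mono) auto
    then have p5: "\<delta> * \<phi>2 * \<delta> * prob Q4 \<le> prob Q5" using b5 by linarith
    have p6: "\<delta>\<^sup>2 * prob Q5 \<le> prob Q6"
    proof -
      have [measurable]: "Q5 \<in> sets M" by (rule F_sets_M[OF m5])
      have "emeasure M Q5 \<le> emeasure M Q6 + (\<integral>\<^sup>+\<omega>. indicator Q5 \<omega> * ennreal (exp (- 2 * \<delta> * (- 7 * \<delta> + \<delta> * 8 - B 8 \<omega>))) \<partial>M)"
        unfolding Q6_def by (rule tail_lower[OF _ m5]) (use d in auto)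
      also have "(\<integral>\<^sup>+\<omega>. indicator Q5 \<omega> * ennreal (exp (- 2 * \<delta> * (- 7 * \<delta> + \<delta> * 8 - B 8 \<omega>))) \<partial>M) \<le>
        (\<integral>\<^sup>+\<omega>. ennreal (exp (- (2 * \<delta>\<^sup>2))) * indicator Q5 \<omega> \<partial>M)"
      proof (rule nn_integral_mono)
        fix \<omega>
        have "exp (- 2 * \<delta> * (- 7 * \<delta> + \<delta> * 8 - B 8 \<omega>)) \<le> exp (- (2 * \<delta>\<^sup>2))" if "\<omega> \<in> Q5"
        proof -
          have "B 8 \<omega> \<le> 0" using that by (auto simp: Q5_def)
          then have "2 * \<delta> * \<delta> \<le> 2 * \<delta> * (\<delta> - B 8 \<omega>)" using d by (intro mult_left_mono) auto
          then show ?thesis by (simp add: power2_eq_square)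
        qed
        then show "indicator Q5 \<omega> * ennreal (exp (- 2 * \<delta> * (- 7 * \<delta> + \<delta> * 8 - B 8 \<omega>))) \<le> ennreal (exp (- (2 * \<delta>\<^sup>2))) * indicator Q5 \<omega>"
          by (auto split: split_indicator intro!: ennreal_leI)
      qed
      also have "\<dots> = ennreal (exp (- (2 * \<delta>\<^sup>2))) * emeasure M Q5" by (rule nn_integral_cmult_indicator) measurable
      finally have "prob Q5 \<le> prob Q6 + exp (- (2 * \<delta>\<^sup>2)) * prob Q5"
        by (simp add: emeasure_eq_measure ennreal_mult[symmetric] ennreal_plus[symmetric] add_left_mono del: ennreal_plus)
      moreover have "2 * \<delta>\<^sup>2 / 2 \<le> 1 - exp (- (2 * \<delta>\<^sup>2))"
        by (rule one_minus_exp_ge) (use d d2 in auto)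
      then have "\<delta>\<^sup>2 * prob Q5 \<le> (1 - exp (- (2 * \<delta>\<^sup>2))) * prob Q5" by (intro mult_right_mono) auto
      ultimately show ?thesis by (simp add: algebra_simps)
    qed
    have "c * \<delta> ^ 8 = \<delta>\<^sup>2 * (\<delta> * \<phi>2 * \<delta> * (k * (k * (1/8 * \<phi>4 * (9/32 * \<delta>) * (\<delta> * \<phi> * \<delta>\<^sup>2)))))"
      by (simp add: c_def power2_eq_square numeral_eq_Suc)
    also have "\<dots> \<le> \<delta>\<^sup>2 * (\<delta> * \<phi>2 * \<delta> * (k * (k * (1/8 * \<phi>4 * (9/32 * \<delta>) * prob Q1))))"
      using p1 pos d by (intro mult_left_mono) auto
    also have "\<dots> \<le> \<delta>\<^sup>2 * (\<delta> * \<phi>2 * \<delta> * (k * (k * prob Q2)))"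
      using p2 pos d by (intro mult_left_mono) auto
    also have "\<dots> \<le> \<delta>\<^sup>2 * (\<delta> * \<phi>2 * \<delta> * (k * prob Q3))"
      using p3 pos d by (intro mult_left_mono) auto
    also have "\<dots> \<le> \<delta>\<^sup>2 * (\<delta> * \<phi>2 * \<delta> * prob Q4)"
      using p4 pos d by (intro mult_left_mono) auto
    also have "\<dots> \<le> \<delta>\<^sup>2 * prob Q5"
      using p5 d by (intro mult_left_mono) auto
    also have "\<dots> \<le> prob Q6" by (rule p6)
    finally have "c * \<delta> ^ 8 \<le> prob Q6" .
    moreover have "Q6 \<subseteq> low_event \<delta>"
    proof
      fix \<omega> assume w: "\<omega> \<in> Q6"
      then have mem: "\<omega> \<in> Q1" "\<omega> \<in> Q2" "\<omega> \<in> Q3" "\<omega> \<in> Q4" "\<omega> \<in> Q5"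
        by (auto simp: Q6_def Q5_def Q4_def Q3_def Q2_def)
      have neg: "B u \<omega> \<le> - 1" if "u \<in> {5..7}" for u
        using mem that by (cases "u \<le> 6") (auto simp: Q3_def Q4_def below_def)
      have "B u \<omega> \<le> \<delta> * (1 + u)" if u: "0 \<le> u" for u
      proof -
        have g: "\<delta> \<le> \<delta> * (1 + u)" using u d by simp
        consider "u \<le> 1" | "1 \<le> u" "u \<le> 5" | "5 \<le> u" "u \<le> 7" | "7 \<le> u" "u \<le> 8" | "8 \<le> u" by linarith
        then show ?thesis
        proof cases
          case 1
          then have "B u \<omega> \<le> \<delta>" using mem u by (auto simp: Q1_def below_def)
          then show ?thesis using g by linarith
        next
          case 2
          then have "B u \<omega> \<le> \<delta>" using mem u by (auto simp: Q2_def below_def)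
          then show ?thesis using g by linarith
        next
          case 3
          then have "B u \<omega> \<le> - 1" by (intro neg) auto
          then show ?thesis using g d by linarith
        next
          case 4
          then have "B u \<omega> \<le> \<delta>" using mem u by (auto simp: Q5_def below_def)
          then show ?thesis using g by linarith
        next
          case 5
          then have "B u \<omega> \<le> - 7 * \<delta> + \<delta> * u" using w by (auto simp: Q6_def)
          then show ?thesis using d by (simp add: algebra_simps)
        qed
      qed
      then show "\<omega> \<in> low_event \<delta>" using mem neg
        by (auto simp: low_event_def Q1_def Q2_def Q3_def Q4_def Q5_def)
    qed
    ultimately show ?thesis using m6 by blast
  qed
  moreover have "0 < c" unfolding c_def using pos by simp
  ultimately show thesis using that by blast
qed

text \<open>By \<open>tail_lower\<close> from time 0, the line \<open>n + u\<close> is never crossed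
  with probability at least \<open>1 - exp (- 2 * n)\<close>, and a path below such a line has a
  concave majorant.\<close>

lemma AE_majorized: "AE \<omega> in M. majorized (\<lambda>u. B u \<omega>)"
proof -
  define G where "G n = {\<omega>\<in>space M. \<forall>u\<ge>0. B u \<omega> \<le> real n + 1 * u}" for n :: nat
  have sp: "space M \<in> sets (F 0)" using sets.top[of "F 0"] by simp
  have G[measurable]: "G n \<in> sets M" for n
    unfolding G_def by (rule tail_measurable[OF _ sp]) auto
  have bound: "1 - exp (- 2 * real n) \<le> prob (G n)" for n
  proof -
    have "emeasure M (space M) \<le> emeasure M (G n) + (\<integral>\<^sup>+\<omega>. indicator (space M) \<omega> * ennreal (exp (- 2 * 1 * (real n + 1 * 0 - B 0 \<omega>))) \<partial>M)"
      unfolding G_def by (rule tail_lower[OF _ sp]) auto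
    also have "(\<integral>\<^sup>+\<omega>. indicator (space M) \<omega> * ennreal (exp (- 2 * 1 * (real n + 1 * 0 - B 0 \<omega>))) \<partial>M) = (\<integral>\<^sup>+\<omega>. ennreal (exp (- 2 * real n)) \<partial>M)"
      by (rule nn_integral_cong) (simp add: B_zero)
    also have "\<dots> = ennreal (exp (- 2 * real n))" by (simp add: emeasure_space_1)
    finally have "1 \<le> prob (G n) + exp (- 2 * real n)"
      by (simp add: emeasure_eq_measure prob_space ennreal_plus[symmetric] del: ennreal_plus flip: ennreal_1)
    then show ?thesis by linarith
  qed
  have "(\<lambda>n. 1 - exp (- 2 * real n)) \<longlonglongrightarrow> 1 - 0"
    by (intro tendsto_diff tendsto_const) real_asymp
  moreover have "1 - exp (- 2 * real n) \<le> prob (\<Union>n. G n)" for n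
    using bound[of n] finite_measure_mono[of "G n" "\<Union>n. G n"] by (auto intro: order_trans)
  ultimately have "1 - 0 \<le> prob (\<Union>n. G n)"
    by (intro LIMSEQ_le_const2[where X="\<lambda>n. 1 - exp (- 2 * real n)"]) auto
  then have "prob (\<Union>n. G n) = 1" using prob_le_1[of "\<Union>n. G n"] by linarith
  then have "AE \<omega> in M. \<omega> \<in> (\<Union>n. G n)" by (subst (asm) prob_eq_1) auto
  then show ?thesis
  proof eventually_elim
    case (elim \<omega>)
    then obtain n where "\<omega> \<in> G n" by auto
    then show ?case by (intro majorized_affine[of _ "real n" 1]) (auto simp: G_def)
  qed
qed

text \<open>If the path were below \<open>- \<epsilon> * n\<close> at all integers
  \<open>n \<ge> N\<close>, it would in particular be so at any single late \<open>n\<close>, and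
  that has a probability of order \<open>1 / n\<^sup>2\<close>. Integer times and
  \<open>\<epsilon> = 1 / (k + 1)\<close> suffice, so there are only countably many exceptional
  events.\<close>

lemma AE_large: "AE \<omega> in M. \<forall>\<epsilon>>0. \<forall>N. \<exists>w\<ge>N. - \<epsilon> * w \<le> B w \<omega>"
proof -
  have "AE \<omega> in M. \<exists>n\<ge>N. - (1 / real (Suc k)) * real n \<le> B (real n) \<omega>" for k N :: nat
  proof -
    define \<epsilon> where "\<epsilon> = 1 / real (Suc k)"
    have e: "0 < \<epsilon>" by (simp add: \<epsilon>_def)
    have Bm[measurable]: "B (real n) \<in> borel_measurable M" for n :: nat by (rule measurable_B) simp
    define A where "A = {\<omega>\<in>space M. \<forall>n\<ge>N. B (real n) \<omega> < - \<epsilon> * real n}"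
    have A[measurable]: "A \<in> sets M" unfolding A_def by measurable
    have "prob A \<le> 3 / (\<epsilon> ^ 4 * (real n)\<^sup>2)" if n: "N \<le> n" "0 < n" for n
    proof -
      have "emeasure M A \<le> emeasure M {\<omega>\<in>space M. \<epsilon> * real n < \<bar>B (real n) \<omega> - B 0 \<omega>\<bar>}"
      proof (rule emeasure_mono)
        have [measurable]: "B 0 \<in> borel_measurable M" by (rule measurable_B) simp
        show "{\<omega>\<in>space M. \<epsilon> * real n < \<bar>B (real n) \<omega> - B 0 \<omega>\<bar>} \<in> sets M" by measurable
        show "A \<subseteq> {\<omega>\<in>space M. \<epsilon> * real n < \<bar>B (real n) \<omega> - B 0 \<omega>\<bar>}"
          using n by (force simp: A_def B_zero)
      qed
      also have "\<dots> \<le> ennreal (3 * (real n - 0)\<^sup>2 / (\<epsilon> * real n) ^ 4)"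
        by (rule increment_abs_tail_bound) (use n e in auto)
      also have "3 * (real n - 0)\<^sup>2 / (\<epsilon> * real n) ^ 4 = 3 / (\<epsilon> ^ 4 * (real n)\<^sup>2)"
        using n e by (simp add: power_mult_distrib power2_eq_square power4_eq_xxxx)
      finally show ?thesis using e by (simp add: emeasure_eq_measure)
    qed
    moreover have "(\<lambda>n. 3 / (\<epsilon> ^ 4 * (real n)\<^sup>2)) \<longlonglongrightarrow> 0" using e by real_asymp
    ultimately have "prob A \<le> 0"
      by (intro LIMSEQ_le_const[where X="\<lambda>n. 3 / (\<epsilon> ^ 4 * (real n)\<^sup>2)"]) (auto intro!: exI[of _ "Suc N"])
    then have "prob A = 0" using measure_nonneg[of M A] by linarith
    then have "AE \<omega> in M. \<omega> \<notin> A" by (subst (asm) prob_eq_0) auto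
    then show ?thesis by (rule AE_mp) (auto simp: A_def \<epsilon>_def not_less)
  qed
  then have "AE \<omega> in M. \<forall>k N. \<exists>n\<ge>N. - (1 / real (Suc k)) * real n \<le> B (real n) \<omega>"
    unfolding AE_all_countable by blast
  then show ?thesis
  proof eventually_elim
    case (elim \<omega>)
    show ?case
    proof (intro allI impI)
      fix \<epsilon> N :: real assume e: "0 < \<epsilon>"
      obtain k where k: "1 / real (Suc k) < \<epsilon>" using nat_approx_posE[OF e] .
      obtain N' :: nat where N': "N \<le> real N'" using real_arch_simple by blast
      obtain n where n: "n \<ge> N'" "- (1 / real (Suc k)) * real n \<le> B (real n) \<omega>" using elim by blast
      have "- \<epsilon> * real n \<le> - (1 / real (Suc k)) * real n" using k by (intro mult_right_mono) auto
      then show "\<exists>w\<ge>N. - \<epsilon> * w \<le> B w \<omega>" using n N' by (intro exI[of _ "real n"]) auto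
    qed
  qed
qed

abbreviation "X t \<omega> \<equiv> 2 * concave_majorant (\<lambda>s. B s \<omega>) t - B t \<omega>"

text \<open>Because of \<open>r \<ge> 1\<close> the bound \<open>u / r * \<delta>\<close> is at most
  \<open>\<delta> + (u - r) * \<delta>\<close>, which is at most \<open>2 * \<delta>\<close> within
  one unit of time and at most \<open>2 * \<delta> + 1\<close> up to the long horizon.\<close>

lemma AE_small_value:
  assumes r: "1 \<le> r" "r \<le> 8" and d: "0 < \<delta>"
  shows "AE \<omega> in M. X r \<omega> \<le> \<delta> \<longrightarrow> \<omega> \<in> stay_low r \<delta> \<inter> below (2 * \<delta> + 2) 0 (r + 1) (r + 1 + 1 / \<delta>)"
  using AE_majorized AE_large AE_space
proof eventually_elim
  case (elim \<omega>)
  show ?case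
  proof
    assume small: "X r \<omega> \<le> \<delta>"
    have r0: "0 < r" using r by simp
    have large: "\<exists>w\<ge>N. - \<epsilon> * w \<le> B w \<omega>" if "0 < \<epsilon>" for \<epsilon> N using elim(2) that by blast
    note small_value_consequences[OF elim(1) B_zero[OF elim(3)] r0 _ small]
    then have c: "- \<delta> \<le> B r \<omega>" "\<And>u. 0 \<le> u \<Longrightarrow> u \<le> r \<Longrightarrow> B u \<omega> \<le> \<delta>"
      "\<And>u. r \<le> u \<Longrightarrow> B u \<omega> \<le> u / r * \<delta>"
      using large by blast+
    have up: "B u \<omega> \<le> \<delta> + (u - r) * \<delta>" if "r \<le> u" for u
    proof -
      have "u / r * \<delta> = \<delta> + (u - r) / r * \<delta>" using r0 by (simp add: field_simps)
      moreover have "(u - r) / r \<le> (u - r) / 1" using that r by (intro divide_left_mono) auto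
      then have "(u - r) / r * \<delta> \<le> (u - r) * \<delta>" using d by (intro mult_right_mono) auto
      ultimately show ?thesis using c(3)[OF that] by linarith
    qed
    have "B r \<omega> \<le> \<delta>" using c(2)[of r] r0 by simp
    moreover have "B u \<omega> \<le> 2 * \<delta>" if "r \<le> u" "u \<le> r + 1" for u
    proof -
      have "(u - r) * \<delta> \<le> 1 * \<delta>" using that d by (intro mult_right_mono) auto
      then show ?thesis using up[OF that(1)] by linarith
    qed
    moreover have "B u \<omega> \<le> 2 * \<delta> + 2" if "r + 1 \<le> u" "u \<le> r + 1 + 1 / \<delta>" for u
    proof -
      have "(u - r) * \<delta> \<le> (1 + 1 / \<delta>) * \<delta>" using that d by (intro mult_right_mono) auto
      then have "(u - r) * \<delta> \<le> \<delta> + 1" using d by (simp add: algebra_simps)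
      then show ?thesis using up[of u] that by linarith
    qed
    ultimately show "\<omega> \<in> stay_low r \<delta> \<inter> below (2 * \<delta> + 2) 0 (r + 1) (r + 1 + 1 / \<delta>)"
      using c(1,2) elim(3) by (auto simp: stay_low_def start_low_def below_def)
  qed
qed

end

section \<open>Cameron-Martin shifts\<close>

lemma increasing_chain_mono:
  fixes ts :: "nat \<Rightarrow> real"
  assumes "\<And>i. i < n \<Longrightarrow> ts i < ts (Suc i)" "i \<le> j" "j \<le> n"
  shows "ts i \<le> ts j"
  using assms(2,3)
proof (induction j)
  case (Suc j)
  then show ?case using assms(1)[of j] by (cases "i = Suc j") (auto intro: order_trans)
qed auto

lemma normal_density_shift:
  assumes "0 < \<Delta>"
  shows "normal_density 0 (sqrt \<Delta>) (x - z * \<Delta>) = normal_density 0 (sqrt \<Delta>) x * exp (z * x - z\<^sup>2 * \<Delta> / 2)"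
proof -
  have "- (x - z * \<Delta> - 0)\<^sup>2 / (2 * (sqrt \<Delta>)\<^sup>2) = - (x - 0)\<^sup>2 / (2 * (sqrt \<Delta>)\<^sup>2) + (z * x - z\<^sup>2 * \<Delta> / 2)"
    using assms by (simp add: field_simps power2_eq_square)
  then show ?thesis
    unfolding normal_density_def by (simp only: exp_add mult.assoc)
qed

context brownian
begin

text \<open>Cameron-Martin for finitely many times, by induction on their number. The hypothesis on
  the steps says that no step straddles \<open>p\<close> or \<open>q\<close>, so that the drift on a
  step is either absent or constant. The term \<open>max p (min (ts n) q)\<close> is the last time
  clamped to \<open>[p, q]\<close>: the weight is the one accumulated so far.\<close>

lemma shift_chain:
  fixes g :: "nat \<Rightarrow> real \<Rightarrow> ennreal"
  assumes pq: "0 \<le> p" "p < q" and ts0: "ts 0 = 0" and inc: "\<And>i. i < n \<Longrightarrow> ts i < ts (Suc i)"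
    and part: "\<And>i. i < n \<Longrightarrow> ts (Suc i) \<le> p \<or> q \<le> ts i \<or> p \<le> ts i \<and> ts (Suc i) \<le> q"
    and g: "\<And>k. g k \<in> borel_measurable borel"
  shows "(\<integral>\<^sup>+\<omega>. (\<Prod>k\<le>n. g k (B (ts k) \<omega> + z * ramp p q (ts k))) \<partial>M) =
    (\<integral>\<^sup>+\<omega>. (\<Prod>k\<le>n. g k (B (ts k) \<omega>)) * ennreal (exp (z * (B (max p (min (ts n) q)) \<omega> - B p \<omega>) - z\<^sup>2 * (max p (min (ts n) q) - p) / 2)) \<partial>M)"
  using inc part g
proof (induction n arbitrary: g)
  case 0
  have "ramp p q 0 = 0" "max p (min 0 q) = p" using pq by (auto simp: ramp_def)
  then show ?case using ts0 by simp
next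
  case (Suc n)
  note g[measurable] = Suc.prems(3)
  have mono: "ts i \<le> ts j" if "i \<le> j" "j \<le> Suc n" for i j
    by (rule increasing_chain_mono[where n="Suc n"]) (use that Suc.prems(1) in auto)
  have nonneg: "0 \<le> ts k" if "k \<le> Suc n" for k using mono[of 0 k] that ts0 by simp
  let ?s = "ts n" and ?t = "ts (Suc n)"
  have st: "0 \<le> ?s" "?s < ?t" using nonneg[of n] Suc.prems(1)[of n] by auto
  define \<Delta> where "\<Delta> = ?t - ?s"
  have D: "0 < \<Delta>" using st by (simp add: \<Delta>_def)
  define c where "c = ramp p q ?t - ramp p q ?s"
  define cl where "cl u = max p (min u q)" for u
  have c: "c = cl ?t - cl ?s" by (simp add: c_def ramp_def cl_def)
  define e where "e x = (if c = 0 then 1 else exp (z * x - z\<^sup>2 * \<Delta> / 2))" for x :: real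
  have em[measurable]: "e \<in> borel_measurable borel" unfolding e_def[abs_def] by measurable
  have e0: "0 \<le> e x" for x by (simp add: e_def)
  \<comment> \<open>Either the step lies outside \<open>[p, q]\<close> and neither drift nor weight
    changes, or it lies inside and the drift acts over its full length.\<close>
  have cases: "c = 0 \<and> cl ?t = cl ?s \<or> c = \<Delta> \<and> cl ?t = ?t \<and> cl ?s = ?s"
    using Suc.prems(2)[of n] st pq by (auto simp: c cl_def \<Delta>_def)
  let ?p = "normal_density 0 (sqrt \<Delta>)"
  have pe: "?p (x - z * c) = ?p x * e x" for x
    using cases normal_density_shift[OF D, of x z] D by (auto simp: e_def)
  define W where "W k \<omega> = exp (z * (B (cl (ts k)) \<omega> - B p \<omega>) - z\<^sup>2 * (cl (ts k) - p) / 2)" for k \<omega>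
  have WS: "W (Suc n) \<omega> = W n \<omega> * e (B ?t \<omega> - B ?s \<omega>)" for \<omega>
    using cases
  proof
    assume "c = \<Delta> \<and> cl ?t = ?t \<and> cl ?s = ?s"
    then show ?thesis using D by (simp add: W_def e_def exp_add[symmetric] \<Delta>_def algebra_simps diff_divide_distrib add_divide_distrib)
  qed (simp add: W_def e_def)
  have BF: "B (ts k) \<in> borel_measurable (F ?s)" if "k \<le> n" for k
    using nonneg[of k] mono[of k n] that by (intro measurable_B_F) auto
  define U where "U \<omega> = (\<Prod>k\<le>n. g k (B (ts k) \<omega> + z * ramp p q (ts k)))" for \<omega>
  have Um[measurable]: "U \<in> borel_measurable (F ?s)"
    unfolding U_def[abs_def]
  proof (rule borel_measurable_prod_ennreal)
    fix k assume "k \<in> {..n}"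
    then have [measurable]: "B (ts k) \<in> borel_measurable (F ?s)" by (intro BF) simp
    show "(\<lambda>\<omega>. g k (B (ts k) \<omega> + z * ramp p q (ts k))) \<in> borel_measurable (F ?s)" by measurable
  qed
  define V where "V \<omega> = (\<Prod>k\<le>n. g k (B (ts k) \<omega>)) * ennreal (W n \<omega>)" for \<omega>
  have Vm[measurable]: "V \<in> borel_measurable (F ?s)"
  proof -
    have [measurable]: "(\<lambda>\<omega>. \<Prod>k\<le>n. g k (B (ts k) \<omega>)) \<in> borel_measurable (F ?s)"
    proof (rule borel_measurable_prod_ennreal)
      fix k assume "k \<in> {..n}"
      then have [measurable]: "B (ts k) \<in> borel_measurable (F ?s)" by (intro BF) simp
      show "(\<lambda>\<omega>. g k (B (ts k) \<omega>)) \<in> borel_measurable (F ?s)" by measurable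
    qed
    have [measurable]: "(\<lambda>\<omega>. W n \<omega>) \<in> borel_measurable (F ?s)"
    proof (cases "?s < p")
      case True
      then have "cl ?s = p" using pq by (simp add: cl_def)
      then show ?thesis by (simp add: W_def)
    next
      case False
      have [measurable]: "B (cl ?s) \<in> borel_measurable (F ?s)" "B p \<in> borel_measurable (F ?s)"
        using False pq st by (auto intro!: measurable_B_F simp: cl_def)
      show ?thesis unfolding W_def by measurable
    qed
    show ?thesis unfolding V_def by measurable
  qed
  have Bs[measurable]: "B ?s \<in> borel_measurable (F ?s)" by (rule BF) simp
  \<comment> \<open>The last coordinate is integrated out together with its weight. The result is a
    function of the previous value, and the induction hypothesis is applied after multiplying it
    into the factor at index \<open>n\<close>.\<close>
  define h where "h y = (\<integral>\<^sup>+x. ennreal (?p x * e x) * g (Suc n) (y + x) \<partial>lborel)" for y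
  have hm[measurable]: "h \<in> borel_measurable borel" unfolding h_def[abs_def] by measurable
  have "(\<integral>\<^sup>+\<omega>. (\<Prod>k\<le>Suc n. g k (B (ts k) \<omega> + z * ramp p q (ts k))) \<partial>M) =
    (\<integral>\<^sup>+\<omega>. (\<lambda>(\<omega>, x). U \<omega> * g (Suc n) (B ?s \<omega> + x + z * ramp p q ?t)) (\<omega>, B ?t \<omega> - B ?s \<omega>) \<partial>M)"
    by (intro nn_integral_cong) (simp add: U_def)
  also have "\<dots> = (\<integral>\<^sup>+\<omega>. (\<integral>\<^sup>+x. ennreal (normal_density 0 (sqrt (?t - ?s)) x) * (\<lambda>(\<omega>, x). U \<omega> * g (Suc n) (B ?s \<omega> + x + z * ramp p q ?t)) (\<omega>, x) \<partial>lborel) \<partial>M)"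
    by (rule nn_integral_increment[OF st]) measurable
  also have "\<dots> = (\<integral>\<^sup>+\<omega>. U \<omega> * h (B ?s \<omega> + z * ramp p q ?s) \<partial>M)"
  proof (rule nn_integral_cong)
    fix \<omega>
    have "(\<integral>\<^sup>+x. ennreal (normal_density 0 (sqrt (?t - ?s)) x) * (\<lambda>(\<omega>, x). U \<omega> * g (Suc n) (B ?s \<omega> + x + z * ramp p q ?t)) (\<omega>, x) \<partial>lborel)
      = U \<omega> * (\<integral>\<^sup>+x. ennreal (?p x) * g (Suc n) (B ?s \<omega> + x + z * ramp p q ?t) \<partial>lborel)"
      by (simp add: \<Delta>_def nn_integral_cmult[symmetric] mult_ac)
    also have "(\<integral>\<^sup>+x. ennreal (?p x) * g (Suc n) (B ?s \<omega> + x + z * ramp p q ?t) \<partial>lborel) =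
      (\<integral>\<^sup>+x. ennreal (?p (- (z * c) + 1 * x)) * g (Suc n) (B ?s \<omega> + (- (z * c) + 1 * x) + z * ramp p q ?t) \<partial>lborel)"
      by (subst nn_integral_real_affine[where c=1 and t="- (z * c)"]) auto
    also have "\<dots> = h (B ?s \<omega> + z * ramp p q ?s)"
      unfolding h_def
    proof (rule nn_integral_cong)
      fix x
      have 1: "B ?s \<omega> + (- (z * c) + 1 * x) + z * ramp p q ?t = B ?s \<omega> + z * ramp p q ?s + x"
        by (simp add: c_def algebra_simps)
      have 2: "?p (- (z * c) + 1 * x) = ?p x * e x" using pe[of x] by simp
      show "ennreal (?p (- (z * c) + 1 * x)) * g (Suc n) (B ?s \<omega> + (- (z * c) + 1 * x) + z * ramp p q ?t) =
        ennreal (?p x * e x) * g (Suc n) (B ?s \<omega> + z * ramp p q ?s + x)"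
        unfolding 1 2 ..
    qed
    finally show "(\<integral>\<^sup>+x. ennreal (normal_density 0 (sqrt (?t - ?s)) x) * (\<lambda>(\<omega>, x). U \<omega> * g (Suc n) (B ?s \<omega> + x + z * ramp p q ?t)) (\<omega>, x) \<partial>lborel)
      = U \<omega> * h (B ?s \<omega> + z * ramp p q ?s)" .
  qed
  also have "\<dots> = (\<integral>\<^sup>+\<omega>. (\<Prod>k\<le>n. (if k = n then \<lambda>y. g n y * h y else g k) (B (ts k) \<omega> + z * ramp p q (ts k))) \<partial>M)"
  proof (rule nn_integral_cong)
    fix \<omega>
    have "(\<Prod>k\<le>n. (if k = n then \<lambda>y. g n y * h y else g k) (B (ts k) \<omega> + z * ramp p q (ts k))) =
      (\<Prod>k\<le>n. g k (B (ts k) \<omega> + z * ramp p q (ts k)) * (if k = n then h (B ?s \<omega> + z * ramp p q ?s) else 1))"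
      by (intro prod.cong) auto
    also have "\<dots> = U \<omega> * h (B ?s \<omega> + z * ramp p q ?s)"
      by (simp add: prod.distrib U_def)
    finally show "U \<omega> * h (B ?s \<omega> + z * ramp p q ?s) = (\<Prod>k\<le>n. (if k = n then \<lambda>y. g n y * h y else g k) (B (ts k) \<omega> + z * ramp p q (ts k)))" by simp
  qed
  also have "\<dots> = (\<integral>\<^sup>+\<omega>. (\<Prod>k\<le>n. (if k = n then \<lambda>y. g n y * h y else g k) (B (ts k) \<omega>)) *
      ennreal (exp (z * (B (max p (min (ts n) q)) \<omega> - B p \<omega>) - z\<^sup>2 * (max p (min (ts n) q) - p) / 2)) \<partial>M)"
    by (rule Suc.IH) (use Suc.prems(1,2) in auto)
  also have "\<dots> = (\<integral>\<^sup>+\<omega>. V \<omega> * h (B ?s \<omega>) \<partial>M)"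
  proof (rule nn_integral_cong)
    fix \<omega>
    have "(\<Prod>k\<le>n. (if k = n then \<lambda>y. g n y * h y else g k) (B (ts k) \<omega>)) =
      (\<Prod>k\<le>n. g k (B (ts k) \<omega>) * (if k = n then h (B ?s \<omega>) else 1))"
      by (intro prod.cong) auto
    also have "\<dots> = (\<Prod>k\<le>n. g k (B (ts k) \<omega>)) * h (B ?s \<omega>)"
      by (simp add: prod.distrib)
    finally show "(\<Prod>k\<le>n. (if k = n then \<lambda>y. g n y * h y else g k) (B (ts k) \<omega>)) *
      ennreal (exp (z * (B (max p (min (ts n) q)) \<omega> - B p \<omega>) - z\<^sup>2 * (max p (min (ts n) q) - p) / 2)) = V \<omega> * h (B ?s \<omega>)"
      by (simp add: V_def W_def cl_def mult_ac)
  qed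
  also have "\<dots> = (\<integral>\<^sup>+\<omega>. (\<integral>\<^sup>+x. ennreal (normal_density 0 (sqrt (?t - ?s)) x) * (\<lambda>(\<omega>, x). V \<omega> * (ennreal (e x) * g (Suc n) (B ?s \<omega> + x))) (\<omega>, x) \<partial>lborel) \<partial>M)"
  proof (rule nn_integral_cong)
    fix \<omega>
    show "V \<omega> * h (B ?s \<omega>) = (\<integral>\<^sup>+x. ennreal (normal_density 0 (sqrt (?t - ?s)) x) * (\<lambda>(\<omega>, x). V \<omega> * (ennreal (e x) * g (Suc n) (B ?s \<omega> + x))) (\<omega>, x) \<partial>lborel)"
      unfolding h_def by (subst nn_integral_cmult[symmetric]) (auto intro!: nn_integral_cong simp: \<Delta>_def ennreal_mult e0 mult_ac)
  qed
  also have "\<dots> = (\<integral>\<^sup>+\<omega>. (\<lambda>(\<omega>, x). V \<omega> * (ennreal (e x) * g (Suc n) (B ?s \<omega> + x))) (\<omega>, B ?t \<omega> - B ?s \<omega>) \<partial>M)"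
    by (rule nn_integral_increment[OF st, symmetric]) measurable
  also have "\<dots> = (\<integral>\<^sup>+\<omega>. (\<Prod>k\<le>Suc n. g k (B (ts k) \<omega>)) * ennreal (W (Suc n) \<omega>) \<partial>M)"
  proof (rule nn_integral_cong)
    fix \<omega>
    have "ennreal (W (Suc n) \<omega>) = ennreal (W n \<omega>) * ennreal (e (B ?t \<omega> - B ?s \<omega>))"
      unfolding WS by (rule ennreal_mult) (auto simp: W_def e0)
    then show "(\<lambda>(\<omega>, x). V \<omega> * (ennreal (e x) * g (Suc n) (B ?s \<omega> + x))) (\<omega>, B ?t \<omega> - B ?s \<omega>) =
      (\<Prod>k\<le>Suc n. g k (B (ts k) \<omega>)) * ennreal (W (Suc n) \<omega>)"
      by (simp add: V_def mult_ac)
  qed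
  finally show ?case by (simp only: W_def cl_def)
qed

text \<open>\<open>B\<close> is controlled at nonnegative times only, so negative times are frozen at 0.\<close>

definition path :: "'a \<Rightarrow> real \<Rightarrow> real" where
  "path \<omega> t = B (max 0 t) \<omega>"

lemma path_measurable [measurable]: "path \<in> measurable M path_space"
  unfolding path_def[abs_def] by (intro measurable_abs_UNIV measurable_B) simp

lemma shifted_path_measurable [measurable]: "(\<lambda>\<omega> u. path \<omega> u + z * f u) \<in> measurable M path_space"
proof (intro measurable_abs_UNIV)
  fix u
  have [measurable]: "(\<lambda>\<omega>. path \<omega> u) \<in> borel_measurable M" unfolding path_def by (rule measurable_B) simp
  show "(\<lambda>\<omega>. path \<omega> u + z * f u) \<in> borel_measurable M" by measurable
qed

text \<open>The Cameron-Martin density of the shift by \<open>z * ramp p q\<close>: the drift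
  \<open>z\<close> paired with the increment over \<open>[p, q]\<close>, minus half of its
  energy.\<close>

definition ramp_weight :: "real \<Rightarrow> real \<Rightarrow> real \<Rightarrow> (real \<Rightarrow> real) \<Rightarrow> real" where
  "ramp_weight p q z w = exp (z * (w q - w p) - z\<^sup>2 * (q - p) / 2)"

lemma ramp_weight_measurable [measurable]: "ramp_weight p q z \<in> borel_measurable path_space"
  unfolding ramp_weight_def[abs_def] by measurable

text \<open>The law of the shifted path and the weighted law of the path agree on cylinders by
  \<open>shift_chain\<close>, and cylinders determine a finite measure on path space.\<close>

lemma Cameron_Martin_ramp:
  assumes pq: "0 \<le> p" "p < q" and G[measurable]: "G \<in> borel_measurable path_space"
  shows "(\<integral>\<^sup>+\<omega>. G (\<lambda>u. path \<omega> u + z * ramp p q u) \<partial>M) =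
    (\<integral>\<^sup>+\<omega>. G (path \<omega>) * ennreal (ramp_weight p q z (path \<omega>)) \<partial>M)"
proof -
  let ?S = "\<lambda>\<omega> u. path \<omega> u + z * ramp p q u"
  let ?P = "distr M path_space ?S"
  let ?Q = "density (distr M path_space path) (\<lambda>w. ennreal (ramp_weight p q z w))"
  interpret P: prob_space ?P by (rule prob_space_distr) measurable
  have "?P = ?Q"
  proof (rule measure_eqI_PiM_infinite)
    fix A :: "real \<Rightarrow> real set" and J :: "real set"
    assume J: "finite J" and A: "\<And>i. i \<in> J \<Longrightarrow> A i \<in> sets borel"
    define J' where "J' = insert 0 (insert p (insert q (max 0 ` J)))"
    have J': "finite J'" "J' \<noteq> {}" using J by (auto simp: J'_def)
    obtain ts :: "nat \<Rightarrow> real" and n where ts: "\<And>i. i < n \<Longrightarrow> ts i < ts (Suc i)" "ts ` {..n} = J'" "ts 0 = Min J'"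
      using sorted_enumeration[OF J'] by metis
    have "Min J' = 0" using pq J'(1) by (intro Min_eqI) (auto simp: J'_def)
    then have ts0: "ts 0 = 0" using ts(3) by simp
    have mono: "ts i \<le> ts j" if "i \<le> j" "j \<le> n" for i j
      by (rule increasing_chain_mono[where n=n]) (use that ts(1) in auto)
    have "p \<in> ts ` {..n}" "q \<in> ts ` {..n}" unfolding ts(2) by (auto simp: J'_def)
    then obtain a b where ab: "a \<le> n" "p = ts a" "b \<le> n" "q = ts b" by auto
    have part: "ts (Suc i) \<le> p \<or> q \<le> ts i \<or> p \<le> ts i \<and> ts (Suc i) \<le> q" if "i < n" for i
    proof -
      consider "Suc i \<le> a" | "b \<le> i" | "a \<le> i \<and> Suc i \<le> b" by linarith
      then show ?thesis using that ab mono by cases auto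
    qed
    have tsn: "max p (min (ts n) q) = q" using mono[of b n] ab pq by auto
    \<comment> \<open>All negative indices share the time 0, so several constraints may fall on one
      time and have to be intersected.\<close>
    define g where "g k x = (indicator (\<Inter>j\<in>{j\<in>J. max 0 j = ts k}. A j) x :: ennreal)" for k x
    have gm: "g k \<in> borel_measurable borel" for k
    proof -
      have "(\<Inter>j\<in>{j\<in>J. max 0 j = ts k}. A j) \<in> sets borel"
      proof (cases "{j\<in>J. max 0 j = ts k} = {}")
        case True
        show ?thesis unfolding True by simp
      next
        case False
        then show ?thesis using J A by (intro sets.finite_INT) auto
      qed
      then show ?thesis unfolding g_def[abs_def] by measurable
    qed
    have prod: "(\<Prod>k\<le>n. g k (w (ts k))) = indicator {w. \<forall>j\<in>J. w (max 0 j) \<in> A j} w" for w :: "real \<Rightarrow> real"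
    proof (cases "\<forall>j\<in>J. w (max 0 j) \<in> A j")
      case True
      have "g k (w (ts k)) = 1" for k
      proof -
        have "w (ts k) \<in> A j" if "j \<in> J" "max 0 j = ts k" for j using True that(1) unfolding that(2)[symmetric] by blast
        then have "w (ts k) \<in> (\<Inter>j\<in>{j\<in>J. max 0 j = ts k}. A j)" by blast
        then show ?thesis unfolding g_def by (rule indicator_simps(1))
      qed
      then show ?thesis using True by simp
    next
      case False
      then obtain j where j: "j \<in> J" "w (max 0 j) \<notin> A j" by auto
      have "max 0 j \<in> ts ` {..n}" unfolding ts(2) using j by (auto simp: J'_def)
      then obtain k where k: "k \<le> n" "max 0 j = ts k" by auto
      have "w (ts k) \<notin> (\<Inter>j\<in>{j\<in>J. max 0 j = ts k}. A j)" using j k(2) by auto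
      then have "g k (w (ts k)) = 0" unfolding g_def by (rule indicator_simps(2))
      then have "(\<Prod>k\<le>n. g k (w (ts k))) = 0" using k(1) by (intro prod_zero) auto
      then show ?thesis using False by simp
    qed
    let ?C = "prod_emb UNIV (\<lambda>_. borel) J (Pi\<^sub>E J A) :: (real \<Rightarrow> real) set"
    have C[measurable]: "?C \<in> sets path_space"
      using J A by (intro sets_PiM_I) auto
    have Cmem: "w \<in> ?C \<longleftrightarrow> (\<forall>j\<in>J. w j \<in> A j)" for w :: "real \<Rightarrow> real"
      by (auto simp: prod_emb_def)
    have r0: "ramp p q (max 0 j) = ramp p q j" for j using pq by (auto simp: ramp_def max_def min_def)
    have "emeasure ?P ?C = (\<integral>\<^sup>+w. indicator ?C w \<partial>?P)" by simp
    also have "\<dots> = (\<integral>\<^sup>+\<omega>. indicator ?C (?S \<omega>) \<partial>M)" by (rule nn_integral_distr) measurable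
    also have "\<dots> = (\<integral>\<^sup>+\<omega>. (\<Prod>k\<le>n. g k (B (ts k) \<omega> + z * ramp p q (ts k))) \<partial>M)"
    proof (rule nn_integral_cong)
      fix \<omega>
      show "indicator ?C (?S \<omega>) = (\<Prod>k\<le>n. g k (B (ts k) \<omega> + z * ramp p q (ts k)))"
        unfolding prod[of "\<lambda>t. B t \<omega> + z * ramp p q t"] by (simp add: Cmem path_def r0 indicator_def)
    qed
    also have "\<dots> = (\<integral>\<^sup>+\<omega>. (\<Prod>k\<le>n. g k (B (ts k) \<omega>)) * ennreal (exp (z * (B q \<omega> - B p \<omega>) - z\<^sup>2 * (q - p) / 2)) \<partial>M)"
      using shift_chain[OF pq ts0 ts(1) part gm, where z=z and n=n] unfolding tsn by simp
    also have "\<dots> = (\<integral>\<^sup>+\<omega>. ennreal (ramp_weight p q z (path \<omega>)) * indicator ?C (path \<omega>) \<partial>M)"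
    proof (rule nn_integral_cong)
      fix \<omega>
      show "(\<Prod>k\<le>n. g k (B (ts k) \<omega>)) * ennreal (exp (z * (B q \<omega> - B p \<omega>) - z\<^sup>2 * (q - p) / 2)) =
        ennreal (ramp_weight p q z (path \<omega>)) * indicator ?C (path \<omega>)"
        unfolding prod[of "\<lambda>t. B t \<omega>"] using pq by (simp add: Cmem path_def ramp_weight_def indicator_def)
    qed
    also have "\<dots> = (\<integral>\<^sup>+w. ennreal (ramp_weight p q z w) * indicator ?C w \<partial>distr M path_space path)"
      by (subst nn_integral_distr) measurable
    also have "\<dots> = emeasure ?Q ?C"
      by (subst emeasure_density) auto
    finally show "emeasure ?P ?C = emeasure ?Q ?C" .
  qed (auto simp: P.finite_measure_axioms)
  then have "(\<integral>\<^sup>+w. G w \<partial>?P) = (\<integral>\<^sup>+w. G w \<partial>?Q)" by simp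
  also have "\<dots> = (\<integral>\<^sup>+\<omega>. G (path \<omega>) * ennreal (ramp_weight p q z (path \<omega>)) \<partial>M)"
    by (subst nn_integral_density) (auto simp: nn_integral_distr mult.commute)
  finally show ?thesis by (subst (asm) nn_integral_distr) measurable
qed

end

section \<open>Undoing a shift and averaging over shifts\<close>

lemma emeasure_le_diameter:
  fixes S :: "real set"
  assumes "\<And>x y. x \<in> S \<Longrightarrow> y \<in> S \<Longrightarrow> x \<le> y \<Longrightarrow> y - x \<le> d" "0 \<le> d"
  shows "emeasure lborel S \<le> ennreal d"
proof (cases "S = {}")
  case False
  then obtain x0 where x0: "x0 \<in> S" by auto
  have dist: "y - x \<le> d" if "x \<in> S" "y \<in> S" for x y
    using assms that by (cases "x \<le> y") auto
  have bdd: "bdd_below S" by (rule bdd_belowI[of _ "x0 - d"]) (use dist[OF _ x0] in \<open>auto simp: algebra_simps\<close>)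
  have "S \<subseteq> {Inf S..Inf S + d}"
  proof
    fix x assume x: "x \<in> S"
    have "x - d \<le> Inf S" by (rule cInf_greatest[OF False]) (use dist[OF _ x] in \<open>auto simp: algebra_simps\<close>)
    then show "x \<in> {Inf S..Inf S + d}" using cInf_lower[OF x bdd] by auto
  qed
  then have "emeasure lborel S \<le> emeasure lborel {Inf S..Inf S + d}" by (intro emeasure_mono) auto
  then show ?thesis using assms(2) by simp
qed simp

lemma nn_integral_normal_exp_abs:
  assumes "0 < \<sigma>"
  shows "(\<integral>\<^sup>+x. ennreal (normal_density 0 \<sigma> x) * ennreal (exp \<bar>x\<bar>) \<partial>lborel) \<le> ennreal (2 * exp (\<sigma>\<^sup>2 / 2))"
proof -
  have "(\<integral>\<^sup>+x. ennreal (normal_density 0 \<sigma> x) * ennreal (exp \<bar>x\<bar>) \<partial>lborel) \<le>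
    (\<integral>\<^sup>+x. ennreal (normal_density 0 \<sigma> x) * ennreal (exp (1 * x)) + ennreal (normal_density 0 \<sigma> x) * ennreal (exp (- 1 * x)) \<partial>lborel)"
  proof (rule nn_integral_mono)
    fix x :: real
    have "exp \<bar>x\<bar> \<le> exp (1 * x) + exp (- 1 * x)" by (auto simp: abs_if)
    then have "normal_density 0 \<sigma> x * exp \<bar>x\<bar> \<le> normal_density 0 \<sigma> x * (exp (1 * x) + exp (- 1 * x))"
      by (rule mult_left_mono) simp
    then show "ennreal (normal_density 0 \<sigma> x) * ennreal (exp \<bar>x\<bar>) \<le>
      ennreal (normal_density 0 \<sigma> x) * ennreal (exp (1 * x)) + ennreal (normal_density 0 \<sigma> x) * ennreal (exp (- 1 * x))"
      by (simp add: ennreal_mult[symmetric] ennreal_plus[symmetric] distrib_left ennreal_leI del: ennreal_plus)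
  qed
  also have "\<dots> = ennreal (exp (1\<^sup>2 * \<sigma>\<^sup>2 / 2)) + ennreal (exp ((- 1)\<^sup>2 * \<sigma>\<^sup>2 / 2))"
    using nn_integral_normal_exp[OF assms, of 1] nn_integral_normal_exp[OF assms, of "-1"]
    by (subst nn_integral_add) auto
  also have "\<dots> = ennreal (2 * exp (\<sigma>\<^sup>2 / 2))"
    by (simp add: ennreal_plus[symmetric] del: ennreal_plus)
  finally show ?thesis .
qed

lemma ramp_measurable [measurable]: "(\<lambda>w u. w u + z * ramp p q u) \<in> measurable path_space path_space"
  by (intro measurable_abs_UNIV) measurable

lemma tent_measurable [measurable]: "(\<lambda>w u. w u + z * tent u) \<in> measurable path_space path_space"
  by (intro measurable_abs_UNIV) measurable

lemma tent_split: "w u + z * tent u = (w u + z * ramp 5 6 u) + (- z) * ramp 6 7 u"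
  by (simp add: tent_def algebra_simps)

context brownian
begin

text \<open>A tent is a ramp on \<open>[5, 6]\<close> followed by the opposite ramp on
  \<open>[6, 7]\<close>. The second one vanishes at 5 and 6, so it does not affect the weight of the
  first, and the two weights multiply.\<close>

lemma Cameron_Martin_tent:
  assumes G[measurable]: "G \<in> borel_measurable path_space"
  shows "(\<integral>\<^sup>+\<omega>. G (\<lambda>u. path \<omega> u + z * tent u) \<partial>M) =
    (\<integral>\<^sup>+\<omega>. G (path \<omega>) * (ennreal (ramp_weight 5 6 z (path \<omega>)) * ennreal (ramp_weight 6 7 (- z) (path \<omega>))) \<partial>M)"
proof -
  define G1 where "G1 w = G (\<lambda>u. w u + (- z) * ramp 6 7 u)" for w
  have [measurable]: "G1 \<in> borel_measurable path_space" unfolding G1_def[abs_def] by measurable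
  define G2 where "G2 w = G w * ennreal (ramp_weight 5 6 z w)" for w
  have [measurable]: "G2 \<in> borel_measurable path_space" unfolding G2_def[abs_def] by measurable
  have "(\<integral>\<^sup>+\<omega>. G (\<lambda>u. path \<omega> u + z * tent u) \<partial>M) = (\<integral>\<^sup>+\<omega>. G1 (\<lambda>u. path \<omega> u + z * ramp 5 6 u) \<partial>M)"
    unfolding G1_def tent_split ..
  also have "\<dots> = (\<integral>\<^sup>+\<omega>. G1 (path \<omega>) * ennreal (ramp_weight 5 6 z (path \<omega>)) \<partial>M)"
    by (rule Cameron_Martin_ramp) auto
  also have "\<dots> = (\<integral>\<^sup>+\<omega>. G2 (\<lambda>u. path \<omega> u + (- z) * ramp 6 7 u) \<partial>M)"
    by (simp add: G1_def G2_def ramp_weight_def ramp_def)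
  also have "\<dots> = (\<integral>\<^sup>+\<omega>. G2 (path \<omega>) * ennreal (ramp_weight 6 7 (- z) (path \<omega>)) \<partial>M)"
    by (rule Cameron_Martin_ramp) auto
  finally show ?thesis by (simp add: G2_def mult.assoc)
qed

text \<open>Evaluated along the shifted path, the inverse weight is
  \<open>exp (- (z * I + z\<^sup>2 * (q - p) / 2))\<close> for the increment \<open>I\<close> over
  \<open>[p, q]\<close>. For \<open>z\<close> in \<open>[0, 1]\<close> it is at most
  \<open>exp \<bar>I\<bar>\<close>, which depends neither on \<open>z\<close>, so that one may
  average over \<open>z\<close>, nor on the path up to \<open>p\<close>, so that it can be
  integrated out.\<close>

lemma unshift_ramp:
  assumes F[measurable]: "G \<in> borel_measurable path_space" and z: "0 \<le> z" "z \<le> 1" and pq: "0 \<le> p" "p < q"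
  shows "(\<integral>\<^sup>+\<omega>. G (path \<omega>) \<partial>M) \<le> (\<integral>\<^sup>+\<omega>. G (\<lambda>u. path \<omega> u + z * ramp p q u) * ennreal (exp \<bar>B q \<omega> - B p \<omega>\<bar>) \<partial>M)"
proof -
  define H where "H w = G w * ennreal (1 / ramp_weight p q z w)" for w
  have [measurable]: "H \<in> borel_measurable path_space" unfolding H_def[abs_def] by measurable
  have "(\<integral>\<^sup>+\<omega>. G (path \<omega>) \<partial>M) = (\<integral>\<^sup>+\<omega>. H (path \<omega>) * ennreal (ramp_weight p q z (path \<omega>)) \<partial>M)"
    by (intro nn_integral_cong) (simp add: H_def mult.assoc ennreal_mult[symmetric] ramp_weight_def)
  also have "\<dots> = (\<integral>\<^sup>+\<omega>. H (\<lambda>u. path \<omega> u + z * ramp p q u) \<partial>M)"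
    by (rule Cameron_Martin_ramp[symmetric]) (use pq in auto)
  also have "\<dots> \<le> (\<integral>\<^sup>+\<omega>. G (\<lambda>u. path \<omega> u + z * ramp p q u) * ennreal (exp \<bar>B q \<omega> - B p \<omega>\<bar>) \<partial>M)"
  proof (rule nn_integral_mono)
    fix \<omega>
    let ?I = "B q \<omega> - B p \<omega>"
    have "ramp_weight p q z (\<lambda>u. path \<omega> u + z * ramp p q u) = exp (z * (?I + z * (q - p)) - z\<^sup>2 * (q - p) / 2)"
      using pq by (simp add: ramp_weight_def path_def ramp_def algebra_simps)
    also have "z * (?I + z * (q - p)) - z\<^sup>2 * (q - p) / 2 = z * ?I + z\<^sup>2 * (q - p) / 2"
      by (simp add: power2_eq_square field_simps)
    finally have "1 / ramp_weight p q z (\<lambda>u. path \<omega> u + z * ramp p q u) = exp (- (z * ?I + z\<^sup>2 * (q - p) / 2))"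
      by (simp only: exp_minus inverse_eq_divide)
    also have "- (z * ?I + z\<^sup>2 * (q - p) / 2) \<le> \<bar>?I\<bar>"
    proof -
      have "z * (- ?I) \<le> z * \<bar>?I\<bar>" using z by (intro mult_left_mono) auto
      also have "\<dots> \<le> \<bar>?I\<bar>" using z by (intro mult_left_le_one_le) auto
      finally have "- (z * ?I) \<le> \<bar>?I\<bar>" by (simp only: mult_minus_right)
      moreover have "0 \<le> z\<^sup>2 * (q - p) / 2" using pq by simp
      ultimately show ?thesis by linarith
    qed
    finally show "H (\<lambda>u. path \<omega> u + z * ramp p q u) \<le> G (\<lambda>u. path \<omega> u + z * ramp p q u) * ennreal (exp \<bar>?I\<bar>)"
      unfolding H_def by (intro mult_left_mono ennreal_leI) auto
  qed
  finally show ?thesis .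
qed

lemma unshift_tent:
  assumes F[measurable]: "G \<in> borel_measurable path_space" and z: "0 \<le> z" "z \<le> 1"
  shows "(\<integral>\<^sup>+\<omega>. G (path \<omega>) \<partial>M) \<le> (\<integral>\<^sup>+\<omega>. G (\<lambda>u. path \<omega> u + z * tent u) * ennreal (exp (\<bar>B 6 \<omega> - B 5 \<omega>\<bar> + \<bar>B 7 \<omega> - B 6 \<omega>\<bar>)) \<partial>M)"
proof -
  define R where "R w = ramp_weight 5 6 z w * ramp_weight 6 7 (- z) w" for w
  have R[measurable]: "R \<in> borel_measurable path_space" unfolding R_def[abs_def] by measurable
  have R0: "0 < R w" for w by (simp add: R_def ramp_weight_def)
  have R2: "ennreal (R w) = ennreal (ramp_weight 5 6 z w) * ennreal (ramp_weight 6 7 (- z) w)" for w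
    unfolding R_def by (rule ennreal_mult) (auto simp: ramp_weight_def)
  define H where "H w = G w * ennreal (1 / R w)" for w
  have [measurable]: "H \<in> borel_measurable path_space" unfolding H_def[abs_def] by measurable
  have "(\<integral>\<^sup>+\<omega>. G (path \<omega>) \<partial>M) = (\<integral>\<^sup>+\<omega>. H (path \<omega>) * ennreal (R (path \<omega>)) \<partial>M)"
  proof (rule nn_integral_cong)
    fix \<omega>
    have "ennreal (1 / R (path \<omega>)) * ennreal (R (path \<omega>)) = 1"
      using R0[of "path \<omega>"] by (subst ennreal_mult[symmetric]) (auto simp: less_imp_le)
    then show "G (path \<omega>) = H (path \<omega>) * ennreal (R (path \<omega>))" by (simp add: H_def mult.assoc)
  qed
  also have "\<dots> = (\<integral>\<^sup>+\<omega>. H (\<lambda>u. path \<omega> u + z * tent u) \<partial>M)"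
    unfolding R2 by (rule Cameron_Martin_tent[symmetric]) auto
  also have "\<dots> \<le> (\<integral>\<^sup>+\<omega>. G (\<lambda>u. path \<omega> u + z * tent u) * ennreal (exp (\<bar>B 6 \<omega> - B 5 \<omega>\<bar> + \<bar>B 7 \<omega> - B 6 \<omega>\<bar>)) \<partial>M)"
  proof (rule nn_integral_mono)
    fix \<omega>
    let ?I = "B 6 \<omega> - B 5 \<omega>" and ?J = "B 7 \<omega> - B 6 \<omega>"
    have "R (\<lambda>u. path \<omega> u + z * tent u) = exp (z * (?I + z) - z\<^sup>2 / 2 + ((- z) * (?J - z) - z\<^sup>2 / 2))"
      unfolding exp_add by (simp add: R_def ramp_weight_def path_def tent_def ramp_def algebra_simps)
    also have "z * (?I + z) - z\<^sup>2 / 2 + ((- z) * (?J - z) - z\<^sup>2 / 2) = z * ?I - z * ?J + z\<^sup>2"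
      by (simp add: power2_eq_square field_simps)
    finally have "1 / R (\<lambda>u. path \<omega> u + z * tent u) = exp (- (z * ?I - z * ?J + z\<^sup>2))"
      by (simp only: exp_minus inverse_eq_divide)
    also have "- (z * ?I - z * ?J + z\<^sup>2) \<le> \<bar>?I\<bar> + \<bar>?J\<bar>"
    proof -
      have *: "z * x \<le> \<bar>x\<bar>" for x
      proof -
        have "z * x \<le> z * \<bar>x\<bar>" using z by (intro mult_left_mono) auto
        also have "\<dots> \<le> \<bar>x\<bar>" using z by (intro mult_left_le_one_le) auto
        finally show ?thesis .
      qed
      have "- (z * ?I) \<le> \<bar>?I\<bar>" using *[of "- ?I"] by (simp only: mult_minus_right abs_minus_cancel)
      moreover have "z * ?J \<le> \<bar>?J\<bar>" by (rule *)
      moreover have "0 \<le> z\<^sup>2" by simp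
      ultimately show ?thesis by linarith
    qed
    finally show "H (\<lambda>u. path \<omega> u + z * tent u) \<le> G (\<lambda>u. path \<omega> u + z * tent u) * ennreal (exp (\<bar>?I\<bar> + \<bar>?J\<bar>))"
      unfolding H_def by (intro mult_left_mono ennreal_leI) auto
  qed
  finally show ?thesis .
qed

text \<open>Fubini, once the shifted path is seen to depend measurably on the pair of shift and
  sample point, which on path space is checked coordinate by coordinate.\<close>

lemma shift_swap:
  assumes G[measurable]: "G \<in> borel_measurable path_space" and f[measurable]: "f \<in> borel_measurable borel"
    and e[measurable]: "e \<in> borel_measurable M" and I[measurable]: "I \<in> sets borel"
  shows "(\<integral>\<^sup>+z. (\<integral>\<^sup>+\<omega>. G (\<lambda>u. path \<omega> u + z * f u) * e \<omega> * indicator I z \<partial>M) \<partial>lborel) =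
    (\<integral>\<^sup>+\<omega>. e \<omega> * (\<integral>\<^sup>+z. G (\<lambda>u. path \<omega> u + z * f u) * indicator I z \<partial>lborel) \<partial>M)"
proof -
  interpret pair_sigma_finite lborel M ..
  have sh: "(\<lambda>x u. path (snd x) u + fst x * f u) \<in> measurable (lborel \<Otimes>\<^sub>M M) path_space"
  proof (intro measurable_abs_UNIV)
    fix u
    have [measurable]: "(\<lambda>\<omega>. path \<omega> u) \<in> borel_measurable M" unfolding path_def by (rule measurable_B) simp
    show "(\<lambda>x. path (snd x) u + fst x * f u) \<in> borel_measurable (lborel \<Otimes>\<^sub>M M)" by measurable
  qed
  have Gm'[measurable]: "(\<lambda>x. G (\<lambda>u. path (snd x) u + fst x * f u)) \<in> borel_measurable (lborel \<Otimes>\<^sub>M M)"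
    using measurable_compose[OF sh G] .
  have Gz[measurable]: "(\<lambda>z. G (\<lambda>u. path \<omega> u + z * f u)) \<in> borel_measurable lborel" if "\<omega> \<in> space M" for \<omega>
    using measurable_compose[OF measurable_Pair2'[OF that] Gm'] by simp
  have "(\<lambda>x. G (\<lambda>u. path (snd x) u + fst x * f u) * e (snd x) * indicator I (fst x)) \<in> borel_measurable (lborel \<Otimes>\<^sub>M M)"
    by measurable
  from Fubini[OF this] have "(\<integral>\<^sup>+z. (\<integral>\<^sup>+\<omega>. G (\<lambda>u. path \<omega> u + z * f u) * e \<omega> * indicator I z \<partial>M) \<partial>lborel) =
    (\<integral>\<^sup>+\<omega>. (\<integral>\<^sup>+z. G (\<lambda>u. path \<omega> u + z * f u) * e \<omega> * indicator I z \<partial>lborel) \<partial>M)" by simp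
  also have "\<dots> = (\<integral>\<^sup>+\<omega>. e \<omega> * (\<integral>\<^sup>+z. G (\<lambda>u. path \<omega> u + z * f u) * indicator I z \<partial>lborel) \<partial>M)"
  proof (rule nn_integral_cong)
    fix \<omega> assume "\<omega> \<in> space M"
    note [measurable] = Gz[OF this]
    show "(\<integral>\<^sup>+z. G (\<lambda>u. path \<omega> u + z * f u) * e \<omega> * indicator I z \<partial>lborel) = e \<omega> * (\<integral>\<^sup>+z. G (\<lambda>u. path \<omega> u + z * f u) * indicator I z \<partial>lborel)"
      by (subst nn_integral_cmult[symmetric]) (auto simp: mult_ac)
  qed
  finally show ?thesis .
qed

text \<open>Averaging over a family of shifts turns a bound on the length of the set of shifts reaching an event
  into a bound on the probability of the event.\<close>

lemma average_shifts:
  assumes G[measurable]: "G \<in> borel_measurable path_space" and f[measurable]: "f \<in> borel_measurable borel"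
    and e[measurable]: "e \<in> borel_measurable M"
    and unshift: "\<And>z. 0 \<le> z \<Longrightarrow> z \<le> 1 \<Longrightarrow> (\<integral>\<^sup>+\<omega>. G (path \<omega>) \<partial>M) \<le> (\<integral>\<^sup>+\<omega>. G (\<lambda>u. path \<omega> u + z * f u) * e \<omega> \<partial>M)"
    and len: "AE \<omega> in M. (\<integral>\<^sup>+z. G (\<lambda>u. path \<omega> u + z * f u) * indicator {0..1} z \<partial>lborel) \<le> L * indicator A \<omega>"
  shows "(\<integral>\<^sup>+\<omega>. G (path \<omega>) \<partial>M) \<le> (\<integral>\<^sup>+\<omega>. L * indicator A \<omega> * e \<omega> \<partial>M)"
proof -
  have "(\<integral>\<^sup>+\<omega>. G (path \<omega>) \<partial>M) = (\<integral>\<^sup>+z. (\<integral>\<^sup>+\<omega>. G (path \<omega>) \<partial>M) * indicator {0..1::real} z \<partial>lborel)"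
    by (subst nn_integral_cmult_indicator) auto
  also have "\<dots> \<le> (\<integral>\<^sup>+z. (\<integral>\<^sup>+\<omega>. G (\<lambda>u. path \<omega> u + z * f u) * e \<omega> * indicator {0..1} z \<partial>M) \<partial>lborel)"
  proof (rule nn_integral_mono)
    fix z :: real
    show "(\<integral>\<^sup>+\<omega>. G (path \<omega>) \<partial>M) * indicator {0..1} z \<le> (\<integral>\<^sup>+\<omega>. G (\<lambda>u. path \<omega> u + z * f u) * e \<omega> * indicator {0..1} z \<partial>M)"
      using unshift[of z] by (auto split: split_indicator)
  qed
  also have "\<dots> = (\<integral>\<^sup>+\<omega>. e \<omega> * (\<integral>\<^sup>+z. G (\<lambda>u. path \<omega> u + z * f u) * indicator {0..1} z \<partial>lborel) \<partial>M)"
    by (rule shift_swap) measurable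
  also have "\<dots> \<le> (\<integral>\<^sup>+\<omega>. L * indicator A \<omega> * e \<omega> \<partial>M)"
  proof (rule nn_integral_mono_AE)
    show "AE \<omega> in M. e \<omega> * (\<integral>\<^sup>+z. G (\<lambda>u. path \<omega> u + z * f u) * indicator {0..1} z \<partial>lborel) \<le> L * indicator A \<omega> * e \<omega>"
      using len by eventually_elim (simp add: mult.commute mult_left_mono)
  qed
  finally show ?thesis .
qed

section \<open>Brownian paths as points of path space, and the law of \<open>X 6\<close> on low
  paths\<close>

lemma concave_majorant_path: "concave_majorant (path \<omega>) t = concave_majorant (\<lambda>s. B s \<omega>) t"
  unfolding concave_majorant_def by (simp add: path_def)

lemma majorized_path: "majorized (path \<omega>) \<longleftrightarrow> majorized (\<lambda>s. B s \<omega>)"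
  unfolding majorized_def by (simp add: path_def)

lemma continuous_path: "\<omega> \<in> space M \<Longrightarrow> continuous_on {0..} (path \<omega>)"
  using continuous_B by (subst continuous_on_cong[OF refl, of _ _ "\<lambda>s. B s \<omega>"]) (auto simp: path_def)

lemma continuous_ramp: "continuous_on S (ramp p q)"
  unfolding ramp_def[abs_def] by (intro continuous_intros)

lemma continuous_tent: "continuous_on S tent"
  unfolding tent_def[abs_def] by (intro continuous_intros continuous_ramp)

lemma AE_path_X: "AE \<omega> in M. path_X (path \<omega>) = X 6 \<omega>"
  using AE_majorized AE_space
proof eventually_elim
  case (elim \<omega>)
  then show ?case using path_X_eq[of "path \<omega>"] continuous_path[of \<omega>]
    by (simp add: majorized_path concave_majorant_path) (simp add: path_def)
qed

lemma majorized_shift: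
  assumes "majorized w" "\<And>u. \<bar>f u\<bar> \<le> C"
  shows "majorized (\<lambda>u. w u + z * f u)"
proof (rule majorized_add_bounded[OF assms(1)])
  fix u
  have "z * f u \<le> \<bar>z\<bar> * \<bar>f u\<bar>" by (metis abs_ge_self abs_mult)
  also have "\<dots> \<le> \<bar>z\<bar> * C" using assms(2) by (intro mult_left_mono) auto
  finally show "z * f u \<le> \<bar>z\<bar> * C" .
qed

text \<open>\<open>stay_low 1 \<delta>\<close> as a set of paths, tested at rational times so as to
  be measurable in path space. It involves times before 2 only and is thus insensitive to the shifts
  used below.\<close>

definition low_paths :: "real \<Rightarrow> (real \<Rightarrow> real) set" where
  "low_paths \<delta> = {w. (\<forall>u\<in>\<rat> \<inter> {0<..<1}. w u \<le> \<delta>) \<and> - \<delta> \<le> w 1 \<and> (\<forall>u\<in>\<rat> \<inter> {1<..<2}. w u \<le> 2 * \<delta>)}"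

lemma low_paths_measurable [measurable]: "low_paths \<delta> \<in> sets path_space"
proof -
  have c: "countable (\<rat> \<inter> S :: real set)" for S by (rule countable_subset[OF _ countable_rat]) auto
  have 1: "{w \<in> space path_space. \<forall>u\<in>\<rat> \<inter> S. w u \<le> a} \<in> sets path_space" for S and a :: real
  proof -
    have "{w \<in> space path_space. \<forall>u\<in>\<rat> \<inter> S. w u \<le> a} = space path_space - (\<Union>u\<in>\<rat> \<inter> S. {w \<in> space path_space. a < w u})"
      by (auto simp: not_less Ball_def)
    also have "\<dots> \<in> sets path_space" by (intro sets.Diff sets.top sets.countable_UN'[OF c]) auto
    finally show ?thesis .
  qed
  have 2: "{w \<in> space path_space. - \<delta> \<le> w 1} \<in> sets path_space" by measurable
  have "low_paths \<delta> = {w \<in> space path_space. \<forall>u\<in>\<rat> \<inter> {0<..<1}. w u \<le> \<delta>} \<inter> {w \<in> space path_space. - \<delta> \<le> w 1} \<inter>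
    {w \<in> space path_space. \<forall>u\<in>\<rat> \<inter> {1<..<2}. w u \<le> 2 * \<delta>}"
    by (auto simp: low_paths_def space_PiM)
  then show ?thesis using 1 2 by auto
qed

lemma path_low_iff:
  assumes "\<omega> \<in> space M"
  shows "path \<omega> \<in> low_paths \<delta> \<longleftrightarrow> \<omega> \<in> stay_low 1 \<delta>"
proof -
  have ext: "B u \<omega> \<le> a" if le: "\<And>u. u \<in> \<rat> \<Longrightarrow> l < u \<Longrightarrow> u < r \<Longrightarrow> B u \<omega> \<le> a" and lr: "0 \<le> l" "l < r" and u: "u \<in> {l..r}" for l r a u
  proof -
    have cl: "closure (\<rat> \<inter> {l<..<r}) \<subseteq> {l..r}" by (rule closure_minimal) auto
    have "continuous_on {l..r} (\<lambda>u. B u \<omega>)"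
      by (rule continuous_on_subset[OF continuous_B[OF assms]]) (use lr in auto)
    then have cont: "continuous_on (closure (\<rat> \<inter> {l<..<r})) (\<lambda>u. B u \<omega>)"
      using cl by (rule continuous_on_subset)
    have "u \<in> closure (\<rat> \<inter> {l<..<r})" using Rats_Int_dense[OF lr(2)] u by blast
    then show ?thesis by (rule continuous_le_on_closure[OF cont]) (simp add: le)
  qed
  show ?thesis
  proof
    assume p: "path \<omega> \<in> low_paths \<delta>"
    have 1: "B u \<omega> \<le> \<delta>" if "u \<in> {0..1}" for u
      by (rule ext[of 0 1]) (use p that in \<open>auto simp: low_paths_def path_def\<close>)
    have 2: "B u \<omega> \<le> 2 * \<delta>" if "u \<in> {1..2}" for u
      by (rule ext[of 1 2]) (use p that in \<open>auto simp: low_paths_def path_def\<close>)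
    show "\<omega> \<in> stay_low 1 \<delta>"
      using assms 1 2 p by (auto simp: stay_low_def start_low_def below_def low_paths_def path_def)
  next
    assume "\<omega> \<in> stay_low 1 \<delta>"
    then show "path \<omega> \<in> low_paths \<delta>"
      by (auto simp: stay_low_def start_low_def below_def low_paths_def path_def)
  qed
qed

lemma low_paths_shift:
  assumes "\<And>u. 0 \<le> u \<Longrightarrow> u \<le> 2 \<Longrightarrow> f u = 0"
  shows "(\<lambda>u. w u + z * f u) \<in> low_paths \<delta> \<longleftrightarrow> w \<in> low_paths \<delta>"
  using assms by (auto simp: low_paths_def)

text \<open>Along the ramp \<open>path_X\<close> grows at speed at least 2 as long as near chords
  dominate, so the shifts leading into \<open>{l..r}\<close> form a set of diameter at most
  \<open>(r - l) / 2\<close>. The ramp starts at 2: it leaves the low event alone, and the bound for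
  its inverse weight involves only \<open>B 7 - B 2\<close>, which is independent of
  \<open>F 2\<close> and contributes \<open>2 * exp (5/2)\<close>.\<close>

lemma near_density:
  assumes lr: "l \<le> r"
  shows "(\<integral>\<^sup>+\<omega>. indicator (low_paths \<delta>) (path \<omega>) * (indicator {w. far_sup w \<le> near_sup w} (path \<omega>) * indicator {l..r} (path_X (path \<omega>))) \<partial>M)
    \<le> ennreal ((r - l) * exp (5/2)) * emeasure M (stay_low 1 \<delta>)"
proof -
  have b27: "0 \<le> (2 :: real)" "(2 :: real) < 7" by auto
  note [measurable] = measurable_B[of 2] measurable_B[of 7]
  define G where "G w = (indicator (low_paths \<delta>) w * (indicator {w. far_sup w \<le> near_sup w} w * indicator {l..r} (path_X w)) :: ennreal)" for w
  have near[measurable]: "{w. far_sup w \<le> near_sup w} \<in> sets path_space"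
  proof -
    have "{w \<in> space path_space. far_sup w \<le> near_sup w} \<in> sets path_space" by measurable
    then show ?thesis by (simp add: space_PiM)
  qed
  have G[measurable]: "G \<in> borel_measurable path_space" unfolding G_def[abs_def] by measurable
  have slow: "stay_low 1 \<delta> \<in> sets (F 2)" using stay_low_measurable[of 1 \<delta>] by simp
  have slowM[measurable]: "stay_low 1 \<delta> \<in> sets M" by (rule F_sets_M[OF slow])
  have "(\<integral>\<^sup>+\<omega>. G (path \<omega>) \<partial>M) \<le> (\<integral>\<^sup>+\<omega>. ennreal ((r - l) / 2) * indicator (stay_low 1 \<delta>) \<omega> * ennreal (exp \<bar>B 7 \<omega> - B 2 \<omega>\<bar>) \<partial>M)"
  proof (rule average_shifts[where f="ramp 2 7"])
    show "ramp 2 7 \<in> borel_measurable borel" by (rule borel_measurable_continuous_onI[OF continuous_ramp])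
    show "AE \<omega> in M. (\<integral>\<^sup>+z. G (\<lambda>u. path \<omega> u + z * ramp 2 7 u) * indicator {0..1} z \<partial>lborel) \<le> ennreal ((r - l) / 2) * indicator (stay_low 1 \<delta>) \<omega>"
      using AE_majorized AE_space
    proof eventually_elim
      case (elim \<omega>)
      have maj: "majorized (\<lambda>u. path \<omega> u + z * ramp 2 7 u)" for z
        by (rule majorized_shift[where C=5]) (use elim in \<open>auto simp: majorized_path ramp_def\<close>)
      let ?S = "{z\<in>{0..1}. far_sup (\<lambda>u. path \<omega> u + z * ramp 2 7 u) \<le> near_sup (\<lambda>u. path \<omega> u + z * ramp 2 7 u) \<and>
        path_X (\<lambda>u. path \<omega> u + z * ramp 2 7 u) \<in> {l..r}}"
      have sh[measurable]: "(\<lambda>z u. path \<omega> u + z * ramp 2 7 u) \<in> measurable borel path_space"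
        by (intro measurable_abs_UNIV) measurable
      have S[measurable]: "?S \<in> sets lborel"
      proof -
        have [measurable]: "(\<lambda>z. far_sup (\<lambda>u. path \<omega> u + z * ramp 2 7 u)) \<in> borel_measurable borel"
          "(\<lambda>z. near_sup (\<lambda>u. path \<omega> u + z * ramp 2 7 u)) \<in> borel_measurable borel"
          "(\<lambda>z. path_X (\<lambda>u. path \<omega> u + z * ramp 2 7 u)) \<in> borel_measurable borel"
          by (rule measurable_compose[OF sh], measurable)+
        show ?thesis by measurable
      qed
      have "(\<integral>\<^sup>+z. G (\<lambda>u. path \<omega> u + z * ramp 2 7 u) * indicator {0..1} z \<partial>lborel) =
        (\<integral>\<^sup>+z. indicator (stay_low 1 \<delta>) \<omega> * indicator ?S z \<partial>lborel)"
      proof (rule nn_integral_cong)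
        fix z :: real
        have "(\<lambda>u. path \<omega> u + z * ramp 2 7 u) \<in> low_paths \<delta> \<longleftrightarrow> \<omega> \<in> stay_low 1 \<delta>"
          using low_paths_shift[of "ramp 2 7" "path \<omega>" z \<delta>] path_low_iff[OF elim(2)] by (simp add: ramp_def)
        then show "G (\<lambda>u. path \<omega> u + z * ramp 2 7 u) * indicator {0..1} z = indicator (stay_low 1 \<delta>) \<omega> * indicator ?S z"
          by (auto simp: G_def split: split_indicator)
      qed
      also have "\<dots> = indicator (stay_low 1 \<delta>) \<omega> * emeasure lborel ?S" by (rule nn_integral_cmult_indicator[OF S])
      also have "\<dots> \<le> indicator (stay_low 1 \<delta>) \<omega> * ennreal ((r - l) / 2)"
      proof (intro mult_left_mono emeasure_le_diameter)
        fix x y assume xy: "x \<in> ?S" "y \<in> ?S" "x \<le> y"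
        then show "y - x \<le> (r - l) / 2"
          using path_X_ramp[OF maj[of x] maj[of y] _ xy(3)] by auto
      qed (use lr in auto)
      finally show ?case by (simp add: mult.commute)
    qed
  next
    fix z :: real assume "0 \<le> z" "z \<le> 1"
    then show "(\<integral>\<^sup>+\<omega>. G (path \<omega>) \<partial>M) \<le> (\<integral>\<^sup>+\<omega>. G (\<lambda>u. path \<omega> u + z * ramp 2 7 u) * ennreal (exp \<bar>B 7 \<omega> - B 2 \<omega>\<bar>) \<partial>M)"
      by (rule unshift_ramp[OF G _ _ b27])
  qed measurable
  also have "\<dots> = ennreal ((r - l) / 2) * (\<integral>\<^sup>+\<omega>. indicator (stay_low 1 \<delta>) \<omega> * ennreal (exp \<bar>B 7 \<omega> - B 2 \<omega>\<bar>) \<partial>M)"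
    by (subst nn_integral_cmult[symmetric]) (auto simp: mult.assoc)
  also have "(\<integral>\<^sup>+\<omega>. indicator (stay_low 1 \<delta>) \<omega> * ennreal (exp \<bar>B 7 \<omega> - B 2 \<omega>\<bar>) \<partial>M) =
    emeasure M (stay_low 1 \<delta>) * (\<integral>\<^sup>+x. ennreal (normal_density 0 (sqrt (7 - 2)) x) * ennreal (exp \<bar>x\<bar>) \<partial>lborel)"
    using slow by (subst nn_integral_indep_increment[OF b27]) auto
  also have "ennreal ((r - l) / 2) * \<dots> \<le> ennreal ((r - l) / 2) * (emeasure M (stay_low 1 \<delta>) * ennreal (2 * exp ((sqrt (7 - 2))\<^sup>2 / 2)))"
    by (intro mult_left_mono nn_integral_normal_exp_abs) auto
  also have "\<dots> = (ennreal ((r - l) / 2) * ennreal (2 * exp (5/2))) * emeasure M (stay_low 1 \<delta>)"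
    by (simp add: mult_ac)
  also have "ennreal ((r - l) / 2) * ennreal (2 * exp (5/2)) = ennreal ((r - l) * exp (5/2))"
    using lr by (simp add: ennreal_mult[symmetric])
  finally show ?thesis unfolding G_def .
qed

text \<open>Here the tent moves \<open>path_X\<close> at speed exactly 1. The increments over
  \<open>[5, 6]\<close> and \<open>[6, 7]\<close> are integrated out one after the other, each
  contributing \<open>2 * exp (1/2)\<close>, which makes \<open>4 * exp 1\<close>.\<close>

lemma far_density:
  assumes lr: "l \<le> r"
  shows "(\<integral>\<^sup>+\<omega>. indicator (low_paths \<delta>) (path \<omega>) * (indicator {w. near_sup w \<le> far_sup w} (path \<omega>) * indicator {l..r} (path_X (path \<omega>))) \<partial>M)
    \<le> ennreal ((r - l) * (4 * exp 1)) * emeasure M (stay_low 1 \<delta>)"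
proof -
  have b56: "0 \<le> (5 :: real)" "(5 :: real) < 6" and b67: "0 \<le> (6 :: real)" "(6 :: real) < 7" by auto
  note [measurable] = measurable_B[of 5] measurable_B[of 6] measurable_B[of 7]
  define G where "G w = (indicator (low_paths \<delta>) w * (indicator {w. near_sup w \<le> far_sup w} w * indicator {l..r} (path_X w)) :: ennreal)" for w
  have near[measurable]: "{w. near_sup w \<le> far_sup w} \<in> sets path_space"
  proof -
    have "{w \<in> space path_space. near_sup w \<le> far_sup w} \<in> sets path_space" by measurable
    then show ?thesis by (simp add: space_PiM)
  qed
  have G[measurable]: "G \<in> borel_measurable path_space" unfolding G_def[abs_def] by measurable
  have slow: "stay_low 1 \<delta> \<in> sets (F 2)" using stay_low_measurable[of 1 \<delta>] by simp
  have slowM[measurable]: "stay_low 1 \<delta> \<in> sets M" by (rule F_sets_M[OF slow])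
  define e where "e \<omega> = ennreal (exp (\<bar>B 6 \<omega> - B 5 \<omega>\<bar> + \<bar>B 7 \<omega> - B 6 \<omega>\<bar>))" for \<omega>
  have em[measurable]: "e \<in> borel_measurable M" unfolding e_def[abs_def] by measurable
  have "(\<integral>\<^sup>+\<omega>. G (path \<omega>) \<partial>M) \<le> (\<integral>\<^sup>+\<omega>. ennreal (r - l) * indicator (stay_low 1 \<delta>) \<omega> * e \<omega> \<partial>M)"
  proof (rule average_shifts[where f=tent])
    show "tent \<in> borel_measurable borel" by (rule borel_measurable_continuous_onI[OF continuous_tent])
    show "AE \<omega> in M. (\<integral>\<^sup>+z. G (\<lambda>u. path \<omega> u + z * tent u) * indicator {0..1} z \<partial>lborel) \<le> ennreal (r - l) * indicator (stay_low 1 \<delta>) \<omega>"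
      using AE_space
    proof eventually_elim
      case (elim \<omega>)
      let ?S = "{z\<in>{0..1}. near_sup (\<lambda>u. path \<omega> u + z * tent u) \<le> far_sup (\<lambda>u. path \<omega> u + z * tent u) \<and>
        path_X (\<lambda>u. path \<omega> u + z * tent u) \<in> {l..r}}"
      have sh[measurable]: "(\<lambda>z u. path \<omega> u + z * tent u) \<in> measurable borel path_space"
        by (intro measurable_abs_UNIV) measurable
      have S[measurable]: "?S \<in> sets lborel"
      proof -
        have [measurable]: "(\<lambda>z. far_sup (\<lambda>u. path \<omega> u + z * tent u)) \<in> borel_measurable borel"
          "(\<lambda>z. near_sup (\<lambda>u. path \<omega> u + z * tent u)) \<in> borel_measurable borel"
          "(\<lambda>z. path_X (\<lambda>u. path \<omega> u + z * tent u)) \<in> borel_measurable borel"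
          by (rule measurable_compose[OF sh], measurable)+
        show ?thesis by measurable
      qed
      have "(\<integral>\<^sup>+z. G (\<lambda>u. path \<omega> u + z * tent u) * indicator {0..1} z \<partial>lborel) =
        (\<integral>\<^sup>+z. indicator (stay_low 1 \<delta>) \<omega> * indicator ?S z \<partial>lborel)"
      proof (rule nn_integral_cong)
        fix z :: real
        have "(\<lambda>u. path \<omega> u + z * tent u) \<in> low_paths \<delta> \<longleftrightarrow> \<omega> \<in> stay_low 1 \<delta>"
          using low_paths_shift[of tent "path \<omega>" z \<delta>] path_low_iff[OF elim] by (simp add: tent_def ramp_def)
        then show "G (\<lambda>u. path \<omega> u + z * tent u) * indicator {0..1} z = indicator (stay_low 1 \<delta>) \<omega> * indicator ?S z"
          by (auto simp: G_def split: split_indicator)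
      qed
      also have "\<dots> = indicator (stay_low 1 \<delta>) \<omega> * emeasure lborel ?S" by (rule nn_integral_cmult_indicator[OF S])
      also have "\<dots> \<le> indicator (stay_low 1 \<delta>) \<omega> * ennreal (r - l)"
      proof (intro mult_left_mono emeasure_le_diameter)
        fix x y assume xy: "x \<in> ?S" "y \<in> ?S" "x \<le> y"
        then show "y - x \<le> r - l"
          using path_X_tent[of "path \<omega>" x] path_X_tent[of "path \<omega>" y] by auto
      qed (use lr in auto)
      finally show ?case by (simp add: mult.commute)
    qed
  next
    fix z :: real assume "0 \<le> z" "z \<le> 1"
    then show "(\<integral>\<^sup>+\<omega>. G (path \<omega>) \<partial>M) \<le> (\<integral>\<^sup>+\<omega>. G (\<lambda>u. path \<omega> u + z * tent u) * e \<omega> \<partial>M)"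
      unfolding e_def by (rule unshift_tent[OF G])
  qed measurable
  also have "\<dots> = ennreal (r - l) * (\<integral>\<^sup>+\<omega>. (indicator (stay_low 1 \<delta>) \<omega> * ennreal (exp \<bar>B 6 \<omega> - B 5 \<omega>\<bar>)) * ennreal (exp \<bar>B 7 \<omega> - B 6 \<omega>\<bar>) \<partial>M)"
    by (subst nn_integral_cmult[symmetric]) (auto simp: mult.assoc e_def exp_add ennreal_mult)
  also have "(\<integral>\<^sup>+\<omega>. (indicator (stay_low 1 \<delta>) \<omega> * ennreal (exp \<bar>B 6 \<omega> - B 5 \<omega>\<bar>)) * ennreal (exp \<bar>B 7 \<omega> - B 6 \<omega>\<bar>) \<partial>M) =
    (\<integral>\<^sup>+\<omega>. indicator (stay_low 1 \<delta>) \<omega> * ennreal (exp \<bar>B 6 \<omega> - B 5 \<omega>\<bar>) \<partial>M) * (\<integral>\<^sup>+x. ennreal (normal_density 0 (sqrt (7 - 6)) x) * ennreal (exp \<bar>x\<bar>) \<partial>lborel)"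
  proof (rule nn_integral_indep_increment[OF b67])
    have [measurable]: "stay_low 1 \<delta> \<in> sets (F 6)" using slow F_mono[of 2 6] by auto
    have [measurable]: "B 5 \<in> borel_measurable (F 6)" "B 6 \<in> borel_measurable (F 6)" by (auto intro: measurable_B_F)
    show "(\<lambda>\<omega>. indicator (stay_low 1 \<delta>) \<omega> * ennreal (exp \<bar>B 6 \<omega> - B 5 \<omega>\<bar>)) \<in> borel_measurable (F 6)" by measurable
  qed measurable
  also have "(\<integral>\<^sup>+\<omega>. indicator (stay_low 1 \<delta>) \<omega> * ennreal (exp \<bar>B 6 \<omega> - B 5 \<omega>\<bar>) \<partial>M) =
    (\<integral>\<^sup>+\<omega>. indicator (stay_low 1 \<delta>) \<omega> \<partial>M) * (\<integral>\<^sup>+x. ennreal (normal_density 0 (sqrt (6 - 5)) x) * ennreal (exp \<bar>x\<bar>) \<partial>lborel)"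
  proof (rule nn_integral_indep_increment[OF b56])
    have [measurable]: "stay_low 1 \<delta> \<in> sets (F 5)" using slow F_mono[of 2 5] by auto
    show "indicator (stay_low 1 \<delta>) \<in> borel_measurable (F 5)" by measurable
  qed measurable
  also have "(\<integral>\<^sup>+\<omega>. indicator (stay_low 1 \<delta>) \<omega> \<partial>M) = emeasure M (stay_low 1 \<delta>)" by simp
  also have "ennreal (r - l) * (emeasure M (stay_low 1 \<delta>) * (\<integral>\<^sup>+x. ennreal (normal_density 0 (sqrt (6 - 5)) x) * ennreal (exp \<bar>x\<bar>) \<partial>lborel) *
      (\<integral>\<^sup>+x. ennreal (normal_density 0 (sqrt (7 - 6)) x) * ennreal (exp \<bar>x\<bar>) \<partial>lborel)) \<le>
    ennreal (r - l) * (emeasure M (stay_low 1 \<delta>) * ennreal (2 * exp ((sqrt (6 - 5))\<^sup>2 / 2)) * ennreal (2 * exp ((sqrt (7 - 6))\<^sup>2 / 2)))"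
    by (intro mult_left_mono mult_mono nn_integral_normal_exp_abs) auto
  also have "\<dots> = (ennreal (r - l) * (ennreal (2 * exp (1/2)) * ennreal (2 * exp (1/2)))) * emeasure M (stay_low 1 \<delta>)"
    by (simp add: mult_ac)
  also have "ennreal (r - l) * (ennreal (2 * exp (1/2)) * ennreal (2 * exp (1/2))) = ennreal ((r - l) * (4 * exp 1))"
  proof -
    have "2 * exp (1/2) * (2 * exp (1/2)) = (4 * exp 1 :: real)" by (simp add: exp_add[symmetric])
    then have "ennreal (2 * exp (1/2)) * ennreal (2 * exp (1/2)) = ennreal (4 * exp 1)"
      by (subst ennreal_mult[symmetric]) auto
    moreover have "ennreal (r - l) * ennreal (4 * exp 1) = ennreal ((r - l) * (4 * exp 1))"
      using lr by (subst ennreal_mult[symmetric]) auto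
    ultimately show ?thesis by simp
  qed
  finally show ?thesis unfolding G_def .
qed

lemma stay_low_density:
  assumes lr: "l \<le> r"
  shows "emeasure M {\<omega>\<in>stay_low 1 \<delta>. path_X (path \<omega>) \<in> {l..r}} \<le>
    ennreal ((r - l) * (exp (5/2) + 4 * exp 1)) * emeasure M (stay_low 1 \<delta>)"
proof -
  have slowM[measurable]: "stay_low 1 \<delta> \<in> sets M" using F_sets_M[OF stay_low_measurable[of 1 \<delta>]] by simp
  have near[measurable]: "{w. far_sup w \<le> near_sup w} \<in> sets path_space" "{w. near_sup w \<le> far_sup w} \<in> sets path_space"
  proof -
    have "{w \<in> space path_space. far_sup w \<le> near_sup w} \<in> sets path_space" "{w \<in> space path_space. near_sup w \<le> far_sup w} \<in> sets path_space" by measurable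
    then show "{w. far_sup w \<le> near_sup w} \<in> sets path_space" "{w. near_sup w \<le> far_sup w} \<in> sets path_space" by (simp_all add: space_PiM)
  qed
  have "emeasure M {\<omega>\<in>stay_low 1 \<delta>. path_X (path \<omega>) \<in> {l..r}} = (\<integral>\<^sup>+\<omega>. indicator {\<omega>\<in>stay_low 1 \<delta>. path_X (path \<omega>) \<in> {l..r}} \<omega> \<partial>M)"
    by (rule nn_integral_indicator[symmetric]) measurable
  also have "\<dots> \<le> (\<integral>\<^sup>+\<omega>. indicator (low_paths \<delta>) (path \<omega>) * (indicator {w. far_sup w \<le> near_sup w} (path \<omega>) * indicator {l..r} (path_X (path \<omega>))) +
    indicator (low_paths \<delta>) (path \<omega>) * (indicator {w. near_sup w \<le> far_sup w} (path \<omega>) * indicator {l..r} (path_X (path \<omega>))) \<partial>M)"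
  proof (rule nn_integral_mono)
    fix \<omega> assume "\<omega> \<in> space M"
    then show "indicator {\<omega>\<in>stay_low 1 \<delta>. path_X (path \<omega>) \<in> {l..r}} \<omega> \<le> (indicator (low_paths \<delta>) (path \<omega>) * (indicator {w. far_sup w \<le> near_sup w} (path \<omega>) * indicator {l..r} (path_X (path \<omega>))) +
      indicator (low_paths \<delta>) (path \<omega>) * (indicator {w. near_sup w \<le> far_sup w} (path \<omega>) * indicator {l..r} (path_X (path \<omega>))) :: ennreal)"
      using path_low_iff[of \<omega> \<delta>] linear[of "far_sup (path \<omega>)" "near_sup (path \<omega>)"] by (auto split: split_indicator)
  qed
  also have "\<dots> = (\<integral>\<^sup>+\<omega>. indicator (low_paths \<delta>) (path \<omega>) * (indicator {w. far_sup w \<le> near_sup w} (path \<omega>) * indicator {l..r} (path_X (path \<omega>))) \<partial>M) +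
    (\<integral>\<^sup>+\<omega>. indicator (low_paths \<delta>) (path \<omega>) * (indicator {w. near_sup w \<le> far_sup w} (path \<omega>) * indicator {l..r} (path_X (path \<omega>))) \<partial>M)"
    by (rule nn_integral_add) measurable
  also have "\<dots> \<le> ennreal ((r - l) * exp (5/2)) * emeasure M (stay_low 1 \<delta>) + ennreal ((r - l) * (4 * exp 1)) * emeasure M (stay_low 1 \<delta>)"
    by (intro add_mono near_density far_density lr)
  also have "\<dots> = ennreal ((r - l) * (exp (5/2) + 4 * exp 1)) * emeasure M (stay_low 1 \<delta>)"
    using lr by (simp add: distrib_right[symmetric] ennreal_plus[symmetric] distrib_left del: ennreal_plus)
  finally show ?thesis .
qed

end

section \<open>Densities\<close>

text \<open>A Borel subset of a bounded interval is covered, up to a small excess of length, by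
  countably many nonoverlapping intervals, and the bound is summed over them.\<close>

lemma emeasure_le_lborel:
  fixes \<nu> :: "real measure"
  assumes sets[measurable_cong, simp]: "sets \<nu> = sets borel" and K: "0 \<le> K"
    and bound: "\<And>l r. l \<le> r \<Longrightarrow> emeasure \<nu> {l..r} \<le> ennreal (K * (r - l))"
    and D[measurable]: "D \<in> sets borel" and Dab: "D \<subseteq> {a..b}"
  shows "emeasure \<nu> D \<le> ennreal K * emeasure lborel D"
proof -
  have fin: "emeasure lborel D < \<infinity>"
  proof -
    have "emeasure lborel D \<le> emeasure lborel {a..b}" using Dab by (intro emeasure_mono) auto
    also have "\<dots> < \<infinity>" by (cases "a \<le> b") auto
    finally show ?thesis .
  qed
  have lm: "D \<in> lmeasurable" using fin by (intro fmeasurableI) auto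
  have mD: "emeasure lborel D = ennreal (measure lborel D)" using fin by (intro emeasure_eq_ennreal_measure) auto
  have approx: "emeasure \<nu> D \<le> ennreal K * emeasure lborel D + ennreal (K * e)" if e: "0 < e" for e
  proof -
    obtain \<D> where \<D>: "countable \<D>" "\<And>C. C \<in> \<D> \<Longrightarrow> C \<subseteq> cbox a b \<and> C \<noteq> {} \<and> (\<exists>c d. C = cbox c d)"
      "pairwise (\<lambda>A B. interior A \<inter> interior B = {}) \<D>" "D \<subseteq> \<Union>\<D>" "\<Union>\<D> \<in> lmeasurable"
      "measure lebesgue (\<Union>\<D>) \<le> measure lebesgue D + e"
    proof -
      have Dc: "D \<subseteq> cbox a b" using Dab by (simp add: cbox_interval)
      show thesis
        by (rule measurable_outer_intervals_bounded[OF lm Dc e], rule that) assumption+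
    qed
    have iv: "\<exists>c d. c \<le> d \<and> C = {c..d} \<and> interior C = {c<..<d}" if CD: "C \<in> \<D>" for C
    proof -
      obtain c d where "C = {c..d}" "C \<noteq> {}" using \<D>(2)[OF CD] by (auto simp: cbox_interval)
      then show ?thesis by (intro exI[of _ c] exI[of _ d]) auto
    qed
    have Cm[measurable]: "C \<in> sets borel" "interior C \<in> sets borel" if "C \<in> \<D>" for C using iv[OF that] by auto
    have Um: "\<Union>\<D> \<in> sets borel" using \<D>(1) Cm by (intro sets.countable_Union) auto
    have Im: "(\<Union>C\<in>\<D>. interior C) \<in> sets borel" using \<D>(1) Cm by (intro sets.countable_UN') auto
    have dis: "disjoint_family_on interior \<D>"
      using \<D>(3) by (auto simp: disjoint_family_on_def pairwise_def)
    \<comment> \<open>The intervals may share endpoints. Points are null by the bound with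
      \<open>l = r\<close>, and without its endpoints the family is disjoint.\<close>
    have bd: "(\<Union>C\<in>\<D>. C - interior C) \<in> null_sets \<nu>"
    proof (rule null_sets_UN'[OF \<D>(1)])
      fix C assume "C \<in> \<D>"
      then obtain c d where cd: "c \<le> d" "C = {c..d}" "interior C = {c<..<d}" using iv by blast
      have pt: "{x} \<in> null_sets \<nu>" for x using bound[of x x] by (intro null_setsI) auto
      have "C - interior C = {c} \<union> {d}" using cd by auto
      then show "C - interior C \<in> null_sets \<nu>" using null_sets.Un[OF pt[of c] pt[of d]] by simp
    qed
    have "emeasure \<nu> D \<le> emeasure \<nu> ((\<Union>C\<in>\<D>. interior C) \<union> (\<Union>C\<in>\<D>. C - interior C))"
      using \<D>(4) Im null_setsD2[OF bd] by (intro emeasure_mono) auto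
    also have "\<dots> = emeasure \<nu> (\<Union>C\<in>\<D>. interior C)"
      using Im by (intro emeasure_Un_null_set bd) auto
    also have "\<dots> = (\<integral>\<^sup>+C. emeasure \<nu> (interior C) \<partial>count_space \<D>)"
      using \<D>(1) Cm dis by (intro emeasure_UN_countable) auto
    also have "\<dots> \<le> (\<integral>\<^sup>+C. ennreal K * emeasure lborel (interior C) \<partial>count_space \<D>)"
    proof (rule nn_integral_mono)
      fix C assume "C \<in> space (count_space \<D>)"
      then have "C \<in> \<D>" by simp
      then obtain c d where cd: "c \<le> d" "C = {c..d}" "interior C = {c<..<d}" using iv by blast
      have "emeasure \<nu> (interior C) \<le> emeasure \<nu> {c..d}" unfolding cd(3) by (intro emeasure_mono) auto
      also have "\<dots> \<le> ennreal (K * (d - c))" by (rule bound[OF cd(1)])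
      also have "\<dots> = ennreal K * emeasure lborel (interior C)" unfolding cd(3) using cd(1) K by (simp add: ennreal_mult)
      finally show "emeasure \<nu> (interior C) \<le> ennreal K * emeasure lborel (interior C)" .
    qed
    also have "\<dots> = ennreal K * (\<integral>\<^sup>+C. emeasure lborel (interior C) \<partial>count_space \<D>)"
      by (rule nn_integral_cmult) auto
    also have "(\<integral>\<^sup>+C. emeasure lborel (interior C) \<partial>count_space \<D>) = emeasure lborel (\<Union>C\<in>\<D>. interior C)"
      using \<D>(1) Cm dis by (intro emeasure_UN_countable[symmetric]) auto
    also have "ennreal K * \<dots> \<le> ennreal K * emeasure lborel (\<Union>\<D>)"
      using Um interior_subset by (intro mult_left_mono emeasure_mono) fastforce+
    also have "emeasure lborel (\<Union>\<D>) = ennreal (measure lebesgue (\<Union>\<D>))"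
      using \<D>(5) Um emeasure_eq_measure2[OF \<D>(5)] by simp
    also have "ennreal K * \<dots> \<le> ennreal K * ennreal (measure lebesgue D + e)"
      using \<D>(6) by (intro mult_left_mono ennreal_leI) auto
    also have "\<dots> = ennreal K * emeasure lborel D + ennreal (K * e)"
      unfolding mD using K e by (simp add: ennreal_mult distrib_left)
    finally show ?thesis .
  qed
  show ?thesis
  proof (rule ennreal_le_epsilon)
    fix e :: real assume e: "0 < e"
    \<comment> \<open>Dividing by \<open>K + 1\<close> instead of \<open>K\<close> includes the case
      \<open>K = 0\<close>.\<close>
    have "emeasure \<nu> D \<le> ennreal K * emeasure lborel D + ennreal (K * (e / (K + 1)))" using K e by (intro approx) auto
    also have "\<dots> \<le> ennreal K * emeasure lborel D + ennreal e"
      using K e by (intro add_left_mono ennreal_leI) (simp add: field_simps)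
    finally show "emeasure \<nu> D \<le> ennreal K * emeasure lborel D + ennreal e" .
  qed
qed

lemma sets_gen_sigma_single: "sets (gen_sigma M X {s}) = {X s -` D \<inter> space M | D. D \<in> sets borel}"
proof -
  have "sets (gen_sigma M X {s}) = sets (vimage_algebra (space M) (X s) borel)"
    unfolding sets_gen_sigma sets_vimage_algebra by simp
  then show ?thesis by (simp add: sets_vimage_algebra2)
qed

text \<open>Extension from indicators to nonnegative functions by monotone limits. It is meant for a
  conditional probability in the role of \<phi>, when the inequality is known only on the sets of
  \<open>T\<close>.\<close>

lemma (in finite_measure) nn_integral_domination_subalgebra:
  fixes f g \<phi> :: "'a \<Rightarrow> ennreal"
  assumes T: "subalgebra M T" and f[measurable]: "f \<in> borel_measurable M" and g[measurable]: "g \<in> borel_measurable M"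
    and le: "\<And>E. E \<in> sets T \<Longrightarrow> (\<integral>\<^sup>+\<omega>. f \<omega> * indicator E \<omega> \<partial>M) \<le> (\<integral>\<^sup>+\<omega>. g \<omega> * indicator E \<omega> \<partial>M)"
    and \<phi>: "\<phi> \<in> borel_measurable T"
  shows "(\<integral>\<^sup>+\<omega>. f \<omega> * \<phi> \<omega> \<partial>M) \<le> (\<integral>\<^sup>+\<omega>. g \<omega> * \<phi> \<omega> \<partial>M)"
  using \<phi>
proof (induction rule: borel_measurable_induct)
  case (cong h k)
  have "space T = space M" using T by (simp add: subalgebra_def)
  then have "(\<integral>\<^sup>+\<omega>. f \<omega> * h \<omega> \<partial>M) = (\<integral>\<^sup>+\<omega>. f \<omega> * k \<omega> \<partial>M)" "(\<integral>\<^sup>+\<omega>. g \<omega> * h \<omega> \<partial>M) = (\<integral>\<^sup>+\<omega>. g \<omega> * k \<omega> \<partial>M)"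
    using cong(3) by (auto intro!: nn_integral_cong)
  then show ?case using cong by simp
next
  case (set A)
  then show ?case by (rule le)
next
  case (mult u c)
  have [measurable]: "u \<in> borel_measurable M" by (rule measurable_from_subalg[OF T mult(2)])
  have "(\<integral>\<^sup>+\<omega>. h \<omega> * (c * u \<omega>) \<partial>M) = c * (\<integral>\<^sup>+\<omega>. h \<omega> * u \<omega> \<partial>M)" if [measurable]: "h \<in> borel_measurable M" for h :: "'a \<Rightarrow> ennreal"
    by (subst nn_integral_cmult[symmetric]) (auto simp: mult_ac)
  then show ?case using mult(4) by (simp add: mult_left_mono)
next
  case (add u v)
  have [measurable]: "u \<in> borel_measurable M" "v \<in> borel_measurable M"
    using measurable_from_subalg[OF T] add by auto
  show ?case using add by (simp add: distrib_left nn_integral_add add_mono)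
next
  case (seq U)
  have Um[measurable]: "U i \<in> borel_measurable M" for i using measurable_from_subalg[OF T seq(1)] .
  have eq: "(\<integral>\<^sup>+\<omega>. h \<omega> * (SUP i. U i) \<omega> \<partial>M) = (SUP i. \<integral>\<^sup>+\<omega>. h \<omega> * U i \<omega> \<partial>M)" if [measurable]: "h \<in> borel_measurable M" for h :: "'a \<Rightarrow> ennreal"
  proof -
    have "(\<integral>\<^sup>+\<omega>. h \<omega> * (SUP i. U i) \<omega> \<partial>M) = (\<integral>\<^sup>+\<omega>. (SUP i. h \<omega> * U i \<omega>) \<partial>M)"
      by (simp add: SUP_apply SUP_mult_left_ennreal image_comp)
    also have "\<dots> = (SUP i. \<integral>\<^sup>+\<omega>. h \<omega> * U i \<omega> \<partial>M)"
      by (rule nn_integral_monotone_convergence_SUP)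
        (use \<open>incseq U\<close> in \<open>auto simp: incseq_def le_fun_def intro!: mult_left_mono\<close>)
    finally show ?thesis .
  qed
  show ?case unfolding eq[OF f] eq[OF g] using seq.IH by (intro SUP_mono) auto
qed

context brownian
begin

text \<open>On an event of fixed positive probability inside \<open>low_event (1/64)\<close> a tent
  leaves the majorant at 6 unchanged, so \<open>path_X\<close> moves at speed exactly 1 and sweeps
  over all of \<open>{1..3/2}\<close>. The weights of these shifts are bounded, hence the law of
  \<open>X 6\<close> dominates a multiple of Lebesgue measure there.\<close>

lemma path_X_density_lower:
  obtains c where "0 < c" "\<And>D. D \<in> sets borel \<Longrightarrow> D \<subseteq> {1..3/2} \<Longrightarrow>
    ennreal c * emeasure lborel D \<le> emeasure M {\<omega>\<in>space M. path_X (path \<omega>) \<in> D}"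
proof -
  obtain c0 where c0: "0 < c0" "\<And>\<delta>. 0 < \<delta> \<Longrightarrow> \<delta> \<le> 1/64 \<Longrightarrow> \<exists>E\<in>sets M. E \<subseteq> low_event \<delta> \<and> c0 * \<delta> ^ 8 \<le> prob E"
    by (rule low_event_bound) blast
  obtain E where E[measurable]: "E \<in> sets M" and El: "E \<subseteq> low_event (1/64)" and Ep: "c0 * (1/64) ^ 8 \<le> prob E"
    using c0(2)[of "1/64"] by auto
  have "0 < c0 * (1/64) ^ 8" using c0(1) by simp
  then have pE: "0 < prob E" using Ep by linarith
  have "ennreal (prob E / exp 2) * emeasure lborel D \<le> emeasure M {\<omega>\<in>space M. path_X (path \<omega>) \<in> D}"
    if D[measurable]: "D \<in> sets borel" and D1: "D \<subseteq> {1..3/2}" for D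
  proof -
    \<comment> \<open>The cutoffs bound the Cameron-Martin weights: for
      \<open>\<bar>z\<bar> \<le> 1/2\<close> and increments of size at most 2 each of the two
      weights is at most \<open>exp 1\<close>.\<close>
    define G where "G w = (indicator D (path_X w) * (indicator {x. \<bar>x\<bar> \<le> 2} (w 6 - w 5) * indicator {x. \<bar>x\<bar> \<le> 2} (w 7 - w 6)) :: ennreal)" for w
    have G[measurable]: "G \<in> borel_measurable path_space" unfolding G_def[abs_def] by measurable
    let ?P = "emeasure M {\<omega>\<in>space M. path_X (path \<omega>) \<in> D}"
    have up: "(\<integral>\<^sup>+\<omega>. G (\<lambda>u. path \<omega> u + z * tent u) \<partial>M) \<le> ennreal (exp 2) * ?P" if z: "z \<in> {-1/2..1/2}" for z
    proof -
      have w: "ramp_weight p (p + 1) y w \<le> exp 1" if "\<bar>w (p + 1) - w p\<bar> \<le> 2" "\<bar>y\<bar> \<le> 1/2" for p y w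
      proof -
        have "y * (w (p + 1) - w p) \<le> \<bar>y\<bar> * \<bar>w (p + 1) - w p\<bar>" by (metis abs_ge_self abs_mult)
        also have "\<dots> \<le> 1/2 * 2" using that by (intro mult_mono) auto
        finally have "y * (w (p + 1) - w p) \<le> 1" by simp
        moreover have "0 \<le> y\<^sup>2 * (p + 1 - p) / 2" by simp
        ultimately have "y * (w (p + 1) - w p) - y\<^sup>2 * (p + 1 - p) / 2 \<le> 1" by linarith
        then show ?thesis by (simp add: ramp_weight_def)
      qed
      have "(\<integral>\<^sup>+\<omega>. G (\<lambda>u. path \<omega> u + z * tent u) \<partial>M) =
        (\<integral>\<^sup>+\<omega>. G (path \<omega>) * (ennreal (ramp_weight 5 6 z (path \<omega>)) * ennreal (ramp_weight 6 7 (- z) (path \<omega>))) \<partial>M)"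
        by (rule Cameron_Martin_tent) measurable
      also have "\<dots> \<le> (\<integral>\<^sup>+\<omega>. ennreal (exp 2) * indicator {\<omega>\<in>space M. path_X (path \<omega>) \<in> D} \<omega> \<partial>M)"
      proof (rule nn_integral_mono)
        fix \<omega> assume sp: "\<omega> \<in> space M"
        show "G (path \<omega>) * (ennreal (ramp_weight 5 6 z (path \<omega>)) * ennreal (ramp_weight 6 7 (- z) (path \<omega>))) \<le>
          ennreal (exp 2) * indicator {\<omega>\<in>space M. path_X (path \<omega>) \<in> D} \<omega>"
        proof (cases "G (path \<omega>) = 0")
          case False
          then have g: "path_X (path \<omega>) \<in> D" "\<bar>path \<omega> 6 - path \<omega> 5\<bar> \<le> 2" "\<bar>path \<omega> 7 - path \<omega> 6\<bar> \<le> 2"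
            by (auto simp: G_def split: split_indicator_asm)
          have "ramp_weight 5 6 z (path \<omega>) \<le> exp 1" "ramp_weight 6 7 (- z) (path \<omega>) \<le> exp 1"
            using w[of "path \<omega>" 5 z] w[of "path \<omega>" 6 "- z"] g z by (auto simp: abs_le_iff)
          then have "ennreal (ramp_weight 5 6 z (path \<omega>)) * ennreal (ramp_weight 6 7 (- z) (path \<omega>)) \<le> ennreal (exp 1) * ennreal (exp 1)"
            by (intro mult_mono ennreal_leI) auto
          also have "\<dots> = ennreal (exp 2)" by (simp add: ennreal_mult[symmetric] exp_add[symmetric])
          finally show ?thesis using g sp by (simp add: G_def)
        qed simp
      qed
      also have "\<dots> = ennreal (exp 2) * ?P" by (rule nn_integral_cmult_indicator) measurable
      finally show ?thesis .
    qed
    have "emeasure lborel D * emeasure M E = (\<integral>\<^sup>+\<omega>. emeasure lborel D * indicator E \<omega> \<partial>M)"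
      by (rule nn_integral_cmult_indicator[symmetric]) measurable
    also have "\<dots> \<le> (\<integral>\<^sup>+\<omega>. 1 * (\<integral>\<^sup>+z. G (\<lambda>u. path \<omega> u + z * tent u) * indicator {-1/2..1/2} z \<partial>lborel) \<partial>M)"
    proof (rule nn_integral_mono_AE)
      show "AE \<omega> in M. emeasure lborel D * indicator E \<omega> \<le> 1 * (\<integral>\<^sup>+z. G (\<lambda>u. path \<omega> u + z * tent u) * indicator {-1/2..1/2} z \<partial>lborel)"
        using AE_majorized AE_space
      proof eventually_elim
        case (elim \<omega>)
        show ?case
        proof (cases "\<omega> \<in> E")
          case True
          then have l: "\<omega> \<in> low_event (1/64)" using El by auto
          let ?p = "path \<omega>"
          have maj: "majorized (\<lambda>u. ?p u + z * tent u)" for z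
            by (rule majorized_shift[where C=1]) (use elim in \<open>auto simp: majorized_path tent_def ramp_def\<close>)
          have cont: "continuous_on {0..} (\<lambda>u. ?p u + z * tent u)" for z
            using continuous_path[OF elim(2)] by (intro continuous_intros continuous_tent)
          have t6: "tent 6 = 1" by (simp add: tent_def ramp_def)
          define x where "x = 2 * concave_majorant ?p 6 - ?p 6"
          have x: "x \<in> {1..3/2}"
            unfolding x_def by (rule low_path_values(3)[of "1/64"]) (use l elim in \<open>auto simp: low_event_def path_def B_zero\<close>)
          have px: "path_X (\<lambda>u. ?p u + z * tent u) = x - z" if "z \<in> {-1/2..1/2}" for z
          proof -
            have "concave_majorant (\<lambda>u. ?p u + z * tent u) 6 = concave_majorant ?p 6"
              by (rule concave_majorant_tent) (use l elim that in \<open>auto simp: low_event_def path_def B_zero\<close>)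
            then show ?thesis using path_X_eq[OF cont maj, of z] by (simp add: x_def t6)
          qed
          have "emeasure lborel D = (\<integral>\<^sup>+y. indicator D y \<partial>lborel)" by simp
          also have "\<dots> = (\<integral>\<^sup>+z. indicator D (x + (- 1) * z) \<partial>lborel)"
            by (subst nn_integral_real_affine[where c="-1" and t=x]) auto
          also have "\<dots> \<le> (\<integral>\<^sup>+z. G (\<lambda>u. ?p u + z * tent u) * indicator {-1/2..1/2} z \<partial>lborel)"
          proof (rule nn_integral_mono)
            fix z :: real
            show "indicator D (x + (- 1) * z) \<le> G (\<lambda>u. ?p u + z * tent u) * indicator {-1/2..1/2} z"
            proof (cases "x - z \<in> D")
              case True
              \<comment> \<open>Both \<open>x\<close> and \<open>x - z\<close> lie in an interval of
                length 1/2; this is what determines the range of shifts.\<close>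
              then have z: "z \<in> {-1/2..1/2}" using D1 x by auto
              \<comment> \<open>At 5, 6 and 7 the path lies in a window of length 1/8, and the tent
                moves it by at most 1/2.\<close>
              have "\<bar>?p 6 + z * tent 6 - (?p 5 + z * tent 5)\<bar> \<le> 2" "\<bar>?p 7 + z * tent 7 - (?p 6 + z * tent 6)\<bar> \<le> 2"
                using l z by (auto simp: low_event_def path_def tent_def ramp_def abs_le_iff)
              then show ?thesis using px[OF z] True z by (simp add: G_def)
            qed simp
          qed
          finally show ?thesis using True by simp
        qed simp
      qed
    qed
    also have "\<dots> = (\<integral>\<^sup>+z. (\<integral>\<^sup>+\<omega>. G (\<lambda>u. path \<omega> u + z * tent u) * 1 * indicator {-1/2..1/2} z \<partial>M) \<partial>lborel)"
      by (rule shift_swap[symmetric]) (auto intro: borel_measurable_continuous_onI continuous_tent)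
    also have "\<dots> \<le> (\<integral>\<^sup>+z. (ennreal (exp 2) * ?P) * indicator {-1/2..1/2::real} z \<partial>lborel)"
    proof (rule nn_integral_mono)
      fix z :: real
      show "(\<integral>\<^sup>+\<omega>. G (\<lambda>u. path \<omega> u + z * tent u) * 1 * indicator {-1/2..1/2} z \<partial>M) \<le> (ennreal (exp 2) * ?P) * indicator {-1/2..1/2} z"
        using up[of z] by (auto split: split_indicator)
    qed
    also have "\<dots> = ennreal (exp 2) * ?P" by (subst nn_integral_cmult_indicator) auto
    finally have *: "emeasure lborel D * ennreal (prob E) \<le> ennreal (exp 2) * ?P" by (simp add: emeasure_eq_measure)
    have 1: "ennreal (prob E / exp 2) = ennreal (1 / exp 2) * ennreal (prob E)"
      by (subst ennreal_mult[symmetric]) auto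
    have 2: "ennreal (1 / exp 2) * ennreal (exp 2) = 1"
      by (subst ennreal_mult[symmetric]) auto
    have "ennreal (prob E / exp 2) * emeasure lborel D = ennreal (1 / exp 2) * (emeasure lborel D * ennreal (prob E))"
      unfolding 1 by (simp only: mult_ac)
    also have "\<dots> \<le> ennreal (1 / exp 2) * (ennreal (exp 2) * ?P)" using * by (rule mult_left_mono) simp
    also have "\<dots> = ?P" unfolding mult.assoc[symmetric] 2 by simp
    finally show ?thesis .
  qed
  then show thesis using pE by (intro that[of "prob E / exp 2"]) auto
qed

end

section \<open>Failure of the Markov property\<close>

context brownian
begin

text \<open>\<nu> is the law of the measurable version of \<open>X 6\<close> restricted to
  \<open>stay_low 1 \<delta>\<close>, an event that almost surely contains
  \<open>X 1 \<le> \<delta>\<close>. Its bound on intervals carries over to Borel sets.\<close>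

lemma small_value_density:
  assumes d: "0 < \<delta>" "\<delta> \<le> 1/4" and X1: "X 1 \<in> borel_measurable M" and X6: "X 6 \<in> borel_measurable M"
    and D[measurable]: "D \<in> sets borel" and D1: "D \<subseteq> {1..3/2}"
  shows "emeasure M {\<omega>\<in>space M. X 1 \<omega> \<le> \<delta> \<and> X 6 \<omega> \<in> D} \<le>
    ennreal ((exp (5/2) + 4 * exp 1) * (384 * \<delta> ^ 4)) * emeasure lborel D"
proof -
  note [measurable] = X1 X6
  have slow[measurable]: "stay_low 1 \<delta> \<in> sets M" using F_sets_M[OF stay_low_measurable[of 1 \<delta>]] by simp
  define \<nu> where "\<nu> = distr (density M (indicator (stay_low 1 \<delta>))) borel (\<lambda>\<omega>. path_X (path \<omega>))"
  have \<nu>: "emeasure \<nu> A = emeasure M {\<omega>\<in>stay_low 1 \<delta>. path_X (path \<omega>) \<in> A}" if [measurable]: "A \<in> sets borel" for A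
  proof -
    have sub: "stay_low 1 \<delta> \<subseteq> space M" by (rule sets.sets_into_space[OF slow])
    have "emeasure \<nu> A = emeasure (density M (indicator (stay_low 1 \<delta>))) ((\<lambda>\<omega>. path_X (path \<omega>)) -` A \<inter> space M)"
      unfolding \<nu>_def by (subst emeasure_distr) auto
    also have "\<dots> = emeasure M (stay_low 1 \<delta> \<inter> ((\<lambda>\<omega>. path_X (path \<omega>)) -` A \<inter> space M))"
      by (subst emeasure_density) (auto simp: indicator_inter_arith[symmetric])
    also have "stay_low 1 \<delta> \<inter> ((\<lambda>\<omega>. path_X (path \<omega>)) -` A \<inter> space M) = {\<omega>\<in>stay_low 1 \<delta>. path_X (path \<omega>) \<in> A}"
      using sub by auto
    finally show ?thesis .
  qed
  let ?K = "(exp (5/2) + 4 * exp 1) * (384 * \<delta> ^ 4) :: real"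
  have K0: "0 \<le> ?K" using d by (intro mult_nonneg_nonneg add_nonneg_nonneg) auto
  have "emeasure \<nu> D \<le> ennreal ?K * emeasure lborel D"
  proof (rule emeasure_le_lborel[OF _ K0 _ D D1])
    show "sets \<nu> = sets borel" by (simp add: \<nu>_def)
    fix l r :: real assume lr: "l \<le> r"
    have "emeasure \<nu> {l..r} \<le> ennreal ((r - l) * (exp (5/2) + 4 * exp 1)) * emeasure M (stay_low 1 \<delta>)"
      unfolding \<nu>[OF borel_closed[OF closed_atLeastAtMost]] by (rule stay_low_density[OF lr])
    also have "\<dots> \<le> ennreal ((r - l) * (exp (5/2) + 4 * exp 1)) * ennreal (384 * \<delta> ^ 4)"
      by (intro mult_left_mono stay_low_bound d) auto
    also have "\<dots> = ennreal (?K * (r - l))"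
      using lr d by (subst ennreal_mult[symmetric]) (auto simp: mult_ac intro!: mult_nonneg_nonneg add_nonneg_nonneg)
    finally show "emeasure \<nu> {l..r} \<le> ennreal (?K * (r - l))" .
  qed
  moreover have "emeasure M {\<omega>\<in>space M. X 1 \<omega> \<le> \<delta> \<and> X 6 \<omega> \<in> D} \<le> emeasure \<nu> D"
    unfolding \<nu>[OF D]
  proof (rule emeasure_mono_AE)
    show "AE \<omega> in M. \<omega> \<in> {\<omega>\<in>space M. X 1 \<omega> \<le> \<delta> \<and> X 6 \<omega> \<in> D} \<longrightarrow> \<omega> \<in> {\<omega>\<in>stay_low 1 \<delta>. path_X (path \<omega>) \<in> D}"
      using AE_small_value[of 1 \<delta>] AE_path_X d by auto
  qed measurable
  ultimately show ?thesis by (rule order_trans[rotated])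
qed

lemma small_value_bound:
  assumes e: "0 < \<epsilon>" "\<epsilon> \<le> 1/4" and X8: "X 8 \<in> borel_measurable M"
  shows "prob {\<omega>\<in>space M. X 8 \<omega> \<le> \<epsilon> ^ 4} \<le> 5376 * \<epsilon> ^ 17"
proof -
  let ?\<delta> = "\<epsilon> ^ 4"
  have d: "0 < ?\<delta>" using e by simp
  have "emeasure M {\<omega>\<in>space M. X 8 \<omega> \<le> ?\<delta>} \<le> emeasure M (stay_low 8 ?\<delta> \<inter> below (2 * ?\<delta> + 2) 0 (8 + 1) (8 + 1 + 1 / ?\<delta>))"
  proof (rule emeasure_mono_AE)
    show "AE \<omega> in M. \<omega> \<in> {\<omega>\<in>space M. X 8 \<omega> \<le> ?\<delta>} \<longrightarrow> \<omega> \<in> stay_low 8 ?\<delta> \<inter> below (2 * ?\<delta> + 2) 0 (8 + 1) (8 + 1 + 1 / ?\<delta>)"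
      using AE_small_value[of 8 ?\<delta>] d by auto
    show "stay_low 8 ?\<delta> \<inter> below (2 * ?\<delta> + 2) 0 (8 + 1) (8 + 1 + 1 / ?\<delta>) \<in> sets M"
      by (intro sets.Int F_sets_M[OF stay_low_measurable] F_sets_M[OF below_measurable]) (use d in auto)
  qed
  also have "\<dots> \<le> ennreal (5376 * \<epsilon> ^ 17)" by (rule stay_low_long_bound) (use e in auto)
  finally show ?thesis using e by (simp add: emeasure_eq_measure)
qed

text \<open>\<open>AC\<close> belongs to the past of time 6 and \<open>H\<close> depends on
  \<open>X 8\<close>, so under the Markov property the probability of \<open>AC \<inter> H\<close>
  is the integral over \<open>AC\<close> of \<open>g\<close>, the conditional probability of
  \<open>H\<close> given \<open>X 6\<close>. Since \<open>AC\<close> has conditional probability at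
  most \<kappa> given \<open>X 6\<close>, it is at most \<kappa> times the probability of
  \<open>H\<close>. Regular conditional laws are avoided by comparing measures on the sets of
  \<open>T\<close>.\<close>

lemma markov_bound:
  assumes mk: "markov_process M X" and e: "0 < \<epsilon>" "\<epsilon> \<le> 1/4" and c: "0 < c"
    and low: "\<And>D. D \<in> sets borel \<Longrightarrow> D \<subseteq> {1..3/2} \<Longrightarrow>
      ennreal c * emeasure lborel D \<le> emeasure M {\<omega>\<in>space M. path_X (path \<omega>) \<in> D}"
  shows "prob {\<omega>\<in>space M. X 1 \<omega> \<le> \<epsilon> ^ 4 \<and> X 6 \<omega> \<in> {1..3/2} \<and> X 8 \<omega> \<le> \<epsilon> ^ 4} \<le>
    (exp (5/2) + 4 * exp 1) * 384 * 5376 / c * \<epsilon> ^ 33"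
proof -
  have Xm: "X t \<in> borel_measurable M" if "0 \<le> t" for t
    using mk that unfolding markov_process_def by blast
  have X1[measurable]: "X 1 \<in> borel_measurable M" and X6[measurable]: "X 6 \<in> borel_measurable M" and X8[measurable]: "X 8 \<in> borel_measurable M"
    using Xm by auto
  define \<delta> where "\<delta> = \<epsilon> ^ 4"
  have d: "0 < \<delta>" "\<delta> \<le> 1/4"
  proof -
    show "0 < \<delta>" using e by (simp add: \<delta>_def)
    have "\<epsilon> ^ 4 \<le> (1/4) ^ 4" using e by (intro power_mono) auto
    then show "\<delta> \<le> 1/4" by (simp add: \<delta>_def power4_eq_xxxx)
  qed
  let ?K = "(exp (5/2) + 4 * exp 1) * (384 * \<delta> ^ 4) :: real"
  have K0: "0 \<le> ?K" using d by (intro mult_nonneg_nonneg add_nonneg_nonneg) auto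
  define \<kappa> where "\<kappa> = ?K / c"
  have k0: "0 \<le> \<kappa>" using K0 c by (simp add: \<kappa>_def)
  define S where "S = gen_sigma M X {0..6}"
  define T where "T = gen_sigma M X {6}"
  have subS: "subalgebra M S" unfolding subalgebra_def S_def
    using sets_gen_sigma_least[of "{0..6}" X M M] Xm by auto
  have subT: "subalgebra M T" unfolding subalgebra_def T_def
    using sets_gen_sigma_least[of "{6}" X M M] Xm by auto
  interpret S: finite_measure_subalgebra M S by unfold_locales (rule subS)
  interpret T: finite_measure_subalgebra M T by unfold_locales (rule subT)
  define AC where "AC = {\<omega>\<in>space M. X 1 \<omega> \<le> \<delta> \<and> X 6 \<omega> \<in> {1..3/2}}"
  define H where "H = {\<omega>\<in>space M. X 8 \<omega> \<in> {..\<delta>}}"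
  have ACS: "AC \<in> sets S"
  proof -
    have [measurable]: "X 1 \<in> borel_measurable S" "X 6 \<in> borel_measurable S"
      unfolding S_def by (rule measurable_gen_sigma, simp)+
    have "{\<omega>\<in>space S. X 1 \<omega> \<le> \<delta> \<and> X 6 \<omega> \<in> {1..3/2}} \<in> sets S" by measurable
    then show ?thesis by (simp add: AC_def S_def)
  qed
  have ACM[measurable]: "AC \<in> sets M" using ACS subS by (auto simp: subalgebra_def)
  have HM[measurable]: "H \<in> sets M" unfolding H_def by measurable
  let ?h = "indicator H :: 'a \<Rightarrow> real"
  define g where "g = real_cond_exp M T ?h"
  have h: "integrable M ?h" by (intro integrable_real_indicator) (auto simp: emeasure_eq_measure)
  have gT[measurable]: "g \<in> borel_measurable T" unfolding g_def by (rule borel_measurable_cond_exp)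
  have gM[measurable]: "g \<in> borel_measurable M" by (rule measurable_from_subalg[OF subT gT])
  have g0: "AE \<omega> in M. 0 \<le> g \<omega>" unfolding g_def by (rule T.real_cond_exp_pos) auto
  have gi: "integrable M g" and gint: "(\<integral>\<omega>. g \<omega> \<partial>M) = prob H"
    unfolding g_def using T.real_cond_exp_int[OF h] by auto
  have mkv: "AE \<omega> in M. real_cond_exp M S ?h \<omega> = g \<omega>"
  proof -
    have "\<forall>s t A. 0 \<le> s \<longrightarrow> s \<le> t \<longrightarrow> A \<in> sets borel \<longrightarrow>
        (AE \<omega> in M.
           real_cond_exp M (gen_sigma M X {0..s}) (indicator {\<omega>\<in>space M. X t \<omega> \<in> A}) \<omega> =
           real_cond_exp M (gen_sigma M X {s}) (indicator {\<omega>\<in>space M. X t \<omega> \<in> A}) \<omega>)"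
      using mk unfolding markov_process_def by (rule conjunct2)
    note this[rule_format, of 6 8 "{..\<delta>}"]
    then show ?thesis unfolding g_def S_def T_def H_def by fastforce
  qed
  have "prob (AC \<inter> H) = (\<integral>\<omega>\<in>AC. ?h \<omega> \<partial>M)"
    unfolding set_lebesgue_integral_def by (simp add: indicator_inter_arith[symmetric] Int_commute)
  also have "\<dots> = (\<integral>\<omega>\<in>AC. real_cond_exp M S ?h \<omega> \<partial>M)" by (rule S.real_cond_exp_intA[OF h ACS])
  also have "\<dots> = (\<integral>\<omega>. indicator AC \<omega> * g \<omega> \<partial>M)"
    unfolding set_lebesgue_integral_def using mkv by (intro integral_cong_AE) auto
  finally have "ennreal (prob (AC \<inter> H)) = ennreal (\<integral>\<omega>. indicator AC \<omega> * g \<omega> \<partial>M)" by simp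
  also have "\<dots> = (\<integral>\<^sup>+\<omega>. ennreal (indicator AC \<omega> * g \<omega>) \<partial>M)"
  proof (rule nn_integral_eq_integral[symmetric])
    show "integrable M (\<lambda>\<omega>. indicator AC \<omega> * g \<omega>)" using integrable_mult_indicator[OF ACM gi] by simp
    show "AE \<omega> in M. 0 \<le> indicator AC \<omega> * g \<omega>" using g0 by eventually_elim auto
  qed
  also have "\<dots> = (\<integral>\<^sup>+\<omega>. indicator AC \<omega> * ennreal (g \<omega>) \<partial>M)"
    by (intro nn_integral_cong) (auto split: split_indicator)
  \<comment> \<open>It is enough to compare on preimages under \<open>X 6\<close>. There the upper
    density bound for \<open>AC\<close>, divided by the lower density bound \<open>c\<close>, gives
    \<kappa>.\<close>
  also have "\<dots> \<le> (\<integral>\<^sup>+\<omega>. ennreal \<kappa> * ennreal (g \<omega>) \<partial>M)"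
  proof (rule nn_integral_domination_subalgebra[OF subT])
    fix E assume "E \<in> sets T"
    then obtain D where D[measurable]: "D \<in> sets borel" and E: "E = X 6 -` D \<inter> space M"
      unfolding T_def sets_gen_sigma_single by auto
    have EM[measurable]: "E \<in> sets M" unfolding E by (rule measurable_sets[OF X6 D])
    let ?D = "D \<inter> {1..3/2}"
    have D1: "?D \<subseteq> {1..3/2}" and Dm[measurable]: "?D \<in> sets borel" by auto
    have "(\<integral>\<^sup>+\<omega>. indicator AC \<omega> * indicator E \<omega> \<partial>M) = emeasure M (AC \<inter> E)"
      by (subst indicator_inter_arith[symmetric]) auto
    also have "AC \<inter> E = {\<omega>\<in>space M. X 1 \<omega> \<le> \<delta> \<and> X 6 \<omega> \<in> ?D}"
      by (auto simp: AC_def E)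
    finally have "(\<integral>\<^sup>+\<omega>. indicator AC \<omega> * indicator E \<omega> \<partial>M) = emeasure M {\<omega>\<in>space M. X 1 \<omega> \<le> \<delta> \<and> X 6 \<omega> \<in> ?D}" .
    also have "\<dots> \<le> ennreal ?K * emeasure lborel ?D"
      by (rule small_value_density[OF d X1 X6 Dm D1])
    also have "ennreal ?K = ennreal \<kappa> * ennreal c"
      using c k0 by (subst ennreal_mult[symmetric]) (auto simp: \<kappa>_def)
    also have "ennreal \<kappa> * ennreal c * emeasure lborel ?D \<le> ennreal \<kappa> * emeasure M {\<omega>\<in>space M. path_X (path \<omega>) \<in> ?D}"
      unfolding mult.assoc by (intro mult_left_mono low Dm D1) auto
    also have "emeasure M {\<omega>\<in>space M. path_X (path \<omega>) \<in> ?D} \<le> emeasure M E"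
      by (rule emeasure_mono_AE) (use AE_path_X in \<open>auto simp: E elim!: eventually_mono\<close>)
    finally have *: "(\<integral>\<^sup>+\<omega>. indicator AC \<omega> * indicator E \<omega> \<partial>M) \<le> ennreal \<kappa> * emeasure M E"
      by (simp add: mult_left_mono)
    also have "\<dots> = (\<integral>\<^sup>+\<omega>. ennreal \<kappa> * indicator E \<omega> \<partial>M)"
      by (rule nn_integral_cmult_indicator[symmetric]) (rule EM)
    finally show "(\<integral>\<^sup>+\<omega>. indicator AC \<omega> * indicator E \<omega> \<partial>M) \<le> (\<integral>\<^sup>+\<omega>. ennreal \<kappa> * indicator E \<omega> \<partial>M)" .
  qed measurable
  also have "\<dots> = ennreal \<kappa> * (\<integral>\<^sup>+\<omega>. ennreal (g \<omega>) \<partial>M)" by (rule nn_integral_cmult) measurable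
  also have "(\<integral>\<^sup>+\<omega>. ennreal (g \<omega>) \<partial>M) = ennreal (prob H)"
    using nn_integral_eq_integral[OF gi g0] gint by simp
  finally have "prob (AC \<inter> H) \<le> \<kappa> * prob H"
    using k0 by (simp add: ennreal_mult[symmetric])
  also have "\<dots> \<le> \<kappa> * (5376 * \<epsilon> ^ 17)"
    using small_value_bound[OF e X8] by (intro mult_left_mono k0) (simp add: H_def \<delta>_def)
  also have "\<dots> = (exp (5/2) + 4 * exp 1) * 384 * 5376 / c * \<epsilon> ^ 33"
  proof -
    have "\<delta> ^ 4 * \<epsilon> ^ 17 = \<epsilon> ^ 33" by (simp add: \<delta>_def power_mult[symmetric] power_add[symmetric])
    then show ?thesis by (simp add: \<kappa>_def mult_ac)
  qed
  also have "AC \<inter> H = {\<omega>\<in>space M. X 1 \<omega> \<le> \<epsilon> ^ 4 \<and> X 6 \<omega> \<in> {1..3/2} \<and> X 8 \<omega> \<le> \<epsilon> ^ 4}"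
    by (auto simp: AC_def H_def \<delta>_def)
  finally show ?thesis .
qed

lemma not_markov: "\<not> markov_process M X"
proof
  assume mk: "markov_process M X"
  have Xm: "X t \<in> borel_measurable M" if "0 \<le> t" for t
    using mk that unfolding markov_process_def by blast
  have [measurable]: "X 1 \<in> borel_measurable M" "X 6 \<in> borel_measurable M" "X 8 \<in> borel_measurable M"
    using Xm by auto
  obtain c where c: "0 < c" "\<And>\<delta>. 0 < \<delta> \<Longrightarrow> \<delta> \<le> 1/64 \<Longrightarrow> \<exists>E\<in>sets M. E \<subseteq> low_event \<delta> \<and> c * \<delta> ^ 8 \<le> prob E"
    by (rule low_event_bound) blast
  obtain c' where c': "0 < c'" "\<And>D. D \<in> sets borel \<Longrightarrow> D \<subseteq> {1..3/2} \<Longrightarrow>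
    ennreal c' * emeasure lborel D \<le> emeasure M {\<omega>\<in>space M. path_X (path \<omega>) \<in> D}"
    by (rule path_X_density_lower) blast
  define l where "l = c / 19 ^ 8"
  define R where "R = (exp (5/2) + 4 * exp 1) * 384 * 5376 / c'"
  have l: "0 < l" using c by (simp add: l_def)
  have R: "0 < R" unfolding R_def using c' by (intro divide_pos_pos mult_pos_pos add_pos_pos) auto
  \<comment> \<open>The joint event has probability at least \<open>l * \<epsilon> ^ 32\<close> and,
    under the Markov property, at most \<open>R * \<epsilon> ^ 33\<close>. Both constants are
    independent of \<epsilon>.\<close>
  have main: "l \<le> R * \<epsilon>" if e: "0 < \<epsilon>" "\<epsilon> \<le> 1/4" for \<epsilon>
  proof -
    \<comment> \<open>The factor 19 is the larger of the two constants in
      \<open>low_path_values\<close>, so that \<open>low_event d\<close> forces both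
      \<open>X 1\<close> and \<open>X 8\<close> below \<open>\<epsilon> ^ 4\<close>.\<close>
    define d where "d = \<epsilon> ^ 4 / 19"
    have "19 * d = \<epsilon> ^ 4" by (simp add: d_def)
    have "\<epsilon> ^ 4 \<le> (1/4) ^ 4" using e by (intro power_mono) auto
    then have d: "0 < d" "d \<le> 1/64" using e by (auto simp: d_def power4_eq_xxxx)
    obtain E where E: "E \<in> sets M" "E \<subseteq> low_event d" "c * d ^ 8 \<le> prob E" using c(2)[OF d] by blast
    have "prob E \<le> prob {\<omega>\<in>space M. X 1 \<omega> \<le> \<epsilon> ^ 4 \<and> X 6 \<omega> \<in> {1..3/2} \<and> X 8 \<omega> \<le> \<epsilon> ^ 4}"
    proof (rule finite_measure_mono)
      show "E \<subseteq> {\<omega>\<in>space M. X 1 \<omega> \<le> \<epsilon> ^ 4 \<and> X 6 \<omega> \<in> {1..3/2} \<and> X 8 \<omega> \<le> \<epsilon> ^ 4}"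
      proof
        fix \<omega> assume "\<omega> \<in> E"
        then have w: "\<omega> \<in> low_event d" using E by auto
        then have sp: "\<omega> \<in> space M" by (simp add: low_event_def)
        have "X 1 \<omega> \<le> 5 * d" "X 8 \<omega> \<le> 19 * d" "X 6 \<omega> \<in> {1..3/2}"
          by (rule low_path_values[OF d]; use w sp in \<open>auto simp: low_event_def B_zero\<close>)+
        then show "\<omega> \<in> {\<omega>\<in>space M. X 1 \<omega> \<le> \<epsilon> ^ 4 \<and> X 6 \<omega> \<in> {1..3/2} \<and> X 8 \<omega> \<le> \<epsilon> ^ 4}"
          using sp d(1) \<open>19 * d = \<epsilon> ^ 4\<close> by simp
      qed
    qed measurable
    also have "\<dots> \<le> R * \<epsilon> ^ 33"
      unfolding R_def by (rule markov_bound[OF mk e c'])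
    finally have "c * d ^ 8 \<le> R * \<epsilon> ^ 33" using E(3) by linarith
    moreover have "c * d ^ 8 = \<epsilon> ^ 32 * l" by (simp add: d_def l_def power_divide power_mult[symmetric])
    moreover have "R * \<epsilon> ^ 33 = \<epsilon> ^ 32 * (R * \<epsilon>)" by (simp add: numeral_eq_Suc)
    ultimately have "\<epsilon> ^ 32 * l \<le> \<epsilon> ^ 32 * (R * \<epsilon>)" by simp
    then show ?thesis using e by (simp only: mult_le_cancel_left_pos zero_less_power)
  qed
  define \<epsilon> where "\<epsilon> = min (1/4) (l / (2 * R))"
  have "0 < \<epsilon>" "\<epsilon> \<le> 1/4" using l R by (auto simp: \<epsilon>_def)
  then have "l \<le> R * \<epsilon>" by (rule main)
  also have "\<dots> \<le> R * (l / (2 * R))" using R by (intro mult_left_mono) (auto simp: \<epsilon>_def)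
  also have "\<dots> = l / 2" using R by simp
  finally show False using l by simp
qed

end

theorem theorem1p1:
  fixes M :: "'a measure" and B :: "real \<Rightarrow> 'a \<Rightarrow> real"
  assumes "brownian_motion M B"
  shows "\<not> markov_process M (\<lambda>t \<omega>. 2 * concave_majorant (\<lambda>s. B s \<omega>) t - B t \<omega>)"
proof -
  interpret prob_space M using assms by (simp add: brownian_motion_def)
  interpret brownian M B by unfold_locales (rule assms)
  show ?thesis by (rule not_markov)
qed

end
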